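(* For every integer $g\ge 0$, the generating function $\mathbf{C}^{[2]}_g(z)=\sum_{n\ge 0}\mathbf{c}^{[2]}_g(n)z^n$ is a rational function with integer coefficients of the form $$\mathbf{C}_g^{[2]}(z)=\frac{P_g^{[2]}(z)}{(1-4z)^{3g+2}},$$ where $P_g^{[2]}(z)$ is a polynomial with integer coefficients of degree at most $3g+1$, satisfying $P_g^{[2]}(1/4)>0$ and $[z^h]P_g^{[2]}(z)=0$ for $0\le h\le 2g$. Furthermore, $$P_g^{[2]}(z)=z^{-1}P_{g+1}(z)-\sum_{g_1=1}^{g}P_{g_1}(z)P_{g+1-g_1}(z),$$ $$[z^{2g+1}]P^{[2]}_g(z)=\mathbf{c}^{[2]}_g(2g+1)=\mathbf{c}_{g+1}(2g+2)=\frac{(4g+4)!}{4^{g+1}(2g+3)!},$$ and as $n\to\infty$, $$[z^n]\mathbf{C}_g^{[2]}(z)\sim \frac{P_g^{[2]}(1/4)}{\Gamma(3g+2)}\,n^{3g+1}4^n.$$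
   Context: For a power series $T(z)$, $[z^i]T(z)$ denotes the coefficient of $z^i$. Permutations are composed right to left. One-backbone chord diagrams: a chord diagram on one backbone with $n\ge 0$ chords is a fixed-point-free involution $\iota$ of $\{1,\dots,2n\}$ (the $2n$ points in order along an oriented interval, paired into $n$ chords). With $\tau=(1,2,\dots,2n)$, let $r$ be the number of disjoint cycles of $\tau\circ\iota$; the genus is $g=(n+1-r)/2$ (for $n=0$ there is one diagram, of genus $0$). Let $\mathbf{c}_g(n)$ be the number of such diagrams with $n$ chords and genus $g$, and $\mathbf{C}_g(z)=\sum_{n\ge0}\mathbf{c}_g(n)z^n$. It is known (earlier work) that for each $g\ge1$ there is a polynomial $P_g(z)$ with integer coefficients (divisible by $z^{2g}$, of degree at most $3g-1$) such that $\mathbf{C}_g(z)=P_g(z)/(1-4z)^{3g-1/2}$; $P_g$ denotes this polynomial. Two-backbone chord diagrams: for $n\ge1$, a chord diagram on two backbones with $n$ chords consists of an integer $c$ with $1\le c\le 2n-1$ (points $1,\dots,c$ lie in order on the first oriented interval and $c+1,\dots,2n$ in order on the second, the first interval lying to the left of the second on the real line) together with a fixed-point-free involution $\iota$ of $\{1,\dots,2n\}$ (the chords). It is connected if the graph formed by the two intervals and the chords is connected, i.e. some chord joins a point in $\{1,\dots,c\}$ to a point in $\{c+1,\dots,2n\}$. Let $\tau_c=(1,\dots,c)\circ(c+1,\dots,2n)$ and $r$ the number of disjoint cycles of $\tau_c\circ\iota$; the genus of a connected such diagram is $g=(n-r)/2$. Let $\mathbf{c}^{[2]}_g(n)$ be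 the number of connected chord diagrams on two backbones with $n$ chords and genus $g$ (and $\mathbf{c}^{[2]}_g(0)=0$). *)

theory Defs
  imports "HOL-Analysis.Analysis" "HOL-Library.Landau_Symbols"
    "HOL-Computational_Algebra.Polynomial_FPS" "HOL-Combinatorics.Permutations"
begin

definition num_cycles :: "(nat \<Rightarrow> nat) \<Rightarrow> nat set \<Rightarrow> nat" where
  "num_cycles \<sigma> S = card ((\<lambda>x. {(\<sigma> ^^ k) x | k. True}) ` S)"

definition fpf_inv :: "nat \<Rightarrow> (nat \<Rightarrow> nat) \<Rightarrow> bool" where
  "fpf_inv n \<iota> \<longleftrightarrow> \<iota> permutes {1..2*n} \<and>
     (\<forall>x\<in>{1..2*n}. \<iota> x \<noteq> x \<and> \<iota> (\<iota> x) = x)"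

definition tau1 :: "nat \<Rightarrow> nat \<Rightarrow> nat" where
  "tau1 n x = (if x \<in> {1..2*n} then (if x = 2*n then 1 else x + 1) else x)"

definition tau2 :: "nat \<Rightarrow> nat \<Rightarrow> nat \<Rightarrow> nat" where
  "tau2 n c x = (if x \<in> {1..c} then (if x = c then 1 else x + 1)
                 else if x \<in> {c+1..2*n} then (if x = 2*n then c + 1 else x + 1)
                 else x)"

text \<open>c_g(n): one-backbone chord diagrams with n chords and genus g,
  g = (n+1-r)/2; by convention one diagram of genus 0 for n = 0.\<close>
definition cnum :: "nat \<Rightarrow> nat \<Rightarrow> nat" where
  "cnum g n = (if n = 0 then (if g = 0 then 1 else 0)
     else card {\<iota>. fpf_inv n \<iota> \<and>
        int n + 1 - int (num_cycles (tau1 n \<circ> \<iota>) {1..2*n}) = 2 * int g})"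

text \<open>c^[2]_g(n): connected two-backbone chord diagrams with n chords and genus g,
  g = (n-r)/2; c^[2]_g(0) = 0.\<close>
definition cnum2 :: "nat \<Rightarrow> nat \<Rightarrow> nat" where
  "cnum2 g n = (if n = 0 then 0
     else card {(c, \<iota>). 1 \<le> c \<and> c \<le> 2*n - 1 \<and> fpf_inv n \<iota> \<and>
        (\<exists>x\<in>{1..c}. \<iota> x \<in> {c+1..2*n}) \<and>
        int n - int (num_cycles (tau2 n c \<circ> \<iota>) {1..2*n}) = 2 * int g})"

definition Cgf :: "nat \<Rightarrow> int fps" where
  "Cgf g = Abs_fps (\<lambda>n. int (cnum g n))"

definition C2gf :: "nat \<Rightarrow> int fps" where
  "C2gf g = Abs_fps (\<lambda>n. int (cnum2 g n))"

definition inv_sqrt_1m4z :: "int fps" where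
  "inv_sqrt_1m4z = Abs_fps (\<lambda>k. int ((2*k) choose k))"

text \<open>P_g(z) = C_g(z) (1-4z)^(3g-1/2) = C_g(z) (1-4z)^(3g) (1-4z)^(-1/2),
  as a formal power series (a polynomial for g >= 1 by earlier work).\<close>
definition Pfps :: "nat \<Rightarrow> int fps" where
  "Pfps g = Cgf g * (1 - 4 * fps_X) ^ (3*g) * inv_sqrt_1m4z"

end

theory Submission
  imports Defs "HOL-Combinatorics.Orbits" "HOL-Real_Asymp.Real_Asymp"
begin

text \<open>Deleting the chord \<open>(1, c + 2)\<close> of a one-backbone diagram with \<open>n + 1\<close> chords cuts the
  backbone into pieces with \<open>c\<close> and \<open>2n - c\<close> endpoints and preserves the number of boundary cycles.
  The result is either a connected two-backbone diagram of genus one less or a pair of one-backbone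
  diagrams, so that \<open>C_(g+1) = z C2_g + z \<Sum> C_i C_(g+1-i)\<close>, while \<open>1 - 2 z C_0\<close> is the square root of
  \<open>1 - 4z\<close>.

  Polynomiality of \<open>P_g\<close>, the extreme coefficients and the values \<open>P_g(1/4)\<close> all come from the Harer-Zagier
  recursion. For it, write the indicator of the cyclic permutations as a combination, over subsets \<open>B\<close>,
  of the functions \<open>\<sigma> \<mapsto> (-1)^cyc(\<sigma>|B)\<close> on the stabiliser of \<open>B\<close>. Averaged against
  \<open>x^cyc(\<sigma>\<iota>)\<close>, a chord of \<open>\<iota>\<close> inside \<open>B\<close> or inside its complement contributes only a sign, and two
  chords crossing between \<open>B\<close> and its complement give zero. What remains is a convolution of Hermite-like
  series, which satisfies a third-order differential equation equivalent to the recursion.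
  Positivity of \<open>P2_g(1/4)\<close> follows from the log-convexity of \<open>P_g(1/4)\<close>.\<close>

section \<open>Counting cycles\<close>

text \<open>The signed functions attached to \<open>B\<close> are, up to a sign depending only on
  the size of \<open>B\<close>, the sign character on \<open>B\<close> times the trivial one on the
  complement. Induced to the full symmetric group this is a sum of at most two hook characters, and
  hooks are the only irreducible characters that do not vanish on a full cycle; subsets thus stand
  in for character theory. The weight \<open>card B\<close> marks a point, without which the signs
  would cancel completely.

  \<open>Pfps g\<close> is only a power series at the outset. In the equation for genus g+1 every
  derivative carries a factor 1 - 4z, so at z = 1/4 it collapses to
  \<open>Pval (Suc g) = Pratio g * Pval g\<close>. Two of the three operators building its
  right-hand side lose their leading term, which together with the factor z^2 raises the degree
  bound by exactly three per genus.

  Monotone ratios bound each of the g products P_i P_(g+1-i) at 1/4 by the extreme one P_1 P_g.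
  Since P_1(1/4) = 1/16, a linear lower bound g/64 on the ratio is enough for positivity.\<close>

abbreviation swap :: "nat \<Rightarrow> nat \<Rightarrow> nat \<Rightarrow> nat" where
  "swap \<equiv> Transposition.transpose"

lemma num_cycles_orbit: "permutation \<sigma> \<Longrightarrow> num_cycles \<sigma> S = card (orbit \<sigma> ` S)"
  unfolding num_cycles_def by (simp add: orbit_altdef_permutation)

lemma orbit_eq_iff:
  assumes "permutation \<sigma>"
  shows "orbit \<sigma> x = orbit \<sigma> y \<longleftrightarrow> y \<in> orbit \<sigma> x"
  by (metis assms cyclic_on_orbit' orbit_cyclic_eq3 permutation_self_in_orbit)

lemma permutation_comp_swap: "permutation \<sigma> \<Longrightarrow> permutation (\<sigma> \<circ> swap a b)"
  by (simp add: permutation_compose permutation_swap_id)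

text \<open>From \<open>a\<close> the product moves to \<open>\<sigma> b\<close>, runs through the
  cycle of \<open>b\<close> until it is back at \<open>b\<close>, and only then continues with
  \<open>\<sigma> a\<close>: the two cycles are spliced, and no other cycle is affected.\<close>

lemma orbit_comp_swap_merge:
  assumes \<sigma>: "permutation \<sigma>" and b: "b \<notin> orbit \<sigma> a"
  shows "orbit (\<sigma> \<circ> swap a b) a = orbit \<sigma> a \<union> orbit \<sigma> b"
    and "orbit (\<sigma> \<circ> swap a b) b = orbit \<sigma> a \<union> orbit \<sigma> b"
    and "x \<notin> orbit \<sigma> a \<union> orbit \<sigma> b \<Longrightarrow> orbit (\<sigma> \<circ> swap a b) x = orbit \<sigma> x"
proof -
  \<comment> \<open>Stated for arbitrary points, since the same inclusion is used again with the two
    points exchanged.\<close>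
  have *: "orbit \<sigma> b \<subseteq> orbit (\<sigma> \<circ> swap a b) a" if b: "b \<notin> orbit \<sigma> a" for a b
  proof
    let ?s = "\<sigma> \<circ> swap a b"
    have a: "a \<notin> orbit \<sigma> b" using b orbit_eq_iff[OF \<sigma>] by metis
    fix y assume "y \<in> orbit \<sigma> b"
    then show "y \<in> orbit ?s a"
    proof (induction rule: orbit.induct)
      case base
      then show ?case using orbit.base[of ?s a] by (simp add: comp_def)
    next
      case (step y)
      then have "y \<noteq> a" using a by auto
      then show ?case
        using orbit.base[of ?s a] orbit.step[OF step.IH] by (cases "y = b") (auto simp: comp_def)
    qed
  qed
  let ?s = "\<sigma> \<circ> swap a b"
  let ?U = "orbit \<sigma> a \<union> orbit \<sigma> b"
  have s: "permutation ?s" using \<sigma> by (rule permutation_comp_swap)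
  have a: "a \<notin> orbit \<sigma> b" using b orbit_eq_iff[OF \<sigma>] by metis
  have self: "a \<in> orbit \<sigma> a" "b \<in> orbit \<sigma> b" by (rule permutation_self_in_orbit[OF \<sigma>])+
  have 1: "orbit \<sigma> b \<subseteq> orbit ?s a" using *[OF b] .
  have 2: "orbit \<sigma> a \<subseteq> orbit ?s b" using *[OF a] by (simp add: transpose_commute)
  have 3: "orbit ?s a = orbit ?s b" using orbit_eq_iff[OF s, of a b] 1 self by blast
  have 4: "orbit ?s a \<subseteq> ?U"
  proof
    fix y assume "y \<in> orbit ?s a" then show "y \<in> ?U"
      by (induction rule: orbit.induct)
        (use self in \<open>auto simp: Transposition.transpose_def intro: orbit.intros\<close>)
  qed
  show "orbit ?s a = ?U" using 1 2 3 4 by auto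
  then show "orbit ?s b = ?U" using 3 by simp
  assume x: "x \<notin> ?U"
  have "a \<notin> orbit \<sigma> x" "b \<notin> orbit \<sigma> x"
    using x permutation_self_in_orbit[OF \<sigma>, of x] orbit_eq_iff[OF \<sigma>, of x a] orbit_eq_iff[OF \<sigma>, of x b]
    by auto
  then have "?s y = \<sigma> y" if "y \<in> orbit \<sigma> x" for y
    using that by (auto simp: Transposition.transpose_def)
  then show "orbit ?s x = orbit \<sigma> x"
    by (intro orbit_cong permutation_self_in_orbit \<sigma>)
qed

text \<open>With \<open>k\<close> the least number of steps from \<open>b\<close> to
  \<open>a\<close>, the product started at \<open>a\<close> visits only the points
  \<open>(\<sigma> ^^ i) b\<close> with \<open>0 < i \<le> k\<close>: on reaching \<open>a\<close>
  it jumps to \<open>\<sigma> b\<close> again. Minimality of \<open>k\<close> keeps \<open>b\<close>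
  off this list.\<close>

lemma orbit_comp_swap_split:
  assumes \<sigma>: "permutation \<sigma>" and b: "b \<in> orbit \<sigma> a" and ab: "a \<noteq> b"
  shows "b \<notin> orbit (\<sigma> \<circ> swap a b) a"
proof -
  let ?s = "\<sigma> \<circ> swap a b"
  have ex: "\<exists>k. (\<sigma> ^^ k) b = a"
  proof -
    have "a \<in> orbit \<sigma> b" by (rule orbit_swap[OF permutation_self_in_orbit[OF \<sigma>] b])
    then show ?thesis by (auto simp: orbit_altdef)
  qed
  define k where "k = (LEAST k. (\<sigma> ^^ k) b = a)"
  have k: "(\<sigma> ^^ k) b = a" unfolding k_def using ex by (rule LeastI_ex)
  have kmin: "(\<sigma> ^^ i) b \<noteq> a" if "i < k" for i
    using that not_less_Least unfolding k_def by blast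
  have bne: "(\<sigma> ^^ i) b \<noteq> b" if "0 < i" "i \<le> k" for i
  proof
    assume h: "(\<sigma> ^^ i) b = b"
    have "(\<sigma> ^^ (k - i)) ((\<sigma> ^^ i) b) = (\<sigma> ^^ (k - i + i)) b"
      by (simp only: funpow_add comp_apply)
    then have "(\<sigma> ^^ (k - i)) ((\<sigma> ^^ i) b) = a"
      using k that by simp
    then show False using kmin[of "k - i"] h that by auto
  qed
  have "\<exists>i. 0 < i \<and> i \<le> k \<and> y = (\<sigma> ^^ i) b" if "y \<in> orbit ?s a" for y
    using that
  proof (induction rule: orbit.induct)
    case base
    have "k \<noteq> 0" using k ab by (metis funpow_0)
    then show ?case by (intro exI[of _ 1]) auto
  next
    case (step y)
    then obtain i where i: "0 < i" "i \<le> k" "y = (\<sigma> ^^ i) b" by auto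
    show ?case
    proof (cases "i = k")
      case True
      then have "y = a" using i k by simp
      then show ?thesis using i by (intro exI[of _ 1]) auto
    next
      case False
      then have "y \<noteq> a" "y \<noteq> b" using i kmin[of i] bne[of i] by auto
      then show ?thesis using i False by (intro exI[of _ "Suc i"]) auto
    qed
  qed
  then show ?thesis using bne by metis
qed

lemma num_cycles_merge:
  assumes \<sigma>: "permutation \<sigma>" and S: "finite S" "a \<in> S" "b \<in> S" and b: "b \<notin> orbit \<sigma> a"
  shows "num_cycles \<sigma> S = Suc (num_cycles (\<sigma> \<circ> swap a b) S)"
proof -
  let ?s = "\<sigma> \<circ> swap a b"
  let ?U = "orbit \<sigma> a \<union> orbit \<sigma> b"
  note m = orbit_comp_swap_merge[OF \<sigma> b]
  have s: "permutation ?s" using \<sigma> by (rule permutation_comp_swap)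
  have ne: "orbit \<sigma> a \<noteq> orbit \<sigma> b" using b orbit_eq_iff[OF \<sigma>] by simp
  have o1: "orbit \<sigma> x \<in> {orbit \<sigma> a, orbit \<sigma> b}" if "x \<in> ?U" for x
    using that orbit_eq_iff[OF \<sigma>, of a x] orbit_eq_iff[OF \<sigma>, of b x] by auto
  have "orbit \<sigma> ` S = {orbit \<sigma> a, orbit \<sigma> b} \<union> orbit \<sigma> ` (S - ?U)"
    using S o1 by auto
  moreover have "{orbit \<sigma> a, orbit \<sigma> b} \<inter> orbit \<sigma> ` (S - ?U) = {}"
    using permutation_self_in_orbit[OF \<sigma>] by blast
  ultimately have 1: "num_cycles \<sigma> S = 2 + card (orbit \<sigma> ` (S - ?U))"
    using S ne by (simp add: num_cycles_orbit \<sigma> card_Un_disjoint)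
  have o2: "orbit ?s x = ?U" if "x \<in> ?U" for x
    using that m(1) orbit_eq_iff[OF s, of a x] by simp
  have "orbit ?s ` S = {?U} \<union> orbit \<sigma> ` (S - ?U)"
  proof -
    have "orbit ?s ` S = orbit ?s ` (S \<inter> ?U) \<union> orbit ?s ` (S - ?U)" by blast
    also have "orbit ?s ` (S - ?U) = orbit \<sigma> ` (S - ?U)"
      using m(3) by (intro image_cong) auto
    also have "orbit ?s ` (S \<inter> ?U) = {?U}"
      using o2 S permutation_self_in_orbit[OF \<sigma>, of a] by fastforce
    finally show ?thesis .
  qed
  moreover have "?U \<notin> orbit \<sigma> ` (S - ?U)"
    using permutation_self_in_orbit[OF \<sigma>] by blast
  ultimately have 2: "num_cycles ?s S = 1 + card (orbit \<sigma> ` (S - ?U))"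
    using S by (simp add: num_cycles_orbit s card_Un_disjoint)
  show ?thesis using 1 2 by simp
qed

lemma num_cycles_split:
  assumes \<sigma>: "permutation \<sigma>" and S: "finite S" "a \<in> S" "b \<in> S"
    and b: "b \<in> orbit \<sigma> a" "a \<noteq> b"
  shows "num_cycles (\<sigma> \<circ> swap a b) S = Suc (num_cycles \<sigma> S)"
  using num_cycles_merge[OF permutation_comp_swap[OF \<sigma>] S orbit_comp_swap_split[OF \<sigma> b]]
  by (simp add: comp_assoc)

lemma num_cycles_comp_swap_cases:
  assumes "permutation \<sigma>" "finite S" "a \<in> S" "b \<in> S" "a \<noteq> b"
  obtains "num_cycles (\<sigma> \<circ> swap a b) S = Suc (num_cycles \<sigma> S)"
  | "num_cycles \<sigma> S = Suc (num_cycles (\<sigma> \<circ> swap a b) S)"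
  using num_cycles_merge[OF assms(1-4)] num_cycles_split[OF assms(1-4) _ assms(5)] by blast

lemma minus_one_num_cycles_comp_swap:
  assumes "permutation \<sigma>" "finite S" "a \<in> S" "b \<in> S" "a \<noteq> b"
  shows "(-1 :: 'a :: comm_ring_1) ^ num_cycles (\<sigma> \<circ> swap a b) S = - ((-1) ^ num_cycles \<sigma> S)"
  using num_cycles_comp_swap_cases[OF assms] by cases auto

text \<open>Only an injection on \<open>S\<close> is asked for, so the points of a smaller diagram
  can be placed among those of a larger one; the later comparisons of boundary cycles of two
  diagrams rest on this.\<close>

lemma num_cycles_relabel:
  assumes inj: "inj_on \<phi> S" and inv: "\<And>x. x \<in> S \<Longrightarrow> \<sigma> x \<in> S"
    and eq: "\<And>x. x \<in> S \<Longrightarrow> \<sigma>' (\<phi> x) = \<phi> (\<sigma> x)"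
  shows "num_cycles \<sigma>' (\<phi> ` S) = num_cycles \<sigma> S"
proof -
  have pw: "(\<sigma> ^^ k) x \<in> S \<and> (\<sigma>' ^^ k) (\<phi> x) = \<phi> ((\<sigma> ^^ k) x)" if "x \<in> S" for k x
    by (induction k) (use that inv eq in auto)
  have "(\<lambda>x. {(\<sigma>' ^^ k) x |k. True}) ` (\<phi> ` S) = (\<lambda>A. \<phi> ` A) ` ((\<lambda>x. {(\<sigma> ^^ k) x |k. True}) ` S)"
    unfolding image_image
  proof (intro image_cong refl)
    fix x assume "x \<in> S"
    then have "(\<sigma>' ^^ k) (\<phi> x) = \<phi> ((\<sigma> ^^ k) x)" for k using pw by blast
    then show "{(\<sigma>' ^^ k) (\<phi> x) |k. True} = \<phi> ` {(\<sigma> ^^ k) x |k. True}" by auto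
  qed
  moreover have "inj_on (\<lambda>A. \<phi> ` A) ((\<lambda>x. {(\<sigma> ^^ k) x |k. True}) ` S)"
    by (rule inj_on_subset[OF inj_on_image_Pow[OF inj]]) (use pw in auto)
  ultimately show ?thesis unfolding num_cycles_def by (simp add: card_image)
qed

lemma num_cycles_cong:
  assumes "\<And>x. x \<in> S \<Longrightarrow> \<sigma> x \<in> S" "\<And>x. x \<in> S \<Longrightarrow> \<sigma>' x = \<sigma> x"
  shows "num_cycles \<sigma>' S = num_cycles \<sigma> S"
  using num_cycles_relabel[of id S \<sigma> \<sigma>'] assms by simp

lemma num_cycles_comp_commute:
  assumes "f permutes S" "g permutes S"
  shows "num_cycles (f \<circ> g) S = num_cycles (g \<circ> f) S"
proof -
  have "num_cycles (g \<circ> f) (g ` S) = num_cycles (f \<circ> g) S"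
    by (rule num_cycles_relabel) (use assms in \<open>auto simp: permutes_in_image intro: permutes_inj_on\<close>)
  then show ?thesis using assms by (simp add: permutes_image)
qed

lemma num_cycles_Un:
  assumes \<sigma>: "permutation \<sigma>" and fin: "finite S" "finite T" and dj: "S \<inter> T = {}"
    and inv: "\<And>x. x \<in> S \<Longrightarrow> \<sigma> x \<in> S"
  shows "num_cycles \<sigma> (S \<union> T) = num_cycles \<sigma> S + num_cycles \<sigma> T"
proof -
  have "orbit \<sigma> x \<subseteq> S" if "x \<in> S" for x
  proof
    fix y assume "y \<in> orbit \<sigma> x" then show "y \<in> S" by induction (use inv that in auto)
  qed
  then have "orbit \<sigma> ` S \<inter> orbit \<sigma> ` T = {}"
    using dj permutation_self_in_orbit[OF \<sigma>] by fastforce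
  then show ?thesis using fin by (simp add: num_cycles_orbit \<sigma> image_Un card_Un_disjoint)
qed

lemma num_cycles_singleton: "num_cycles \<sigma> {a} = 1"
  unfolding num_cycles_def by simp

lemma num_cycles_empty: "num_cycles \<sigma> {} = 0"
  unfolding num_cycles_def by simp

lemma num_cycles_pos: "finite S \<Longrightarrow> S \<noteq> {} \<Longrightarrow> 0 < num_cycles \<sigma> S"
  unfolding num_cycles_def by (simp add: card_gt_0_iff)

lemma num_cycles_insert_fixed:
  assumes "permutation \<sigma>" "finite S" "a \<notin> S" "\<sigma> a = a"
  shows "num_cycles \<sigma> (insert a S) = Suc (num_cycles \<sigma> S)"
  using num_cycles_Un[of \<sigma> "{a}" S] assms by (simp add: num_cycles_singleton)

text \<open>\<open>\<sigma>'\<close> is \<open>\<sigma>\<close> with \<open>a\<close>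
  short-circuited. With \<open>b\<close> the predecessor of \<open>a\<close> one has
  \<open>\<sigma> = \<sigma>' \<circ> swap a b\<close>, so the transposition merges the singleton
  cycle \<open>{a}\<close> of \<open>\<sigma>'\<close> into the cycle of \<open>b\<close>, and that
  singleton is not counted on \<open>S - {a}\<close>.\<close>

lemma num_cycles_bypass:
  assumes \<sigma>: "\<sigma> permutes S" and \<sigma>': "\<sigma>' permutes (S - {a})" and S: "finite S" "a \<in> S"
    and ne: "\<sigma> a \<noteq> a"
    and eq: "\<And>x. x \<in> S - {a} \<Longrightarrow> \<sigma>' x = (if \<sigma> x = a then \<sigma> a else \<sigma> x)"
  shows "num_cycles \<sigma>' (S - {a}) = num_cycles \<sigma> S"
proof -
  define b where "b = inv \<sigma> a"
  have b: "\<sigma> b = a" "b \<in> S" "b \<noteq> a"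
    using permutes_inverses(1)[OF \<sigma>, of a] permutes_in_image[OF permutes_inv[OF \<sigma>]] S ne
    unfolding b_def by metis+
  have p': "permutation \<sigma>'" using \<sigma>' S by (meson finite_Diff permutation_permutes)
  have a': "\<sigma>' a = a" using \<sigma>' by (simp add: permutes_not_in)
  have "\<sigma> = \<sigma>' \<circ> swap a b"
  proof
    fix x
    have inj: "\<sigma> x = a \<longleftrightarrow> x = b" using b permutes_inj[OF \<sigma>] by (metis injD)
    show "\<sigma> x = (\<sigma>' \<circ> swap a b) x"
      using inj eq[of x] eq[of b] b a' \<sigma> \<sigma>' S
      by (cases "x \<in> S") (auto simp: Transposition.transpose_def permutes_not_in)
  qed
  moreover have "orbit \<sigma>' a = {a}" using a' by (simp add: orbit_eq_singleton_iff)
  ultimately have "num_cycles \<sigma>' S = Suc (num_cycles \<sigma> S)"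
    using num_cycles_merge[OF p' S b(2)] b by simp
  moreover have "num_cycles \<sigma>' S = Suc (num_cycles \<sigma>' (S - {a}))"
    using num_cycles_insert_fixed[OF p', of "S - {a}" a] S a' by (simp add: insert_absorb)
  ultimately show ?thesis by simp
qed

section \<open>Deleting the chord at the first endpoint\<close>

text \<open>Chord systems on an arbitrary set of endpoints, because removing a chord leaves a set
  with gaps.\<close>

definition fpfs :: "nat set \<Rightarrow> (nat \<Rightarrow> nat) set" where
  "fpfs A = {\<iota>. \<iota> permutes A \<and> (\<forall>x\<in>A. \<iota> x \<noteq> x \<and> \<iota> (\<iota> x) = x)}"

lemma fpf_inv_iff_fpfs: "fpf_inv n \<iota> \<longleftrightarrow> \<iota> \<in> fpfs {1..2*n}"
  unfolding fpf_inv_def fpfs_def by simp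

lemma finite_fpfs: "finite A \<Longrightarrow> finite (fpfs A)"
  unfolding fpfs_def by (rule finite_subset[OF _ finite_permutations]) auto

lemma fpfs_empty [simp]: "fpfs {} = {id}"
  unfolding fpfs_def by auto

lemma fpfs_permutes: "\<iota> \<in> fpfs A \<Longrightarrow> \<iota> permutes A"
  by (simp add: fpfs_def)

lemma swap_comp_in_fpfs:
  assumes "a \<in> A" "b \<in> A" "a \<noteq> b" "\<iota> \<in> fpfs (A - {a, b})"
  shows "swap a b \<circ> \<iota> \<in> fpfs A"
proof -
  have p: "\<iota> permutes (A - {a, b})" using assms by (simp add: fpfs_permutes)
  have "\<iota> permutes A" by (rule permutes_subset[OF p]) auto
  then have "swap a b \<circ> \<iota> permutes A"
    using assms by (intro permutes_compose permutes_swap_id)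
  moreover have "(swap a b \<circ> \<iota>) x \<noteq> x \<and> (swap a b \<circ> \<iota>) ((swap a b \<circ> \<iota>) x) = x" if "x \<in> A" for x
  proof (cases "x \<in> {a, b}")
    case True
    then have "\<iota> a = a" "\<iota> b = b" using p by (auto simp: permutes_def)
    then show ?thesis using True assms by auto
  next
    case False
    then have x: "x \<in> A - {a, b}" using that by simp
    then have "\<iota> x \<in> A - {a, b}" using permutes_in_image[OF p] by blast
    moreover have "\<iota> x \<noteq> x" "\<iota> (\<iota> x) = x" using x assms(4) by (auto simp: fpfs_def)
    ultimately show ?thesis using x by (auto simp: Transposition.transpose_def)
  qed
  ultimately show ?thesis by (auto simp: fpfs_def)
qed

lemma swap_comp_in_fpfs':
  assumes "\<iota> \<in> fpfs A" "a \<in> A"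
  shows "swap a (\<iota> a) \<circ> \<iota> \<in> fpfs (A - {a, \<iota> a})" "\<iota> a \<in> A - {a}"
proof -
  have p: "\<iota> permutes A" and i: "\<And>x. x \<in> A \<Longrightarrow> \<iota> x \<noteq> x" "\<And>x. x \<in> A \<Longrightarrow> \<iota> (\<iota> x) = x"
    using assms by (auto simp: fpfs_def)
  show b: "\<iota> a \<in> A - {a}" using p i assms by (auto simp: permutes_in_image)
  let ?j = "swap a (\<iota> a) \<circ> \<iota>"
  have inj: "\<iota> x = \<iota> y \<longleftrightarrow> x = y" for x y using permutes_inj[OF p] by (auto dest: injD)
  have j: "?j x = \<iota> x" if "x \<notin> {a, \<iota> a}" for x
  proof -
    have "\<iota> x \<noteq> a"
    proof
      assume "\<iota> x = a"
      then have "x \<in> A" using assms permutes_in_image[OF p, of x] by simp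
      then show False using i(2)[of x] \<open>\<iota> x = a\<close> that by auto
    qed
    then show ?thesis using that inj by (auto simp: Transposition.transpose_def)
  qed
  have ja: "?j a = a" "?j (\<iota> a) = \<iota> a" using i assms by auto
  have "?j permutes A" using b assms p by (intro permutes_compose permutes_swap_id) auto
  then have "?j permutes (A - {a, \<iota> a})"
    by (rule permutes_superset) (use ja in auto)
  moreover have "?j x \<noteq> x \<and> ?j (?j x) = x" if "x \<in> A - {a, \<iota> a}" for x
  proof -
    have "\<iota> x \<in> A - {a, \<iota> a}"
      using permutes_in_image[OF calculation, of x] that j[of x] by auto
    then show ?thesis using that j[of x] j[of "\<iota> x"] i by auto
  qed
  ultimately show "?j \<in> fpfs (A - {a, \<iota> a})" by (auto simp: fpfs_def)
qed

text \<open>Sorting by the partner \<open>b\<close> of \<open>a\<close> factors each involution into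
  the chord \<open>swap a b\<close> and an involution of the remaining points. This recursion serves
  both the deletion of the first chord and the sums over all matchings below.\<close>

lemma sum_fpfs_remove:
  assumes "finite A" "a \<in> A"
  shows "(\<Sum>\<iota>\<in>fpfs A. F \<iota>) = (\<Sum>b\<in>A - {a}. \<Sum>\<iota>\<in>fpfs (A - {a, b}). F (swap a b \<circ> \<iota>))"
proof -
  have "(\<Sum>\<iota>\<in>fpfs A. F \<iota>) =
      (\<Sum>(b, \<iota>)\<in>(SIGMA b:A - {a}. fpfs (A - {a, b})). F (swap a b \<circ> \<iota>))"
  proof (rule sum.reindex_bij_witness[where i = "\<lambda>(b, \<iota>). swap a b \<circ> \<iota>"
        and j = "\<lambda>\<iota>. (\<iota> a, swap a (\<iota> a) \<circ> \<iota>)"])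
    fix \<iota> assume \<iota>: "\<iota> \<in> fpfs A"
    show "(case (\<iota> a, swap a (\<iota> a) \<circ> \<iota>) of (b, \<iota>) \<Rightarrow> swap a b \<circ> \<iota>) = \<iota>"
      by (simp add: fun_eq_iff)
    show "(\<iota> a, swap a (\<iota> a) \<circ> \<iota>) \<in> (SIGMA b:A - {a}. fpfs (A - {a, b}))"
      using swap_comp_in_fpfs'[OF \<iota> assms(2)] by auto
    show "(case (\<iota> a, swap a (\<iota> a) \<circ> \<iota>) of (b, \<iota>) \<Rightarrow> F (swap a b \<circ> \<iota>)) = F \<iota>"
      by (simp add: comp_def)
  next
    fix p assume "p \<in> (SIGMA b:A - {a}. fpfs (A - {a, b}))"
    then obtain b \<iota> where p: "p = (b, \<iota>)" "b \<in> A" "b \<noteq> a" "\<iota> \<in> fpfs (A - {a, b})" by auto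
    have "\<iota> a = a" using fpfs_permutes[OF p(4)] by (auto simp: permutes_def)
    then show "((case p of (b, \<iota>) \<Rightarrow> swap a b \<circ> \<iota>) a,
          swap a ((case p of (b, \<iota>) \<Rightarrow> swap a b \<circ> \<iota>) a) \<circ> (case p of (b, \<iota>) \<Rightarrow> swap a b \<circ> \<iota>)) = p"
      using p by (simp add: fun_eq_iff)
    show "(case p of (b, \<iota>) \<Rightarrow> swap a b \<circ> \<iota>) \<in> fpfs A"
      using p assms swap_comp_in_fpfs[of a A b \<iota>] by simp
  qed
  also have "\<dots> = (\<Sum>b\<in>A - {a}. \<Sum>\<iota>\<in>fpfs (A - {a, b}). F (swap a b \<circ> \<iota>))"
    using assms by (intro sum.Sigma[symmetric]) (auto intro: finite_fpfs)
  finally show ?thesis .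
qed

lemma map_permutation_in_fpfs:
  assumes "inj_on \<phi> A" "\<iota> \<in> fpfs A"
  shows "map_permutation A \<phi> \<iota> \<in> fpfs (\<phi> ` A)"
proof -
  have p: "\<iota> permutes A" using assms fpfs_permutes by blast
  have "map_permutation A \<phi> \<iota> permutes (\<phi> ` A)"
    by (rule map_permutation_permutes[OF _ p]) (use assms in \<open>auto simp: bij_betw_def\<close>)
  moreover have "map_permutation A \<phi> \<iota> (\<phi> x) = \<phi> (\<iota> x)" if "x \<in> A" for x
    using map_permutation_apply[OF assms(1) that] .
  ultimately show ?thesis
    using assms(2) p by (auto simp: fpfs_def permutes_in_image inj_on_eq_iff[OF assms(1)])
qed

lemma sum_fpfs_relabel:
  assumes inj: "inj_on \<phi> A"
  shows "(\<Sum>\<iota>\<in>fpfs (\<phi> ` A). F \<iota>) = (\<Sum>\<iota>\<in>fpfs A. F (map_permutation A \<phi> \<iota>))"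
proof (rule sum.reindex_bij_witness[where j = "map_permutation (\<phi> ` A) (inv_into A \<phi>)"
      and i = "map_permutation A \<phi>"])
  have bij: "bij_betw \<phi> A (\<phi> ` A)" using inj by (simp add: bij_betw_def)
  have bij': "bij_betw (inv_into A \<phi>) (\<phi> ` A) A" using bij by (rule bij_betw_inv_into)
  have im: "inv_into A \<phi> ` \<phi> ` A = A" using inj by simp
  fix \<iota>
  {
    assume \<iota>: "\<iota> \<in> fpfs (\<phi> ` A)"
    show "map_permutation A \<phi> (map_permutation (\<phi> ` A) (inv_into A \<phi>) \<iota>) = \<iota>"
      by (rule map_permutation_compose_inv[OF bij' fpfs_permutes[OF \<iota>]]) (auto simp: f_inv_into_f)
    then show "F (map_permutation A \<phi> (map_permutation (\<phi> ` A) (inv_into A \<phi>) \<iota>)) = F \<iota>" by simp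
    show "map_permutation (\<phi> ` A) (inv_into A \<phi>) \<iota> \<in> fpfs A"
      using map_permutation_in_fpfs[OF inj_on_inv_into[OF order_refl] \<iota>] by (simp add: im)
  }
  assume \<iota>: "\<iota> \<in> fpfs A"
  show "map_permutation A \<phi> \<iota> \<in> fpfs (\<phi> ` A)" using map_permutation_in_fpfs[OF inj \<iota>] .
  show "map_permutation (\<phi> ` A) (inv_into A \<phi>) (map_permutation A \<phi> \<iota>) = \<iota>"
    by (rule map_permutation_compose_inv[OF bij fpfs_permutes[OF \<iota>]]) (use inj in auto)
qed

text \<open>Composing with \<open>swap a (\<sigma> a)\<close> on the left fixes \<open>a\<close> and
  sends the predecessor of \<open>a\<close> to \<open>\<sigma> a\<close>; a cycle is lost only if
  \<open>a\<close> was a cycle by itself.\<close>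

lemma num_cycles_delete:
  assumes \<sigma>: "\<sigma> permutes S" and S: "finite S" "a \<in> S"
  shows "num_cycles \<sigma> S = num_cycles (swap a (\<sigma> a) \<circ> \<sigma>) (S - {a}) + (if \<sigma> a = a then 1 else 0)"
    and "swap a (\<sigma> a) \<circ> \<sigma> permutes (S - {a})"
proof -
  have inj: "\<sigma> x = \<sigma> y \<longleftrightarrow> x = y" for x y using permutes_inj[OF \<sigma>] by (auto dest: injD)
  have "swap a (\<sigma> a) \<circ> \<sigma> permutes S"
    using \<sigma> S by (intro permutes_compose permutes_swap_id) (auto simp: permutes_in_image)
  then show p: "swap a (\<sigma> a) \<circ> \<sigma> permutes (S - {a})"
    by (rule permutes_superset) auto
  show "num_cycles \<sigma> S = num_cycles (swap a (\<sigma> a) \<circ> \<sigma>) (S - {a}) + (if \<sigma> a = a then 1 else 0)"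
  proof (cases "\<sigma> a = a")
    case True
    have "permutation \<sigma>" using \<sigma> S permutation_permutes by blast
    then have "num_cycles \<sigma> S = Suc (num_cycles \<sigma> (S - {a}))"
      using num_cycles_insert_fixed[of \<sigma> "S - {a}" a] S True by (simp add: insert_absorb)
    then show ?thesis using True by (simp add: comp_def)
  next
    case False
    have "num_cycles (swap a (\<sigma> a) \<circ> \<sigma>) (S - {a}) = num_cycles \<sigma> S"
      using inj by (intro num_cycles_bypass[OF \<sigma> p S False]) (auto simp: Transposition.transpose_def)
    then show ?thesis using False by simp
  qed
qed

section \<open>Cutting the backbone at the chord from its first endpoint\<close>

lemma tau1_permutes: "tau1 n permutes {1..2*n}"
proof (rule bij_imp_permutes)
  have "inj_on (tau1 n) {1..2*n}" 
    by (rule inj_onI, unfold tau1_def atLeastAtMost_iff) presburger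
  moreover have "tau1 n ` {1..2*n} \<subseteq> {1..2*n}" by (auto simp: tau1_def)
  ultimately show "bij_betw (tau1 n) {1..2*n} {1..2*n}"
    by (simp add: bij_betw_def endo_inj_surj)
qed (auto simp: tau1_def)

lemma tau2_permutes:
  assumes "c \<le> 2*n"
  shows "tau2 n c permutes {1..2*n}"
proof (rule bij_imp_permutes)
  have "inj_on (tau2 n c) {1..2*n}" 
    by (rule inj_on_inverseI[where g = "\<lambda>y. if y = c+1 then 2*n else if y = 1 then c else y-1"])
      (use assms in \<open>auto simp: tau2_def\<close>)
  moreover have "tau2 n c ` {1..2*n} \<subseteq> {1..2*n}" using assms by (auto simp: tau2_def)
  ultimately show "bij_betw (tau2 n c) {1..2*n} {1..2*n}"
    by (simp add: bij_betw_def endo_inj_surj)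
qed (use assms in \<open>auto simp: tau2_def\<close>)

text \<open>The order-preserving placement of the old endpoints among the new ones: the first
  \<open>c\<close> lie under the new chord \<open>(1, c+2)\<close>, the others to its right.\<close>

definition open_gap :: "nat \<Rightarrow> nat \<Rightarrow> nat" where
  "open_gap c x = (if x \<le> c then x + 1 else x + 2)"

lemma inj_open_gap: "inj_on (open_gap c) A"
  by (auto simp: inj_on_def open_gap_def split: if_splits)

lemma open_gap_image:
  assumes "c \<le> 2*n"
  shows "open_gap c ` {1..2*n} = {1..2*(n+1)} - {1, c+2}"
proof (intro equalityI subsetI)
  fix y assume "y \<in> {1..2*(n+1)} - {1, c+2}"
  then have "y = open_gap c (if y \<le> c+1 then y-1 else y-2)" "(if y \<le> c+1 then y-1 else y-2) \<in> {1..2*n}"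
    using assms by (auto simp: open_gap_def)
  then show "y \<in> open_gap c ` {1..2*n}" by blast
qed (use assms in \<open>auto simp: open_gap_def split: if_splits\<close>)

text \<open>Numbers of boundary cycles, where an empty backbone counts as one boundary cycle. With this
  convention the deletion of a chord needs no exceptional cases.\<close>

definition bnd1 :: "nat \<Rightarrow> (nat \<Rightarrow> nat) \<Rightarrow> nat" where
  "bnd1 n \<iota> = num_cycles (tau1 n \<circ> \<iota>) {1..2*n} + (if n = 0 then 1 else 0)"

definition bnd2 :: "nat \<Rightarrow> nat \<Rightarrow> (nat \<Rightarrow> nat) \<Rightarrow> nat" where
  "bnd2 n c \<iota> = num_cycles (tau2 n c \<circ> \<iota>) {1..2*n} + (if c = 0 then 1 else 0) + (if c = 2*n then 1 else 0)"

text \<open>The two transpositions are those that deleting the points \<open>c+2\<close> and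
  \<open>1\<close> puts in front of the boundary permutation. Closing both gaps in the cyclic order
  \<open>tau1\<close> in this way leaves the two cyclic orders of \<open>tau2\<close>.\<close>

lemma delete_chord_step:
  assumes "c \<le> 2*n" "y \<in> {1..2*n}"
  shows "swap 1 (tau1 (n+1) (c+2)) (swap (c+2) 2 (tau1 (n+1) (open_gap c y))) = open_gap c (tau2 n c y)"
  using assms unfolding Transposition.transpose_def tau1_def tau2_def open_gap_def
  by (auto split: if_splits)

text \<open>Both endpoints of the new chord are deleted from the boundary permutation,
  \<open>c+2\<close> before \<open>1\<close>. A deletion loses a cycle exactly when its point is
  fixed, which happens for \<open>c = 0\<close> and \<open>c = 2*n\<close> respectively, that is,
  when a piece of the backbone is empty. These are the extra terms of \<open>bnd2\<close>.\<close>

lemma bnd1_add_chord: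
  assumes c: "c \<le> 2*n" and \<iota>: "\<iota> \<in> fpfs {1..2*n}"
  shows "bnd1 (n+1) (swap 1 (c+2) \<circ> map_permutation {1..2*n} (open_gap c) \<iota>) = bnd2 n c \<iota>"
proof -
  define S where "S = {1..2*(n+1)}"
  define k where "k = map_permutation {1..2*n} (open_gap c) \<iota>"
  define \<sigma> where "\<sigma> = tau1 (n+1) \<circ> (swap 1 (c+2) \<circ> k)"
  define \<sigma>1 where "\<sigma>1 = swap (c+2) (\<sigma> (c+2)) \<circ> \<sigma>"
  define \<sigma>2 where "\<sigma>2 = swap 1 (\<sigma>1 1) \<circ> \<sigma>1"
  have k: "k \<in> fpfs (S - {1, c+2})"
    using map_permutation_in_fpfs[OF inj_open_gap \<iota>, of c] unfolding open_gap_image[OF c] k_def S_def .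
  have k_fix: "k 1 = 1" "k (c+2) = c+2" using fpfs_permutes[OF k] by (auto simp: permutes_def)
  have k_app: "k (open_gap c x) = open_gap c (\<iota> x)" if "x \<in> {1..2*n}" for x
    unfolding k_def by (rule map_permutation_apply[OF inj_open_gap that])
  have in_S: "1 \<in> S" "c+2 \<in> S" "finite S" using c unfolding S_def by auto
  have "swap 1 (c+2) \<circ> k permutes S"
    using swap_comp_in_fpfs[OF in_S(1,2) _ k] by (auto dest: fpfs_permutes)
  then have \<sigma>: "\<sigma> permutes S"
    unfolding \<sigma>_def by (rule permutes_compose) (use tau1_permutes[of "n+1"] S_def in auto)
  have \<sigma>_c: "\<sigma> (c+2) = 2" unfolding \<sigma>_def using k_fix c by (simp add: tau1_def)
  have \<sigma>_1: "\<sigma> 1 = (if c = 2*n then 1 else c+3)" unfolding \<sigma>_def using k_fix c by (simp add: tau1_def)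
  have \<sigma>1_1: "\<sigma>1 1 = tau1 (n+1) (c+2)" unfolding \<sigma>1_def using \<sigma>_c \<sigma>_1 c
    by (auto simp: Transposition.transpose_def tau1_def)
  note d1 = num_cycles_delete[OF \<sigma> in_S(3,2), folded \<sigma>1_def]
  have in_S1: "finite (S - {c+2})" "1 \<in> S - {c+2}" using in_S by auto
  note d2 = num_cycles_delete[OF d1(2) in_S1, folded \<sigma>2_def]
  have "num_cycles \<sigma>2 (open_gap c ` {1..2*n}) = num_cycles (tau2 n c \<circ> \<iota>) {1..2*n}"
  proof (rule num_cycles_relabel[OF inj_open_gap])
    fix x assume x: "x \<in> {1..2*n}"
    have p: "\<iota> permutes {1..2*n}" using fpfs_permutes[OF \<iota>] .
    show "(tau2 n c \<circ> \<iota>) x \<in> {1..2*n}"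
      using permutes_in_image[OF permutes_compose[OF p tau2_permutes[OF c]]] x by blast
    have ix: "\<iota> x \<in> {1..2*n}" using permutes_in_image[OF p] x by blast
    then have "open_gap c (\<iota> x) \<noteq> 1" "open_gap c (\<iota> x) \<noteq> c+2" by (auto simp: open_gap_def)
    then have "swap 1 (c+2) (open_gap c (\<iota> x)) = open_gap c (\<iota> x)" by (simp add: Transposition.transpose_def)
    then have "\<sigma>2 (open_gap c x) = swap 1 (tau1 (n+1) (c+2)) (swap (c+2) 2 (tau1 (n+1) (open_gap c (\<iota> x))))"
      unfolding \<sigma>2_def comp_apply \<sigma>1_1 unfolding \<sigma>1_def comp_apply \<sigma>_c
      unfolding \<sigma>_def comp_apply k_app[OF x] by simp
    then show "\<sigma>2 (open_gap c x) = open_gap c ((tau2 n c \<circ> \<iota>) x)"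
      using delete_chord_step[OF c ix] by simp
  qed
  moreover have "S - {c+2} - {1} = open_gap c ` {1..2*n}"
    unfolding open_gap_image[OF c] S_def by auto
  ultimately have "num_cycles \<sigma> S = num_cycles (tau2 n c \<circ> \<iota>) {1..2*n}
      + (if \<sigma>1 1 = 1 then 1 else 0) + (if \<sigma> (c+2) = c+2 then 1 else 0)"
    using d1(1) d2(1) by simp
  moreover have "\<sigma>1 1 = 1 \<longleftrightarrow> c = 2*n" using \<sigma>1_1 c by (auto simp: tau1_def)
  moreover have "\<sigma> (c+2) = c+2 \<longleftrightarrow> c = 0" using \<sigma>_c by auto
  ultimately show ?thesis
    unfolding bnd1_def bnd2_def \<sigma>_def S_def k_def by simp
qed

lemma sum_fpfs_delete_chord:
  "(\<Sum>\<iota>\<in>fpfs {1..2*(n+1)}. w (bnd1 (n+1) \<iota>)) = (\<Sum>c\<le>2*n. \<Sum>\<iota>\<in>fpfs {1..2*n}. w (bnd2 n c \<iota>))"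
proof -
  have "(\<Sum>\<iota>\<in>fpfs {1..2*(n+1)}. w (bnd1 (n+1) \<iota>)) = (\<Sum>b\<in>{1..2*(n+1)} - {1}.
      \<Sum>\<iota>\<in>fpfs ({1..2*(n+1)} - {1, b}). w (bnd1 (n+1) (swap 1 b \<circ> \<iota>)))"
    by (rule sum_fpfs_remove) auto
  also have "\<dots> = (\<Sum>c\<le>2*n. \<Sum>\<iota>\<in>fpfs ({1..2*(n+1)} - {1, c+2}). w (bnd1 (n+1) (swap 1 (c+2) \<circ> \<iota>)))"
  proof -
    have "{1..2*(n+1)} - {1} = (\<lambda>c. c+2) ` {..2*n}"
    proof (intro equalityI subsetI)
      fix x assume "x \<in> {1..2*(n+1)} - {1}"
      then show "x \<in> (\<lambda>c. c+2) ` {..2*n}" by (intro rev_image_eqI[of "x-2"]) auto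
    qed auto
    then show ?thesis by (simp only:) (subst sum.reindex, auto simp: inj_on_def)
  qed
  also have "\<dots> = (\<Sum>c\<le>2*n. \<Sum>\<iota>\<in>fpfs {1..2*n}. w (bnd2 n c \<iota>))"
  proof (rule sum.cong[OF refl])
    fix c assume "c \<in> {..2*n}"
    then have c: "c \<le> 2*n" by simp
    show "(\<Sum>\<iota>\<in>fpfs ({1..2*(n+1)} - {1, c+2}). w (bnd1 (n+1) (swap 1 (c+2) \<circ> \<iota>)))
        = (\<Sum>\<iota>\<in>fpfs {1..2*n}. w (bnd2 n c \<iota>))"
      unfolding open_gap_image[OF c, symmetric] sum_fpfs_relabel[OF inj_open_gap]
      by (intro sum.cong refl arg_cong[of _ _ w] bnd1_add_chord c)
  qed
  finally show ?thesis .
qed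

text \<open>Each of the \<open>k\<close> chords acts as a transposition and changes the number of
  cycles by exactly one, up or down.\<close>

lemma fpfs_parity_bound:
  assumes "finite S" "card A = 2*k" "A \<subseteq> S" "permutation \<sigma>" "\<iota> \<in> fpfs A"
  shows "num_cycles (\<sigma> \<circ> \<iota>) S \<le> num_cycles \<sigma> S + k \<and> even (num_cycles (\<sigma> \<circ> \<iota>) S + num_cycles \<sigma> S + k)"
  using assms(2-)
proof (induction k arbitrary: A \<sigma> \<iota>)
  case 0
  then have "A = {}" using assms(1) finite_subset by fastforce
  then show ?case using 0 by simp
next
  case (Suc k)
  then obtain a where a: "a \<in> A" by fastforce
  note i = swap_comp_in_fpfs'[OF Suc.prems(4) a]
  let ?b = "\<iota> a"
  have fA: "finite A" using Suc.prems(1) by (simp add: card_ge_0_finite)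
  have c: "card (A - {a, ?b}) = 2*k" using Suc.prems(1) a i(2) fA by (simp add: card_Diff_subset)
  have eq: "\<sigma> \<circ> \<iota> = (\<sigma> \<circ> swap a ?b) \<circ> (swap a ?b \<circ> \<iota>)" by (simp add: fun_eq_iff)
  have IH: "num_cycles (\<sigma> \<circ> \<iota>) S \<le> num_cycles (\<sigma> \<circ> swap a ?b) S + k \<and>
      even (num_cycles (\<sigma> \<circ> \<iota>) S + num_cycles (\<sigma> \<circ> swap a ?b) S + k)"
    unfolding eq by (rule Suc.IH[OF c _ permutation_comp_swap[OF Suc.prems(3)] i(1)])
      (use Suc.prems(2) in blast)
  have "a \<in> S" "?b \<in> S" "a \<noteq> ?b" using a i(2) Suc.prems(2) by auto
  from num_cycles_comp_swap_cases[OF Suc.prems(3) assms(1) this] show ?case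
    by cases (use IH in presburger)+
qed

section \<open>Bounds for the number of boundary cycles of a diagram\<close>

lemma num_cycles_interval:
  assumes "a \<le> b" "\<And>x. a \<le> x \<Longrightarrow> x < b \<Longrightarrow> \<sigma> x = x + 1" "\<sigma> b = a"
  shows "num_cycles \<sigma> {a..b} = 1"
proof -
  have up: "(\<sigma> ^^ k) x = x + k" if "a \<le> x" "x + k \<le> b" for x k
    using that by (induction k) (auto simp: assms(2))
  have inab: "(\<sigma> ^^ k) x \<in> {a..b}" if "x \<in> {a..b}" for x k
  proof (induction k)
    case (Suc k)
    then show ?case using assms by (cases "(\<sigma> ^^ k) x = b") auto
  qed (use that in simp)
  have "{(\<sigma> ^^ k) x |k. True} = {a..b}" if x: "x \<in> {a..b}" for x
  proof (intro equalityI subsetI)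
    fix y assume y: "y \<in> {a..b}"
    have "(\<sigma> ^^ (b - x)) x = b" using up[of x "b - x"] x by simp
    then have "(\<sigma> ^^ Suc (b - x)) x = a" using assms(3) by simp
    moreover have "(\<sigma> ^^ (y - a)) a = y" using up[of a "y - a"] y by simp
    ultimately have "y = (\<sigma> ^^ (y - a + Suc (b - x))) x" by (simp only: funpow_add comp_apply)
    then show "y \<in> {(\<sigma> ^^ k) x |k. True}" by blast
  qed (use inab[OF x] in auto)
  then have "(\<lambda>x. {(\<sigma> ^^ k) x |k. True}) ` {a..b} = {{a..b}}" using assms(1) by auto
  then show ?thesis unfolding num_cycles_def by simp
qed

lemma permutation_of_permutes_interval: "\<sigma> permutes {a..b::nat} \<Longrightarrow> permutation \<sigma>"
  using permutation_permutes by blast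

text \<open>A nonempty backbone is one cycle of \<open>tau1\<close>, and the convention for the
  empty one makes \<open>n = 0\<close> fit. Hence the genus of every one-backbone diagram is a
  natural number.\<close>

lemma bnd1_parity_bound:
  assumes "\<iota> \<in> fpfs {1..2*n}"
  shows "bnd1 n \<iota> \<le> n + 1 \<and> even (bnd1 n \<iota> + n + 1)"
proof (cases "n = 0")
  case False
  have "num_cycles (tau1 n) {1..2*n} = 1"
    using False by (intro num_cycles_interval) (auto simp: tau1_def)
  then show ?thesis
    using fpfs_parity_bound[OF _ _ order_refl permutation_of_permutes_interval[OF tau1_permutes[of n]] assms, of n] False
    unfolding bnd1_def by simp
next
  case True
  then show ?thesis using assms by (auto simp: bnd1_def num_cycles_empty)
qed

text \<open>Taken before all others, the connecting chord merges the two cycles of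
  \<open>tau2\<close> into one; the remaining \<open>n - 1\<close> chords add at most one cycle
  each.\<close>

lemma bnd2_connected_bound:
  assumes c: "1 \<le> c" "c \<le> 2*n - 1" and \<iota>: "\<iota> \<in> fpfs {1..2*n}"
    and x: "x \<in> {1..c}" "\<iota> x \<in> {c+1..2*n}"
  shows "num_cycles (tau2 n c \<circ> \<iota>) {1..2*n} \<le> n"
proof -
  let ?t = "tau2 n c" and ?S = "{1..2*n}" and ?y = "\<iota> x"
  have pt: "permutation ?t" using c by (intro permutation_of_permutes_interval[OF tau2_permutes]) auto
  have 1: "num_cycles ?t {1..c} = 1"
    by (rule num_cycles_interval) (use c in \<open>auto simp: tau2_def\<close>)
  have two: "num_cycles ?t {c+1..2*n} = 1"
    by (rule num_cycles_interval) (use c in \<open>auto simp: tau2_def\<close>)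
  have "num_cycles ?t ({1..c} \<union> {c+1..2*n}) = 2"
    by (subst num_cycles_Un) (use pt 1 two in \<open>auto simp: tau2_def\<close>)
  moreover have "{1..c} \<union> {c+1..2*n} = ?S" using c by auto
  ultimately have 2: "num_cycles ?t ?S = 2" by simp
  have orb: "orbit ?t x \<subseteq> {1..c}"
  proof
    fix z assume "z \<in> orbit ?t x" then show "z \<in> {1..c}"
      by induction (use x in \<open>auto simp: tau2_def\<close>)
  qed
  have xS: "x \<in> ?S" "?y \<in> ?S" using x c by auto
  have "num_cycles ?t ?S = Suc (num_cycles (?t \<circ> swap x ?y) ?S)"
    by (rule num_cycles_merge[OF pt]) (use orb x xS in auto)
  then have 3: "num_cycles (?t \<circ> swap x ?y) ?S = 1" using 2 by simp
  note i = swap_comp_in_fpfs'[OF \<iota> xS(1)]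
  have "card (?S - {x, ?y}) = 2*(n-1)" using xS i(2) by (simp add: card_Diff_subset)
  then have "num_cycles ((?t \<circ> swap x ?y) \<circ> (swap x ?y \<circ> \<iota>)) ?S \<le> num_cycles (?t \<circ> swap x ?y) ?S + (n-1)"
    using fpfs_parity_bound[OF _ _ _ permutation_comp_swap[OF pt] i(1)] by blast
  moreover have "(?t \<circ> swap x ?y) \<circ> (swap x ?y \<circ> \<iota>) = ?t \<circ> \<iota>" by (simp add: fun_eq_iff)
  ultimately show ?thesis using 3 c by simp
qed

section \<open>Disconnected diagrams as pairs of one-backbone diagrams\<close>

lemma fpfs_perm_restrict:
  assumes "\<iota> \<in> fpfs (A \<union> B)" "\<And>x. x \<in> A \<Longrightarrow> \<iota> x \<in> A"
  shows "perm_restrict \<iota> A \<in> fpfs A"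
proof -
  have i: "\<And>x. x \<in> A \<Longrightarrow> \<iota> x \<noteq> x \<and> \<iota> (\<iota> x) = x" using assms(1) by (auto simp: fpfs_def)
  have "bij_betw (perm_restrict \<iota> A) A A"
    by (rule bij_betwI[where g = \<iota>]) (use assms(2) i in \<open>auto simp: perm_restrict_simps\<close>)
  then have "perm_restrict \<iota> A permutes A"
    by (rule bij_imp_permutes) (simp add: perm_restrict_simps)
  then show ?thesis using i assms(2) by (auto simp: fpfs_def perm_restrict_simps)
qed

lemma fpfs_comp_disjoint:
  assumes "\<iota>1 \<in> fpfs A" "\<iota>2 \<in> fpfs B" "A \<inter> B = {}"
  shows "\<iota>1 \<circ> \<iota>2 \<in> fpfs (A \<union> B)" "x \<in> A \<Longrightarrow> (\<iota>1 \<circ> \<iota>2) x = \<iota>1 x" "x \<in> B \<Longrightarrow> (\<iota>1 \<circ> \<iota>2) x = \<iota>2 x"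
proof -
  have p: "\<iota>1 permutes A" "\<iota>2 permutes B" using assms fpfs_permutes by auto
  have f1: "\<iota>1 x = x" if "x \<in> B" for x using p(1) that assms(3) by (intro permutes_not_in) auto
  have f2: "\<iota>2 x = x" if "x \<in> A" for x using p(2) that assms(3) by (intro permutes_not_in) auto
  have in1: "\<iota>1 x \<in> A" if "x \<in> A" for x using p(1) that by (simp add: permutes_in_image)
  have in2: "\<iota>2 x \<in> B" if "x \<in> B" for x using p(2) that by (simp add: permutes_in_image)
  have "\<iota>1 permutes (A \<union> B)" "\<iota>2 permutes (A \<union> B)" using p by (auto intro: permutes_subset)
  then have "\<iota>1 \<circ> \<iota>2 permutes (A \<union> B)" by (intro permutes_compose)
  then show "\<iota>1 \<circ> \<iota>2 \<in> fpfs (A \<union> B)"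
    using assms(1,2) f1 f2 in1 in2 by (auto simp: fpfs_def)
  show "x \<in> A \<Longrightarrow> (\<iota>1 \<circ> \<iota>2) x = \<iota>1 x" "x \<in> B \<Longrightarrow> (\<iota>1 \<circ> \<iota>2) x = \<iota>2 x"
    using f1 f2 in2 by auto
qed

lemma sum_fpfs_Un:
  assumes fin: "finite A" "finite B" and dj: "A \<inter> B = {}"
  shows "(\<Sum>\<iota>\<in>{\<iota>\<in>fpfs (A \<union> B). \<forall>x\<in>A. \<iota> x \<in> A}. F \<iota>) = (\<Sum>\<iota>1\<in>fpfs A. \<Sum>\<iota>2\<in>fpfs B. F (\<iota>1 \<circ> \<iota>2))"
proof -
  have "(\<Sum>\<iota>\<in>{\<iota>\<in>fpfs (A \<union> B). \<forall>x\<in>A. \<iota> x \<in> A}. F \<iota>)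
      = (\<Sum>(\<iota>1, \<iota>2)\<in>fpfs A \<times> fpfs B. F (\<iota>1 \<circ> \<iota>2))"
  proof (rule sum.reindex_bij_witness[where i = "\<lambda>(\<iota>1, \<iota>2). \<iota>1 \<circ> \<iota>2"
        and j = "\<lambda>\<iota>. (perm_restrict \<iota> A, perm_restrict \<iota> B)"])
    fix \<iota> assume "\<iota> \<in> {\<iota>\<in>fpfs (A \<union> B). \<forall>x\<in>A. \<iota> x \<in> A}"
    then have \<iota>: "\<iota> \<in> fpfs (A \<union> B)" and A: "\<And>x. x \<in> A \<Longrightarrow> \<iota> x \<in> A" by auto
    have B: "\<iota> x \<in> B" if "x \<in> B" for x
    proof (rule ccontr)
      assume n: "\<iota> x \<notin> B"
      have "\<iota> x \<in> A \<union> B" using permutes_in_image[OF fpfs_permutes[OF \<iota>]] that by blast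
      then have "\<iota> (\<iota> x) \<in> A" using A n by blast
      moreover have "\<iota> (\<iota> x) = x" using \<iota> that by (auto simp: fpfs_def)
      ultimately show False using that dj by auto
    qed
    show "(perm_restrict \<iota> A, perm_restrict \<iota> B) \<in> fpfs A \<times> fpfs B"
      using fpfs_perm_restrict[OF \<iota> A] fpfs_perm_restrict[of \<iota> B A] \<iota> B by (simp add: Un_commute)
    have "perm_restrict \<iota> A \<circ> perm_restrict \<iota> B = \<iota>"
    proof
      fix x
      show "(perm_restrict \<iota> A \<circ> perm_restrict \<iota> B) x = \<iota> x"
        using A[of x] B[of x] dj permutes_not_in[OF fpfs_permutes[OF \<iota>], of x]
        by (auto simp: perm_restrict_def)
    qed
    then show "(case (perm_restrict \<iota> A, perm_restrict \<iota> B) of (\<iota>1, \<iota>2) \<Rightarrow> \<iota>1 \<circ> \<iota>2) = \<iota>"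
      "(case (perm_restrict \<iota> A, perm_restrict \<iota> B) of (\<iota>1, \<iota>2) \<Rightarrow> F (\<iota>1 \<circ> \<iota>2)) = F \<iota>" by simp_all
  next
    fix q assume "q \<in> fpfs A \<times> fpfs B"
    then obtain \<iota>1 \<iota>2 where q: "q = (\<iota>1, \<iota>2)" and \<iota>: "\<iota>1 \<in> fpfs A" "\<iota>2 \<in> fpfs B" by auto
    note c = fpfs_comp_disjoint[OF \<iota> dj]
    have p: "\<iota>1 permutes A" "\<iota>2 permutes B" using \<iota> fpfs_permutes by auto
    show "(case q of (\<iota>1, \<iota>2) \<Rightarrow> \<iota>1 \<circ> \<iota>2) \<in> {\<iota>\<in>fpfs (A \<union> B). \<forall>x\<in>A. \<iota> x \<in> A}"
      using c p by (auto simp: q permutes_in_image simp del: comp_apply)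
    have "perm_restrict (\<iota>1 \<circ> \<iota>2) A = \<iota>1" "perm_restrict (\<iota>1 \<circ> \<iota>2) B = \<iota>2"
      using c p by (auto simp: fun_eq_iff perm_restrict_def permutes_not_in simp del: comp_apply)
    then show "(perm_restrict (case q of (\<iota>1, \<iota>2) \<Rightarrow> \<iota>1 \<circ> \<iota>2) A,
         perm_restrict (case q of (\<iota>1, \<iota>2) \<Rightarrow> \<iota>1 \<circ> \<iota>2) B) = q" by (simp add: q)
  qed
  also have "\<dots> = (\<Sum>\<iota>1\<in>fpfs A. \<Sum>\<iota>2\<in>fpfs B. F (\<iota>1 \<circ> \<iota>2))"
    by (rule sum.cartesian_product[symmetric])
  finally show ?thesis .
qed

lemma fpfs_odd_empty:
  assumes "finite A" "odd (card A)"
  shows "fpfs A = {}"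
  using assms
proof (induction "card A" arbitrary: A rule: less_induct)
  case less
  show ?case
  proof (rule ccontr)
    assume "fpfs A \<noteq> {}"
    then obtain \<iota> where \<iota>: "\<iota> \<in> fpfs A" by blast
    have "A \<noteq> {}" using less.prems by auto
    then obtain a where a: "a \<in> A" by blast
    note i = swap_comp_in_fpfs'[OF \<iota> a]
    have "card {a, \<iota> a} = 2" using i by auto
    moreover have "card {a, \<iota> a} \<le> card A" using a i less.prems by (intro card_mono) auto
    moreover have "card (A - {a, \<iota> a}) = card A - card {a, \<iota> a}"
      using a i less.prems by (intro card_Diff_subset) auto
    ultimately have "card (A - {a, \<iota> a}) < card A" "odd (card (A - {a, \<iota> a}))"
      using less.prems(2) by auto
    then show False using less.hyps[of "A - {a, \<iota> a}"] less.prems i by auto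
  qed
qed

text \<open>No chord joins the two blocks, so the boundary permutation acts on each separately. The
  conventions for empty backbones agree, since \<open>2*m = 0\<close> and \<open>2*m = 2*n\<close>
  are exactly the cases \<open>m = 0\<close> and \<open>n - m = 0\<close>.\<close>

lemma bnd2_disconnected:
  assumes m: "m \<le> n" and \<iota>1: "\<iota>1 \<in> fpfs {1..2*m}" and \<iota>2: "\<iota>2 \<in> fpfs {1..2*(n-m)}"
  shows "bnd2 n (2*m) (\<iota>1 \<circ> map_permutation {1..2*(n-m)} (\<lambda>x. x + 2*m) \<iota>2) = bnd1 m \<iota>1 + bnd1 (n-m) \<iota>2"
proof -
  define A B where "A = {1..2*m}" and "B = {1..2*(n-m)}"
  define \<phi> where "\<phi> = (\<lambda>x. x + 2*m)"
  define k where "k = map_permutation B \<phi> \<iota>2"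
  have \<iota>: "\<iota>1 \<in> fpfs A" "\<iota>2 \<in> fpfs B" using \<iota>1 \<iota>2 by (auto simp: A_def B_def)
  have inj: "inj_on \<phi> B" by (auto simp: \<phi>_def)
  have im: "\<phi> ` B = {2*m+1..2*n}"
    unfolding \<phi>_def B_def image_add_atLeastAtMost' using m by auto
  have k: "k \<in> fpfs (\<phi> ` B)" unfolding k_def by (rule map_permutation_in_fpfs[OF inj \<iota>(2)])
  have dj: "A \<inter> \<phi> ` B = {}" unfolding im A_def by auto
  note c = fpfs_comp_disjoint[OF \<iota>(1) k dj]
  have un: "A \<union> \<phi> ` B = {1..2*n}" unfolding im A_def using m by auto
  let ?t = "tau2 n (2*m) \<circ> (\<iota>1 \<circ> k)"
  have pt: "?t permutes {1..2*n}"
    by (rule permutes_compose[OF fpfs_permutes[OF c(1), unfolded un] tau2_permutes]) (use m in simp)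
  have in1: "\<iota>1 x \<in> A" if "x \<in> A" for x using permutes_in_image[OF fpfs_permutes[OF \<iota>(1)]] that by blast
  have in2: "\<iota>2 x \<in> B" if "x \<in> B" for x using permutes_in_image[OF fpfs_permutes[OF \<iota>(2)]] that by blast
  have t1: "tau2 n (2*m) y = tau1 m y" "tau1 m y \<in> A" if "y \<in> A" for y
    using that unfolding A_def tau2_def tau1_def by auto
  have t2: "tau2 n (2*m) (\<phi> y) = \<phi> (tau1 (n-m) y)" "tau1 (n-m) y \<in> B" if "y \<in> B" for y
    using that m unfolding B_def \<phi>_def tau2_def tau1_def by auto
  have 1: "num_cycles ?t A = num_cycles (tau1 m \<circ> \<iota>1) A"
  proof (rule num_cycles_cong)
    fix x assume x: "x \<in> A"
    show "(tau1 m \<circ> \<iota>1) x \<in> A" using t1(2) in1 x by simp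
    show "?t x = (tau1 m \<circ> \<iota>1) x" using c(2)[OF x] t1(1) in1 x by simp
  qed
  have 2: "num_cycles ?t (\<phi> ` B) = num_cycles (tau1 (n-m) \<circ> \<iota>2) B"
  proof (rule num_cycles_relabel[OF inj])
    fix x assume x: "x \<in> B"
    show "(tau1 (n-m) \<circ> \<iota>2) x \<in> B" using t2(2) in2 x by simp
    have "(\<iota>1 \<circ> k) (\<phi> x) = k (\<phi> x)" using c(3) x by blast
    also have "\<dots> = \<phi> (\<iota>2 x)" unfolding k_def by (rule map_permutation_apply[OF inj x])
    finally show "?t (\<phi> x) = \<phi> ((tau1 (n-m) \<circ> \<iota>2) x)" using t2(1)[OF in2[OF x]] by simp
  qed
  have "num_cycles ?t (A \<union> \<phi> ` B) = num_cycles ?t A + num_cycles ?t (\<phi> ` B)"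
  proof (rule num_cycles_Un[OF permutation_of_permutes_interval[OF pt] _ _ dj])
    fix x assume x: "x \<in> A"
    then show "?t x \<in> A" using c(2)[OF x] t1[OF in1[OF x]] by simp
  qed (auto simp: A_def B_def)
  then have "num_cycles ?t {1..2*n} = num_cycles (tau1 m \<circ> \<iota>1) A + num_cycles (tau1 (n-m) \<circ> \<iota>2) B"
    unfolding un using 1 2 by simp
  then show ?thesis
    using m unfolding bnd2_def bnd1_def A_def B_def k_def \<phi>_def by auto
qed

text \<open>The value prescribed for \<open>n = 0\<close> is the one the sum gives, because the
  empty diagram has one boundary cycle by convention.\<close>

lemma cnum_eq_sum:
  "cnum g n = (\<Sum>\<iota>\<in>fpfs {1..2*n}. of_bool (int n + 1 - int (bnd1 n \<iota>) = 2 * int g))"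
proof (cases "n = 0")
  case True
  then show ?thesis by (simp add: cnum_def bnd1_def num_cycles_empty)
next
  case False
  have "{\<iota>. fpf_inv n \<iota> \<and> int n + 1 - int (num_cycles (tau1 n \<circ> \<iota>) {1..2*n}) = 2 * int g}
      = fpfs {1..2*n} \<inter> {\<iota>. int n + 1 - int (bnd1 n \<iota>) = 2 * int g}"
    using False by (auto simp: fpf_inv_iff_fpfs bnd1_def)
  then show ?thesis
    using False by (simp add: cnum_def sum_of_bool_eq finite_fpfs)
qed

section \<open>Connected diagrams and the recursion in the number of chords\<close>

definition conn :: "nat \<Rightarrow> nat \<Rightarrow> (nat \<Rightarrow> nat) set" where
  "conn n c = {\<iota> \<in> fpfs {1..2*n}. \<exists>x\<in>{1..c}. \<iota> x \<in> {c+1..2*n}}"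

lemma finite_conn: "finite (conn n c)"
  unfolding conn_def by (simp add: finite_fpfs)

lemma conn_trivial:
  assumes "c = 0 \<or> c = 2*n"
  shows "conn n c = {}"
  using assms by (auto simp: conn_def)

lemma cnum2_eq_sum:
  "cnum2 g n = (\<Sum>c\<le>2*n. \<Sum>\<iota>\<in>conn n c. of_bool (int n - int (bnd2 n c \<iota>) = 2 * int g))"
proof (cases "n = 0")
  case True
  then show ?thesis by (simp add: cnum2_def conn_trivial)
next
  case False
  define P where "P = (\<lambda>c \<iota>. int n - int (bnd2 n c \<iota>) = 2 * int g)"
  have "{(c, \<iota>). 1 \<le> c \<and> c \<le> 2*n - 1 \<and> fpf_inv n \<iota> \<and> (\<exists>x\<in>{1..c}. \<iota> x \<in> {c+1..2*n}) \<and>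
        int n - int (num_cycles (tau2 n c \<circ> \<iota>) {1..2*n}) = 2 * int g}
      = (SIGMA c:{1..2*n-1}. {\<iota> \<in> conn n c. P c \<iota>})"
    by (auto simp: fpf_inv_iff_fpfs conn_def bnd2_def P_def)
  then have "cnum2 g n = card (SIGMA c:{1..2*n-1}. {\<iota> \<in> conn n c. P c \<iota>})"
    using False by (simp add: cnum2_def)
  also have "\<dots> = (\<Sum>c\<in>{1..2*n-1}. card {\<iota> \<in> conn n c. P c \<iota>})"
    by (rule card_SigmaI) (auto simp: finite_conn)
  also have "\<dots> = (\<Sum>c\<in>{1..2*n-1}. \<Sum>\<iota>\<in>conn n c. of_bool (P c \<iota>))"
    by (simp add: sum_of_bool_eq finite_conn Int_def)
  also have "\<dots> = (\<Sum>c\<le>2*n. \<Sum>\<iota>\<in>conn n c. of_bool (P c \<iota>))"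
  proof (rule sum.mono_neutral_left)
    show "\<forall>c\<in>{..2*n} - {1..2*n-1}. (\<Sum>\<iota>\<in>conn n c. of_bool (P c \<iota>)) = 0"
    proof
      fix c assume "c \<in> {..2*n} - {1..2*n-1}"
      then have "c = 0 \<or> c = 2*n" by auto
      then show "(\<Sum>\<iota>\<in>conn n c. of_bool (P c \<iota>)) = 0" by (simp add: conn_trivial)
    qed
  qed auto
  finally show ?thesis by (simp add: P_def)
qed

lemma bnd2_conn_le:
  assumes "c \<le> 2*n" "\<iota> \<in> conn n c"
  shows "bnd2 n c \<iota> \<le> n"
proof -
  have "c \<noteq> 0" "c \<noteq> 2*n" using assms(2) conn_trivial[of c n] by force+
  then have c: "1 \<le> c" "c \<le> 2*n-1" using assms by auto
  obtain x where "x \<in> {1..c}" "\<iota> x \<in> {c+1..2*n}" "\<iota> \<in> fpfs {1..2*n}"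
    using assms(2) by (auto simp: conn_def)
  then show ?thesis using bnd2_connected_bound[OF c] c by (auto simp: bnd2_def)
qed

text \<open>A cut at an odd position separates two odd sets of endpoints, which carry no perfect
  matching, so only \<open>c = 2*m\<close> survives.\<close>

lemma sum_disconnected:
  "(\<Sum>c\<le>2*n. \<Sum>\<iota>\<in>fpfs {1..2*n} - conn n c. w (bnd2 n c \<iota>))
    = (\<Sum>m\<le>n. \<Sum>\<iota>1\<in>fpfs {1..2*m}. \<Sum>\<iota>2\<in>fpfs {1..2*(n-m)}. w (bnd1 m \<iota>1 + bnd1 (n-m) \<iota>2))"
proof -
  define D where "D = (\<lambda>c. \<Sum>\<iota>\<in>fpfs {1..2*n} - conn n c. w (bnd2 n c \<iota>))"
  have D: "D c = (\<Sum>\<iota>1\<in>fpfs {1..c}. \<Sum>\<iota>2\<in>fpfs {c+1..2*n}. w (bnd2 n c (\<iota>1 \<circ> \<iota>2)))" if c: "c \<le> 2*n" for c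
  proof -
    have un: "{1..c} \<union> {c+1..2*n} = {1..2*n}" using c by auto
    have "fpfs {1..2*n} - conn n c = {\<iota>\<in>fpfs ({1..c} \<union> {c+1..2*n}). \<forall>x\<in>{1..c}. \<iota> x \<in> {1..c}}"
      unfolding un
    proof (intro equalityI subsetI)
      fix \<iota> assume "\<iota> \<in> fpfs {1..2*n} - conn n c"
      then have \<iota>: "\<iota> \<in> fpfs {1..2*n}" "\<And>x. x \<in> {1..c} \<Longrightarrow> \<iota> x \<notin> {c+1..2*n}" by (auto simp: conn_def)
      have "\<iota> x \<in> {1..c}" if "x \<in> {1..c}" for x
        using permutes_in_image[OF fpfs_permutes[OF \<iota>(1)], of x] \<iota>(2)[OF that] that un by auto
      then show "\<iota> \<in> {\<iota>\<in>fpfs {1..2*n}. \<forall>x\<in>{1..c}. \<iota> x \<in> {1..c}}" using \<iota> by auto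
    qed (fastforce simp: conn_def)
    then show ?thesis unfolding D_def by (simp only:) (rule sum_fpfs_Un, auto)
  qed
  have odd: "D c = 0" if "c \<le> 2*n" "odd c" for c
    using D[OF that(1)] fpfs_odd_empty[of "{1..c}"] that by simp
  have "(\<Sum>c\<le>2*n. D c) = (\<Sum>c\<in>(\<lambda>m. 2*m) ` {..n}. D c)"
  proof (rule sum.mono_neutral_right)
    show "\<forall>c\<in>{..2*n} - (\<lambda>m. 2*m) ` {..n}. D c = 0"
    proof
      fix c assume c: "c \<in> {..2*n} - (\<lambda>m. 2*m) ` {..n}"
      have "odd c"
      proof
        assume "even c"
        then obtain m where "c = 2*m" by (rule evenE)
        then show False using c by auto
      qed
      then show "D c = 0" using odd c by simp
    qed
  qed auto
  also have "\<dots> = (\<Sum>m\<le>n. D (2*m))"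
    by (subst sum.reindex) (auto simp: inj_on_def)
  also have "\<dots> = (\<Sum>m\<le>n. \<Sum>\<iota>1\<in>fpfs {1..2*m}. \<Sum>\<iota>2\<in>fpfs {1..2*(n-m)}. w (bnd1 m \<iota>1 + bnd1 (n-m) \<iota>2))"
  proof (rule sum.cong[OF refl])
    fix m assume "m \<in> {..n}"
    then have m: "m \<le> n" by simp
    have im: "{2*m+1..2*n} = (\<lambda>x. x + 2*m) ` {1..2*(n-m)}"
      unfolding image_add_atLeastAtMost' using m by auto
    have inj: "inj_on (\<lambda>x. x + 2*m) {1..2*(n-m)}" by auto
    have "D (2*m) = (\<Sum>\<iota>1\<in>fpfs {1..2*m}. \<Sum>\<iota>2\<in>fpfs {2*m+1..2*n}. w (bnd2 n (2*m) (\<iota>1 \<circ> \<iota>2)))"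
      using m by (intro D) simp
    also have "\<dots> = (\<Sum>\<iota>1\<in>fpfs {1..2*m}. \<Sum>\<iota>2\<in>fpfs {1..2*(n-m)}. w (bnd1 m \<iota>1 + bnd1 (n-m) \<iota>2))"
      unfolding im sum_fpfs_relabel[OF inj]
      by (intro sum.cong refl arg_cong[of _ _ w] bnd2_disconnected m)
    finally show "D (2*m) = \<dots>" .
  qed
  finally show ?thesis by (simp add: D_def)
qed

text \<open>Let \<open>r\<close> be the common number of boundary cycles. On one backbone with
  \<open>n + 1\<close> chords, \<open>n + 2 - r = 2*G\<close>. For a connected pair of backbones
  this reads \<open>n - r = 2*(G-1)\<close>; for a disconnected pair it is the sum of
  \<open>m + 1 - r1\<close> and \<open>n - m + 1 - r2\<close>, so the genera add. For
  \<open>G = 0\<close> the bound \<open>r \<le> n\<close> excludes connected diagrams.\<close>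

theorem cnum_Suc:
  "cnum G (n+1) = (if G = 0 then 0 else cnum2 (G-1) n) + (\<Sum>m\<le>n. \<Sum>i\<le>G. cnum i m * cnum (G-i) (n-m))"
proof -
  define w :: "nat \<Rightarrow> nat" where "w = (\<lambda>r. of_bool (int n + 2 - int r = 2 * int G))"
  have "cnum G (n+1) = (\<Sum>\<iota>\<in>fpfs {1..2*(n+1)}. w (bnd1 (n+1) \<iota>))"
    unfolding cnum_eq_sum w_def by (intro sum.cong refl arg_cong[of _ _ of_bool]) auto
  also have "\<dots> = (\<Sum>c\<le>2*n. \<Sum>\<iota>\<in>fpfs {1..2*n}. w (bnd2 n c \<iota>))"
    by (rule sum_fpfs_delete_chord)
  also have "\<dots> = (\<Sum>c\<le>2*n. (\<Sum>\<iota>\<in>fpfs {1..2*n} - conn n c. w (bnd2 n c \<iota>)) + (\<Sum>\<iota>\<in>conn n c. w (bnd2 n c \<iota>)))"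
    by (intro sum.cong refl sum.subset_diff) (auto simp: conn_def finite_fpfs)
  also have "\<dots> = (\<Sum>c\<le>2*n. \<Sum>\<iota>\<in>conn n c. w (bnd2 n c \<iota>)) +
     (\<Sum>m\<le>n. \<Sum>\<iota>1\<in>fpfs {1..2*m}. \<Sum>\<iota>2\<in>fpfs {1..2*(n-m)}. w (bnd1 m \<iota>1 + bnd1 (n-m) \<iota>2))"
    by (simp only: sum.distrib sum_disconnected add.commute)
  also have "(\<Sum>c\<le>2*n. \<Sum>\<iota>\<in>conn n c. w (bnd2 n c \<iota>)) = (if G = 0 then 0 else cnum2 (G-1) n)"
  proof (cases "G = 0")
    case True
    have "w (bnd2 n c \<iota>) = 0" if "c \<le> 2*n" "\<iota> \<in> conn n c" for c \<iota>
      using bnd2_conn_le[OF that] True by (simp add: w_def)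
    then show ?thesis using True by simp
  next
    case False
    then have "(int n + 2 - int r = 2 * int G) = (int n - int r = 2 * int (G-1))" for r by auto
    then show ?thesis using False by (simp add: cnum2_eq_sum w_def)
  qed
  also have "(\<Sum>m\<le>n. \<Sum>\<iota>1\<in>fpfs {1..2*m}. \<Sum>\<iota>2\<in>fpfs {1..2*(n-m)}. w (bnd1 m \<iota>1 + bnd1 (n-m) \<iota>2))
      = (\<Sum>m\<le>n. \<Sum>i\<le>G. cnum i m * cnum (G-i) (n-m))"
  proof (rule sum.cong[OF refl])
    fix m assume "m \<in> {..n}"
    then have m: "m \<le> n" by simp
    have "w (bnd1 m \<iota>1 + bnd1 (n-m) \<iota>2) = (\<Sum>i\<le>G. of_bool (int m + 1 - int (bnd1 m \<iota>1) = 2 * int i) *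
        of_bool (int (n-m) + 1 - int (bnd1 (n-m) \<iota>2) = 2 * int (G-i)))"
      if "\<iota>1 \<in> fpfs {1..2*m}" "\<iota>2 \<in> fpfs {1..2*(n-m)}" for \<iota>1 \<iota>2
    proof -
      define r1 where "r1 = bnd1 m \<iota>1"
      define r2 where "r2 = bnd1 (n-m) \<iota>2"
      \<comment> \<open>Parity provides natural numbers \<open>i1\<close> and \<open>i2\<close> as
        genera of the two parts, so the sum over \<open>i\<close> has the single candidate
        \<open>i = i1\<close>.\<close>
      have "r1 \<le> m + 1 \<and> even (r1 + m + 1)" "r2 \<le> n-m+1 \<and> even (r2 + (n-m) + 1)"
        unfolding r1_def r2_def by (rule bnd1_parity_bound[OF that(1)], rule bnd1_parity_bound[OF that(2)])
      moreover have "\<exists>i. k = r + 2*i" if "r \<le> k" "even (r + k)" for k r :: nat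
        using that by (intro exI[of _ "(k - r) div 2"]) simp
      ultimately obtain i1 i2 where i: "m + 1 = r1 + 2*i1" "n-m+1 = r2 + 2*i2"
        by (metis add.assoc)
      have "(\<Sum>i\<le>G. of_bool (int m + 1 - int r1 = 2 * int i) *
        of_bool (int (n-m) + 1 - int r2 = 2 * int (G-i))) = (\<Sum>i\<le>G. if i = i1 then of_bool (i2 = G-i1) else (0::nat))"
        using i by (intro sum.cong refl) auto
      also have "\<dots> = of_bool (i1 + i2 = G)" by auto
      also have "\<dots> = w (r1 + r2)" using i m unfolding w_def by (intro arg_cong[of _ _ of_bool]) linarith
      finally show ?thesis unfolding r1_def r2_def ..
    qed
    then have "(\<Sum>\<iota>1\<in>fpfs {1..2*m}. \<Sum>\<iota>2\<in>fpfs {1..2*(n-m)}. w (bnd1 m \<iota>1 + bnd1 (n-m) \<iota>2))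
      = (\<Sum>\<iota>1\<in>fpfs {1..2*m}. \<Sum>\<iota>2\<in>fpfs {1..2*(n-m)}. \<Sum>i\<le>G. of_bool (int m + 1 - int (bnd1 m \<iota>1) = 2 * int i) *
        of_bool (int (n-m) + 1 - int (bnd1 (n-m) \<iota>2) = 2 * int (G-i)))"
      by (intro sum.cong refl) auto
    also have "\<dots> = (\<Sum>i\<le>G. \<Sum>\<iota>1\<in>fpfs {1..2*m}. \<Sum>\<iota>2\<in>fpfs {1..2*(n-m)}. of_bool (int m + 1 - int (bnd1 m \<iota>1) = 2 * int i) *
        of_bool (int (n-m) + 1 - int (bnd1 (n-m) \<iota>2) = 2 * int (G-i)))"
      by (subst sum.swap) (intro sum.cong refl, rule sum.swap)
    also have "\<dots> = (\<Sum>i\<le>G. cnum i m * cnum (G-i) (n-m))"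
      unfolding cnum_eq_sum by (simp only: sum_product)
    finally show "(\<Sum>\<iota>1\<in>fpfs {1..2*m}. \<Sum>\<iota>2\<in>fpfs {1..2*(n-m)}. w (bnd1 m \<iota>1 + bnd1 (n-m) \<iota>2)) = \<dots>" .
  qed
  finally show ?thesis .
qed

section \<open>The Harer-Zagier recursion\<close>

text \<open>The new point \<open>a\<close> either forms a cycle by itself, with weight
  \<open>y\<close>, or is inserted into an existing cycle next to one of the \<open>card S\<close>
  old points, with weight 1.\<close>

lemma sum_power_num_cycles:
  fixes y :: "'a :: comm_ring_1"
  assumes "finite A"
  shows "(\<Sum>\<sigma> | \<sigma> permutes A. y ^ num_cycles \<sigma> A) = pochhammer y (card A)"
  using assms
proof (induction A rule: finite_induct)
  case empty
  then show ?case by (simp add: num_cycles_empty)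
next
  case (insert a S)
  have *: "num_cycles (swap a b \<circ> q) (insert a S) = (if b = a then Suc (num_cycles q S) else num_cycles q S)"
    if q: "q permutes S" and b: "b \<in> insert a S" for b q
  proof -
    have pq: "permutation q" using q insert.hyps permutation_permutes by blast
    have qa: "q a = a" using q insert.hyps by (simp add: permutes_not_in)
    have 1: "num_cycles q (insert a S) = Suc (num_cycles q S)"
      by (rule num_cycles_insert_fixed[OF pq insert.hyps qa])
    have 2: "num_cycles q (insert a S) = Suc (num_cycles (q \<circ> swap a b) (insert a S))" if "b \<noteq> a"
    proof (rule num_cycles_merge[OF pq])
      have "orbit q a = {a}" using qa by (simp add: orbit_eq_singleton_iff)
      then show "b \<notin> orbit q a" using that by simp
    qed (use insert.hyps b in auto)
    have "q permutes insert a S" using q by (rule permutes_subset) auto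
    then have "num_cycles (swap a b \<circ> q) (insert a S) = num_cycles (q \<circ> swap a b) (insert a S)"
      using b by (intro num_cycles_comp_commute permutes_swap_id) auto
    then show ?thesis using 1 2 by auto
  qed
  have "(\<Sum>\<sigma> | \<sigma> permutes insert a S. y ^ num_cycles \<sigma> (insert a S))
      = (\<Sum>b\<in>insert a S. \<Sum>q | q permutes S. y ^ num_cycles (swap a b \<circ> q) (insert a S))"
    by (rule sum_over_permutations_insert[OF insert.hyps])
  also have "\<dots> = (\<Sum>b\<in>insert a S. (if b = a then y else 1) * (\<Sum>q | q permutes S. y ^ num_cycles q S))"
    unfolding sum_distrib_left by (intro sum.cong refl) (auto simp: *)
  also have "\<dots> = (\<Sum>b\<in>insert a S. if b = a then y else 1) * pochhammer y (card S)"
    by (simp only: sum_distrib_right insert.IH)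
  also have "(\<Sum>b\<in>insert a S. if b = a then y else 1) = y + of_nat (card S)"
  proof -
    have "(\<Sum>b\<in>S. if b = a then y else 1) = (\<Sum>b\<in>S. 1)"
      using insert.hyps by (intro sum.cong) auto
    then show ?thesis using insert.hyps by simp
  qed
  finally show ?case using insert.hyps by (simp add: pochhammer_rec')
qed

section \<open>Signed cycle sums over the stabiliser of a subset\<close>

definition stab :: "nat set \<Rightarrow> nat set \<Rightarrow> (nat \<Rightarrow> nat) set" where
  "stab A B = {\<sigma>. \<sigma> permutes A \<and> (\<forall>x\<in>B. \<sigma> x \<in> B)}"

lemma stabD:
  assumes "\<sigma> \<in> stab A B"
  shows "\<sigma> permutes A" "\<And>x. x \<in> B \<Longrightarrow> \<sigma> x \<in> B"
  using assms by (auto simp: stab_def)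

lemma stab_comp: "\<sigma> \<in> stab A B \<Longrightarrow> \<rho> \<in> stab A B \<Longrightarrow> \<sigma> \<circ> \<rho> \<in> stab A B"
  by (auto simp: stab_def permutes_compose)

lemma swap_in_stab:
  assumes "B \<subseteq> A" "u \<in> B \<and> v \<in> B \<or> u \<in> A - B \<and> v \<in> A - B"
  shows "swap u v \<in> stab A B"
  using assms by (auto simp: stab_def Transposition.transpose_def intro!: permutes_swap_id)

lemma sum_stab_comp_swap:
  assumes "swap u v \<in> stab A B"
  shows "(\<Sum>\<sigma>\<in>stab A B. F \<sigma>) = (\<Sum>\<sigma>\<in>stab A B. F (\<sigma> \<circ> swap u v))"
    and "(\<Sum>\<sigma>\<in>stab A B. F \<sigma>) = (\<Sum>\<sigma>\<in>stab A B. F (swap u v \<circ> \<sigma>))"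
proof -
  show "(\<Sum>\<sigma>\<in>stab A B. F \<sigma>) = (\<Sum>\<sigma>\<in>stab A B. F (\<sigma> \<circ> swap u v))"
    by (rule sum.reindex_bij_witness[where i = "\<lambda>\<sigma>. \<sigma> \<circ> swap u v" and j = "\<lambda>\<sigma>. \<sigma> \<circ> swap u v"])
      (use assms in \<open>auto simp: comp_assoc stab_comp\<close>)
  show "(\<Sum>\<sigma>\<in>stab A B. F \<sigma>) = (\<Sum>\<sigma>\<in>stab A B. F (swap u v \<circ> \<sigma>))"
    by (rule sum.reindex_bij_witness[where i = "\<lambda>\<sigma>. swap u v \<circ> \<sigma>" and j = "\<lambda>\<sigma>. swap u v \<circ> \<sigma>"])
      (use assms in \<open>auto simp: stab_comp simp flip: comp_assoc\<close>)
qed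

lemma sum_stab_Un:
  assumes fin: "finite A" "finite B" and dj: "A \<inter> B = {}"
  shows "(\<Sum>\<sigma>\<in>stab (A \<union> B) A. F \<sigma>) = (\<Sum>\<sigma>1 | \<sigma>1 permutes A. \<Sum>\<sigma>2 | \<sigma>2 permutes B. F (\<sigma>1 \<circ> \<sigma>2))"
proof -
  have "(\<Sum>\<sigma>\<in>stab (A \<union> B) A. F \<sigma>)
      = (\<Sum>(\<sigma>1, \<sigma>2)\<in>{\<sigma>1. \<sigma>1 permutes A} \<times> {\<sigma>2. \<sigma>2 permutes B}. F (\<sigma>1 \<circ> \<sigma>2))"
  proof (rule sum.reindex_bij_witness[where i = "\<lambda>(\<sigma>1, \<sigma>2). \<sigma>1 \<circ> \<sigma>2"
        and j = "\<lambda>\<sigma>. (perm_restrict \<sigma> A, perm_restrict \<sigma> B)"])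
    fix \<sigma> assume "\<sigma> \<in> stab (A \<union> B) A"
    note p = stabD(1)[OF this] and A = stabD(2)[OF this]
    have inj: "inj \<sigma>" using p by (rule permutes_inj)
    have imA: "\<sigma> ` A = A"
      by (rule endo_inj_surj) (use fin A inj in \<open>auto intro: inj_on_subset\<close>)
    have B: "\<sigma> x \<in> B" if "x \<in> B" for x
    proof (rule ccontr)
      assume n: "\<sigma> x \<notin> B"
      have "\<sigma> x \<in> A \<union> B" using permutes_in_image[OF p] that by blast
      then have "\<sigma> x \<in> \<sigma> ` A" using imA n by blast
      then show False using that dj inj by (auto dest: injD)
    qed
    have imB: "\<sigma> ` B = B"
      by (rule endo_inj_surj) (use fin B inj in \<open>auto intro: inj_on_subset\<close>)
    have bij: "bij_betw \<sigma> A A" "bij_betw \<sigma> B B"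
      using imA imB inj by (auto simp: bij_betw_def intro: inj_on_subset)
    have "perm_restrict \<sigma> A permutes A" "perm_restrict \<sigma> B permutes B"
      by (rule bij_imp_permutes; use bij in \<open>simp add: perm_restrict_def cong: bij_betw_cong\<close>)+
    then show "(perm_restrict \<sigma> A, perm_restrict \<sigma> B) \<in> {\<sigma>1. \<sigma>1 permutes A} \<times> {\<sigma>2. \<sigma>2 permutes B}"
      by simp
    have "perm_restrict \<sigma> A \<circ> perm_restrict \<sigma> B = \<sigma>"
    proof
      fix x
      show "(perm_restrict \<sigma> A \<circ> perm_restrict \<sigma> B) x = \<sigma> x"
        using A[of x] B[of x] dj permutes_not_in[OF p, of x] by (auto simp: perm_restrict_def)
    qed
    then show "(case (perm_restrict \<sigma> A, perm_restrict \<sigma> B) of (\<sigma>1, \<sigma>2) \<Rightarrow> \<sigma>1 \<circ> \<sigma>2) = \<sigma>"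
      "(case (perm_restrict \<sigma> A, perm_restrict \<sigma> B) of (\<sigma>1, \<sigma>2) \<Rightarrow> F (\<sigma>1 \<circ> \<sigma>2)) = F \<sigma>" by simp_all
  next
    fix q assume "q \<in> {\<sigma>1. \<sigma>1 permutes A} \<times> {\<sigma>2. \<sigma>2 permutes B}"
    then obtain \<sigma>1 \<sigma>2 where q: "q = (\<sigma>1, \<sigma>2)" and p: "\<sigma>1 permutes A" "\<sigma>2 permutes B" by auto
    have f1: "\<sigma>1 x = x" if "x \<in> B" for x using p(1) that dj by (intro permutes_not_in) auto
    have f2: "\<sigma>2 x = x" if "x \<in> A" for x using p(2) that dj by (intro permutes_not_in) auto
    have in1: "\<sigma>1 x \<in> A" if "x \<in> A" for x using p(1) that by (simp add: permutes_in_image)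
    have in2: "\<sigma>2 x \<in> B" if "x \<in> B" for x using p(2) that by (simp add: permutes_in_image)
    have "\<sigma>1 permutes (A \<union> B)" "\<sigma>2 permutes (A \<union> B)" using p by (auto intro: permutes_subset)
    then have "\<sigma>1 \<circ> \<sigma>2 permutes (A \<union> B)" by (intro permutes_compose)
    then show "(case q of (\<sigma>1, \<sigma>2) \<Rightarrow> \<sigma>1 \<circ> \<sigma>2) \<in> stab (A \<union> B) A"
      using f2 in1 by (auto simp: q stab_def)
    have "perm_restrict (\<sigma>1 \<circ> \<sigma>2) A = \<sigma>1" "perm_restrict (\<sigma>1 \<circ> \<sigma>2) B = \<sigma>2"
      using f1 f2 in2 p by (auto simp: fun_eq_iff perm_restrict_def permutes_not_in)
    then show "(perm_restrict (case q of (\<sigma>1, \<sigma>2) \<Rightarrow> \<sigma>1 \<circ> \<sigma>2) A,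
         perm_restrict (case q of (\<sigma>1, \<sigma>2) \<Rightarrow> \<sigma>1 \<circ> \<sigma>2) B) = q" by (simp add: q)
  qed
  also have "\<dots> = (\<Sum>\<sigma>1 | \<sigma>1 permutes A. \<Sum>\<sigma>2 | \<sigma>2 permutes B. F (\<sigma>1 \<circ> \<sigma>2))"
    by (rule sum.cartesian_product[symmetric])
  finally show ?thesis .
qed

text \<open>The power \<open>(-1) ^ num_cycles \<sigma> B\<close> is, up to the factor
  \<open>(-1) ^ card B\<close>, the sign of the restriction of \<open>\<sigma>\<close> to
  \<open>B\<close>. It is therefore a character of the stabiliser up to a constant, and translating
  \<open>\<sigma>\<close> within the stabiliser changes the sum in a controlled way.\<close>

definition scyc :: "nat set \<Rightarrow> nat set \<Rightarrow> real \<Rightarrow> (nat \<Rightarrow> nat) \<Rightarrow> real" where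
  "scyc A B x \<iota> = (\<Sum>\<sigma>\<in>stab A B. (-1) ^ num_cycles \<sigma> B * x ^ num_cycles (\<sigma> \<circ> \<iota>) A)"

text \<open>The stabiliser is a product of two symmetric groups, and the sign turns the weight
  \<open>x\<close> of a cycle inside \<open>B\<close> into \<open>-x\<close>.\<close>

lemma scyc_id:
  assumes "finite A" "B \<subseteq> A"
  shows "scyc A B x id = pochhammer (-x) (card B) * pochhammer x (card (A - B))"
proof -
  have fB: "finite B" "finite (A - B)" using assms finite_subset by auto
  have un: "B \<union> (A - B) = A" using assms by auto
  have "scyc A B x id = (\<Sum>\<sigma>\<in>stab (B \<union> (A - B)) B. (-1) ^ num_cycles \<sigma> B * x ^ num_cycles \<sigma> A)"
    unfolding scyc_def un by simp
  also have "\<dots> = (\<Sum>\<sigma>1 | \<sigma>1 permutes B. \<Sum>\<sigma>2 | \<sigma>2 permutes (A - B).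
      (-1) ^ num_cycles (\<sigma>1 \<circ> \<sigma>2) B * x ^ num_cycles (\<sigma>1 \<circ> \<sigma>2) A)"
    by (rule sum_stab_Un[OF fB]) auto
  also have "\<dots> = (\<Sum>\<sigma>1 | \<sigma>1 permutes B. \<Sum>\<sigma>2 | \<sigma>2 permutes (A - B).
      (-x) ^ num_cycles \<sigma>1 B * x ^ num_cycles \<sigma>2 (A - B))"
  proof (intro sum.cong refl)
    fix \<sigma>1 \<sigma>2 assume "\<sigma>1 \<in> {\<sigma>1. \<sigma>1 permutes B}" "\<sigma>2 \<in> {\<sigma>2. \<sigma>2 permutes (A - B)}"
    then have p: "\<sigma>1 permutes B" "\<sigma>2 permutes (A - B)" by auto
    have f1: "\<sigma>1 x = x" if "x \<in> A - B" for x using p(1) that by (intro permutes_not_in) auto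
    have f2: "\<sigma>2 x = x" if "x \<in> B" for x using p(2) that by (intro permutes_not_in) auto
    have in1: "\<sigma>1 x \<in> B" if "x \<in> B" for x using p(1) that by (simp add: permutes_in_image)
    have in2: "\<sigma>2 x \<in> A - B" if "x \<in> A - B" for x using permutes_in_image[OF p(2)] that by blast
    have c1: "num_cycles (\<sigma>1 \<circ> \<sigma>2) B = num_cycles \<sigma>1 B"
      by (rule num_cycles_cong) (use f2 in1 in auto)
    have c2: "num_cycles (\<sigma>1 \<circ> \<sigma>2) (A - B) = num_cycles \<sigma>2 (A - B)"
      by (rule num_cycles_cong) (use f1 in2 in auto)
    have "\<sigma>1 permutes A" "\<sigma>2 permutes A" using p assms by (auto intro: permutes_subset)
    then have "permutation (\<sigma>1 \<circ> \<sigma>2)"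
      using assms permutation_permutes by (blast intro: permutes_compose)
    then have "num_cycles (\<sigma>1 \<circ> \<sigma>2) (B \<union> (A - B)) = num_cycles \<sigma>1 B + num_cycles \<sigma>2 (A - B)"
      using num_cycles_Un[of "\<sigma>1 \<circ> \<sigma>2" B "A - B"] fB f2 in1 c1 c2 by simp
    then show "(-1) ^ num_cycles (\<sigma>1 \<circ> \<sigma>2) B * x ^ num_cycles (\<sigma>1 \<circ> \<sigma>2) A
        = (-x) ^ num_cycles \<sigma>1 B * x ^ num_cycles \<sigma>2 (A - B)"
      unfolding c1 un by (simp add: power_add power_minus[of x])
  qed
  also have "\<dots> = pochhammer (-x) (card B) * pochhammer x (card (A - B))"
    by (simp only: sum_product[symmetric] sum_power_num_cycles[OF fB(1)] sum_power_num_cycles[OF fB(2)])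
  finally show ?thesis .
qed

text \<open>Replacing \<open>\<sigma>\<close> by \<open>\<sigma> \<circ> swap u v\<close> absorbs
  the chord and changes the parity of the number of cycles on \<open>B\<close>.\<close>

lemma scyc_swap_inside:
  assumes "finite A" "B \<subseteq> A" "u \<in> B" "v \<in> B" "u \<noteq> v"
  shows "scyc A B x (swap u v \<circ> \<iota>) = - scyc A B x \<iota>"
proof -
  have st: "swap u v \<in> stab A B" using assms by (intro swap_in_stab) auto
  have "scyc A B x (swap u v \<circ> \<iota>)
      = (\<Sum>\<sigma>\<in>stab A B. (-1) ^ num_cycles (\<sigma> \<circ> swap u v) B * x ^ num_cycles ((\<sigma> \<circ> swap u v) \<circ> (swap u v \<circ> \<iota>)) A)"
    unfolding scyc_def by (rule sum_stab_comp_swap(1)[OF st])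
  also have "\<dots> = (\<Sum>\<sigma>\<in>stab A B. - ((-1) ^ num_cycles \<sigma> B * x ^ num_cycles (\<sigma> \<circ> \<iota>) A))"
  proof (rule sum.cong[OF refl])
    fix \<sigma> assume \<sigma>: "\<sigma> \<in> stab A B"
    have "permutation \<sigma>" using stabD(1)[OF \<sigma>] assms permutation_permutes by blast
    then have "(-1::real) ^ num_cycles (\<sigma> \<circ> swap u v) B = - ((-1) ^ num_cycles \<sigma> B)"
      using assms finite_subset by (intro minus_one_num_cycles_comp_swap) auto
    moreover have "(\<sigma> \<circ> swap u v) \<circ> (swap u v \<circ> \<iota>) = \<sigma> \<circ> \<iota>" by (simp add: fun_eq_iff)
    ultimately show "(-1) ^ num_cycles (\<sigma> \<circ> swap u v) B * x ^ num_cycles ((\<sigma> \<circ> swap u v) \<circ> (swap u v \<circ> \<iota>)) A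
        = - ((-1) ^ num_cycles \<sigma> B * x ^ num_cycles (\<sigma> \<circ> \<iota>) A)" by simp
  qed
  finally show ?thesis by (simp add: scyc_def sum_negf)
qed

lemma scyc_swap_outside:
  assumes "B \<subseteq> A" "u \<in> A - B" "v \<in> A - B"
  shows "scyc A B x (swap u v \<circ> \<iota>) = scyc A B x \<iota>"
proof -
  have st: "swap u v \<in> stab A B" using assms by (intro swap_in_stab) auto
  have "scyc A B x (swap u v \<circ> \<iota>)
      = (\<Sum>\<sigma>\<in>stab A B. (-1) ^ num_cycles (\<sigma> \<circ> swap u v) B * x ^ num_cycles ((\<sigma> \<circ> swap u v) \<circ> (swap u v \<circ> \<iota>)) A)"
    unfolding scyc_def by (rule sum_stab_comp_swap(1)[OF st])
  also have "\<dots> = scyc A B x \<iota>"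
    unfolding scyc_def
  proof (rule sum.cong[OF refl])
    fix \<sigma> assume \<sigma>: "\<sigma> \<in> stab A B"
    have "swap u v y = y" if "y \<in> B" for y using assms that by (auto simp: Transposition.transpose_def)
    then have "num_cycles (\<sigma> \<circ> swap u v) B = num_cycles \<sigma> B"
      using stabD(2)[OF \<sigma>] by (intro num_cycles_cong) auto
    moreover have "(\<sigma> \<circ> swap u v) \<circ> (swap u v \<circ> \<iota>) = \<sigma> \<circ> \<iota>" by (simp add: fun_eq_iff)
    ultimately show "(-1) ^ num_cycles (\<sigma> \<circ> swap u v) B * x ^ num_cycles ((\<sigma> \<circ> swap u v) \<circ> (swap u v \<circ> \<iota>)) A
        = (-1) ^ num_cycles \<sigma> B * x ^ num_cycles (\<sigma> \<circ> \<iota>) A" by simp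
  qed
  finally show ?thesis .
qed

text \<open>The substitution is now \<open>swap u v \<circ> \<sigma>\<close>. The transpositions at
  the two ends of the product cancel, because the number of cycles of a product does not change when
  its factors are rotated.\<close>

lemma scyc_comp_swap_outside:
  assumes "B \<subseteq> A" "u \<in> A - B" "v \<in> A - B" "\<iota> permutes A"
  shows "scyc A B x (\<iota> \<circ> swap u v) = scyc A B x \<iota>"
proof -
  have st: "swap u v \<in> stab A B" using assms by (intro swap_in_stab) auto
  have "scyc A B x (\<iota> \<circ> swap u v)
      = (\<Sum>\<sigma>\<in>stab A B. (-1) ^ num_cycles (swap u v \<circ> \<sigma>) B * x ^ num_cycles ((swap u v \<circ> \<sigma>) \<circ> (\<iota> \<circ> swap u v)) A)"
    unfolding scyc_def by (rule sum_stab_comp_swap(2)[OF st])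
  also have "\<dots> = scyc A B x \<iota>"
    unfolding scyc_def
  proof (rule sum.cong[OF refl])
    fix \<sigma> assume \<sigma>: "\<sigma> \<in> stab A B"
    have "swap u v y = y" if "y \<in> B" for y using assms that by (auto simp: Transposition.transpose_def)
    then have 1: "num_cycles (swap u v \<circ> \<sigma>) B = num_cycles \<sigma> B"
      using stabD(2)[OF \<sigma>] by (intro num_cycles_cong) auto
    have "num_cycles ((swap u v \<circ> (\<sigma> \<circ> \<iota>)) \<circ> swap u v) A = num_cycles (swap u v \<circ> (swap u v \<circ> (\<sigma> \<circ> \<iota>))) A"
      using assms stabD(1)[OF \<sigma>] stabD(1)[OF st]
      by (intro num_cycles_comp_commute permutes_compose) auto
    moreover have "swap u v \<circ> (swap u v \<circ> (\<sigma> \<circ> \<iota>)) = \<sigma> \<circ> \<iota>" by (simp add: fun_eq_iff)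
    moreover have "(swap u v \<circ> (\<sigma> \<circ> \<iota>)) \<circ> swap u v = (swap u v \<circ> \<sigma>) \<circ> (\<iota> \<circ> swap u v)" by (simp add: fun_eq_iff)
    ultimately have 2: "num_cycles ((swap u v \<circ> \<sigma>) \<circ> (\<iota> \<circ> swap u v)) A = num_cycles (\<sigma> \<circ> \<iota>) A" by simp
    show "(-1) ^ num_cycles (swap u v \<circ> \<sigma>) B * x ^ num_cycles ((swap u v \<circ> \<sigma>) \<circ> (\<iota> \<circ> swap u v)) A
        = (-1) ^ num_cycles \<sigma> B * x ^ num_cycles (\<sigma> \<circ> \<iota>) A" by (simp only: 1 2)
  qed
  finally show ?thesis .
qed

text \<open>Multiplying on the left by \<open>swap u u'\<close> reverses the sign, as both points
  lie in \<open>B\<close>. For two crossing chords this equals multiplication on the right by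
  \<open>swap v v'\<close>, which changes nothing; the value is its own negative.\<close>

lemma scyc_two_crossings:
  assumes fin: "finite A" and BA: "B \<subseteq> A" and u: "u \<in> B" "u' \<in> B" "u \<noteq> u'" and v: "v \<in> A - B" "v' \<in> A - B" "v \<noteq> v'"
    and \<iota>: "\<iota> permutes A" "\<iota> v = v" "\<iota> v' = v'"
  shows "scyc A B x (swap u v \<circ> (swap u' v' \<circ> \<iota>)) = 0"
proof -
  let ?X = "swap u v \<circ> (swap u' v' \<circ> \<iota>)"
  have inj: "\<iota> y = v \<longleftrightarrow> y = v" "\<iota> y = v' \<longleftrightarrow> y = v'" for y
    using \<iota> permutes_inj[OF \<iota>(1)] by (metis injD)+
  have c1: "\<iota> \<circ> swap v v' = swap v v' \<circ> \<iota>"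
    using \<iota> inj by (auto simp: fun_eq_iff Transposition.transpose_def)
  have c2: "swap u u' \<circ> (swap u v \<circ> swap u' v') = swap u v \<circ> (swap u' v' \<circ> swap v v')"
  proof
    fix y
    have ne: "u \<noteq> v" "u \<noteq> v'" "u' \<noteq> v" "u' \<noteq> v'" using u v by auto
    consider "y = u" | "y = v" | "y = u'" | "y = v'" | "y \<noteq> u \<and> y \<noteq> v \<and> y \<noteq> u' \<and> y \<noteq> v'" by blast
    then show "(swap u u' \<circ> (swap u v \<circ> swap u' v')) y = (swap u v \<circ> (swap u' v' \<circ> swap v v')) y"
      using ne u(3) v(3)
      by cases (simp_all add: Transposition.transpose_def)
  qed
  have "swap u u' \<circ> ?X = (swap u u' \<circ> (swap u v \<circ> swap u' v')) \<circ> \<iota>" by (simp only: comp_assoc)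
  also have "\<dots> = swap u v \<circ> (swap u' v' \<circ> (\<iota> \<circ> swap v v'))" by (simp only: c1 c2 comp_assoc)
  finally have eq: "swap u u' \<circ> ?X = ?X \<circ> swap v v'" by (simp only: comp_assoc)
  have p: "?X permutes A"
    using \<iota>(1) u v BA by (intro permutes_compose permutes_swap_id) auto
  have "- scyc A B x ?X = scyc A B x (swap u u' \<circ> ?X)"
    by (rule scyc_swap_inside[OF fin BA u, symmetric])
  also have "\<dots> = scyc A B x ?X"
    unfolding eq by (rule scyc_comp_swap_outside[OF BA v(1,2) p])
  finally show ?thesis by simp
qed

text \<open>A permutation preserving \<open>B\<close> has \<open>u\<close> and \<open>v\<close> in
  different cycles, so the crossing chord always merges two cycles and costs one factor
  \<open>x\<close> in every term.\<close>

lemma scyc_one_crossing: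
  assumes fin: "finite A" and BA: "B \<subseteq> A" and uv: "u \<in> B" "v \<in> A - B"
  shows "x * scyc A B x (swap u v) = scyc A B x id"
  unfolding scyc_def sum_distrib_left
proof (rule sum.cong[OF refl])
  fix \<sigma> assume \<sigma>: "\<sigma> \<in> stab A B"
  have "orbit \<sigma> u \<subseteq> B"
  proof
    fix z assume "z \<in> orbit \<sigma> u" then show "z \<in> B"
      by induction (use uv stabD(2)[OF \<sigma>] in auto)
  qed
  moreover have "permutation \<sigma>" using stabD(1)[OF \<sigma>] fin permutation_permutes by blast
  ultimately have "num_cycles \<sigma> A = Suc (num_cycles (\<sigma> \<circ> swap u v) A)"
    using uv BA fin by (intro num_cycles_merge) auto
  then show "x * ((-1) ^ num_cycles \<sigma> B * x ^ num_cycles (\<sigma> \<circ> swap u v) A)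
      = (-1) ^ num_cycles \<sigma> B * x ^ num_cycles (\<sigma> \<circ> id) A" by simp
qed

text \<open>The number of perfect matchings of \<open>n\<close> points, each chord carrying the weight \<open>e\<close>.\<close>

fun matchings :: "real \<Rightarrow> nat \<Rightarrow> real" where
  "matchings e 0 = 1"
| "matchings e (Suc 0) = 0"
| "matchings e (Suc (Suc n)) = e * (real n + 1) * matchings e n"

lemma matchings_rec: "n > 0 \<Longrightarrow> matchings e n = e * (real n - 1) * matchings e (n - 2)"
  by (induction e n rule: matchings.induct) auto

text \<open>Next to the crossing chord \<open>(u, v)\<close> any further crossing makes the term
  vanish. Only matchings that stay inside \<open>B\<close>, with a sign for each chord, and inside
  the complement contribute. The induction removes chords at points of \<open>B\<close> as long as
  there are any.\<close>

lemma sum_fpfs_scyc_crossing: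
  assumes fin: "finite A" and BA: "B \<subseteq> A" and uv: "u \<in> B" "v \<in> A - B"
    and A': "A' \<subseteq> A" "u \<notin> A'" "v \<notin> A'"
  shows "(\<Sum>\<iota>\<in>fpfs A'. scyc A B x (swap u v \<circ> \<iota>))
    = matchings (-1) (card (A' \<inter> B)) * matchings 1 (card (A' - B)) * scyc A B x (swap u v)"
  using A'
proof (induction "card A'" arbitrary: A' rule: less_induct)
  case less
  have fA': "finite A'" using less.prems fin finite_subset by blast
  have small: "card (A' - {w, z}) < card A'" if "w \<in> A'" for w z
    using that fA' by (intro psubset_card_mono) auto
  have perm: "\<iota> permutes A" if "\<iota> \<in> fpfs (A' - {w, z})" for \<iota> w z
    using fpfs_permutes[OF that] by (rule permutes_subset) (use less.prems in auto)
  have comm: "swap u v \<circ> (swap w z \<circ> \<iota>) = swap w z \<circ> (swap u v \<circ> \<iota>)" if "w \<in> A'" "z \<in> A'" for w z \<iota>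
    using that less.prems by (auto simp: fun_eq_iff Transposition.transpose_def)
  show ?case
  proof (cases "A' \<inter> B = {}")
    case False
    then obtain w where w: "w \<in> A'" "w \<in> B" by blast
    have inner: "(\<Sum>\<iota>\<in>fpfs (A' - {w, z}). scyc A B x (swap u v \<circ> (swap w z \<circ> \<iota>)))
        = (if z \<in> B then - (matchings (-1) (card (A' \<inter> B) - 2) * matchings 1 (card (A' - B)) * scyc A B x (swap u v)) else 0)"
      if z: "z \<in> A' - {w}" for z
    proof (cases "z \<in> B")
      case True
      have "(A' - {w, z}) \<inter> B = A' \<inter> B - {w, z}" "(A' - {w, z}) - B = A' - B" using w True by auto
      moreover have "card (A' \<inter> B - {w, z}) = card (A' \<inter> B) - 2"
        using w z True fA' by (subst card_Diff_subset) auto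
      ultimately have IH: "(\<Sum>\<iota>\<in>fpfs (A' - {w, z}). scyc A B x (swap u v \<circ> \<iota>))
          = matchings (-1) (card (A' \<inter> B) - 2) * matchings 1 (card (A' - B)) * scyc A B x (swap u v)"
        using less.hyps[OF small[OF w(1)], of z] less.prems by auto
      have "(\<Sum>\<iota>\<in>fpfs (A' - {w, z}). scyc A B x (swap u v \<circ> (swap w z \<circ> \<iota>)))
          = (\<Sum>\<iota>\<in>fpfs (A' - {w, z}). - scyc A B x (swap u v \<circ> \<iota>))"
        using z w True by (intro sum.cong refl) (simp only: comm DiffD1 scyc_swap_inside[OF fin BA w(2)], metis scyc_swap_inside[OF fin BA w(2)] DiffD2 singletonI)
      then show ?thesis using True IH by (simp add: sum_negf)
    next
      case zB: False
      have "scyc A B x (swap u v \<circ> (swap w z \<circ> \<iota>)) = 0" if "\<iota> \<in> fpfs (A' - {w, z})" for \<iota>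
      proof (rule scyc_two_crossings[OF fin BA uv(1) w(2) _ uv(2) _ _ perm[OF that]])
        show "u \<noteq> w" "v \<noteq> z" using w z less.prems by auto
        show "z \<in> A - B" using z zB less.prems by auto
        show "\<iota> v = v" "\<iota> z = z"
          using less.prems by (auto intro!: permutes_not_in[OF fpfs_permutes[OF that]])
      qed
      then show ?thesis using zB by simp
    qed
    have "(\<Sum>\<iota>\<in>fpfs A'. scyc A B x (swap u v \<circ> \<iota>)) = (\<Sum>z\<in>A' - {w}. if z \<in> B then
        - (matchings (-1) (card (A' \<inter> B) - 2) * matchings 1 (card (A' - B)) * scyc A B x (swap u v)) else 0)"
      using inner by (subst sum_fpfs_remove[OF fA' w(1)]) (rule sum.cong[OF refl], simp)
    also have "\<dots> = real (card ((A' - {w}) \<inter> B)) *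
        - (matchings (-1) (card (A' \<inter> B) - 2) * matchings 1 (card (A' - B)) * scyc A B x (swap u v))"
      using fA' by (simp add: sum.If_cases Int_def)
    also have "(A' - {w}) \<inter> B = A' \<inter> B - {w}" by auto
    also have "real (card (A' \<inter> B - {w})) = real (card (A' \<inter> B)) - 1"
      using w fA' by (simp add: card_Diff_singleton card_gt_0_iff of_nat_diff Suc_leI) (metis IntI card_gt_0_iff empty_iff finite_Int Suc_leI of_nat_1 of_nat_diff One_nat_def)
    finally have sum: "(\<Sum>\<iota>\<in>fpfs A'. scyc A B x (swap u v \<circ> \<iota>)) = (real (card (A' \<inter> B)) - 1) *
        - (matchings (-1) (card (A' \<inter> B) - 2) * matchings 1 (card (A' - B)) * scyc A B x (swap u v))" .
    have "card (A' \<inter> B) > 0" using False fA' by (simp add: card_gt_0_iff)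
    note rec = matchings_rec[OF this, of "-1"]
    show ?thesis unfolding sum rec by (simp add: algebra_simps)
  next
    case True
    show ?thesis
    proof (cases "A' = {}")
      case True
      then show ?thesis by simp
    next
      case False
      then obtain w where w: "w \<in> A'" by blast
      have AB: "A' - B = A'" "A' \<inter> B = {}" using True by auto
      have inner: "(\<Sum>\<iota>\<in>fpfs (A' - {w, z}). scyc A B x (swap u v \<circ> (swap w z \<circ> \<iota>)))
        = matchings 1 (card A' - 2) * scyc A B x (swap u v)" if z: "z \<in> A' - {w}" for z
      proof -
        have "(A' - {w, z}) \<inter> B = {}" "(A' - {w, z}) - B = A' - {w, z}" using True by auto
        moreover have "card (A' - {w, z}) = card A' - 2"
          using w z fA' by (subst card_Diff_subset) auto
        ultimately have IH: "(\<Sum>\<iota>\<in>fpfs (A' - {w, z}). scyc A B x (swap u v \<circ> \<iota>))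
          = matchings 1 (card A' - 2) * scyc A B x (swap u v)"
          using less.hyps[OF small[OF w], of z] less.prems by auto
        have "scyc A B x (swap u v \<circ> (swap w z \<circ> \<iota>)) = scyc A B x (swap u v \<circ> \<iota>)" for \<iota>
          unfolding comm[OF w, of z \<iota>, OF DiffD1[OF z]]
          by (rule scyc_swap_outside[OF BA]) (use w z True less.prems in auto)
        then show ?thesis using IH by simp
      qed
      have "(\<Sum>\<iota>\<in>fpfs A'. scyc A B x (swap u v \<circ> \<iota>)) = (\<Sum>z\<in>A' - {w}. matchings 1 (card A' - 2) * scyc A B x (swap u v))"
        using inner by (subst sum_fpfs_remove[OF fA' w]) (rule sum.cong[OF refl], simp)
      also have "\<dots> = (real (card A') - 1) * matchings 1 (card A' - 2) * scyc A B x (swap u v)"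
      proof -
        have "card A' \<ge> 1" using w fA' by (metis One_nat_def Suc_leI card_gt_0_iff empty_iff)
        then show ?thesis using w fA' by (simp add: of_nat_diff)
      qed
      finally show ?thesis
        using matchings_rec[of "card A'" 1] False fA' AB by (simp add: card_gt_0_iff)
    qed
  qed
qed

text \<open>By parity only one of the summands is nonzero: no crossing chord, or exactly one.\<close>

definition scyc_total :: "real \<Rightarrow> real \<Rightarrow> nat \<Rightarrow> nat \<Rightarrow> real" where
  "scyc_total F0 F1 b a = matchings (-1) b * matchings 1 a * F0
     + real b * real a * matchings (-1) (b - 1) * matchings 1 (a - 1) * F1"

text \<open>A chosen point of \<open>B\<close> has a partner in \<open>B\<close>, which costs a
  sign, or one of the \<open>a\<close> partners outside, after which no further crossing is allowed.
  For \<open>b = 1\<close> the truncated \<open>b - 2\<close> is harmless, as its factor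
  \<open>b - 1\<close> vanishes.\<close>

lemma scyc_total_rec_left:
  assumes "b > 0"
  shows "scyc_total F0 F1 b a = - (real b - 1) * scyc_total F0 F1 (b - 2) a
     + real a * matchings (-1) (b - 1) * matchings 1 (a - 1) * F1"
proof (cases "b = 1")
  case True
  then show ?thesis by (simp add: scyc_total_def)
next
  case False
  then have "b = Suc (Suc (b - 2))" using assms by simp
  then obtain c where b: "b = Suc (Suc c)" by blast
  have "matchings (-1) (Suc c) = - real c * matchings (-1) (c - 1)"
    using matchings_rec[of "Suc c" "-1"] by simp
  then show ?thesis by (simp add: scyc_total_def b algebra_simps)
qed

lemma scyc_total_rec_right:
  "a > 0 \<Longrightarrow> scyc_total F0 F1 0 a = (real a - 1) * scyc_total F0 F1 0 (a - 2)"
  using matchings_rec[of a 1] by (simp add: scyc_total_def)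

text \<open>Chords are removed at points of \<open>B\<close> as before, except that a partner
  outside \<open>B\<close> now uses up the one crossing that is allowed; \<open>F1\<close> is the
  common value of all single crossings.\<close>

lemma sum_fpfs_scyc:
  assumes fin: "finite A" and BA: "B \<subseteq> A" and A': "A' \<subseteq> A"
    and F1: "\<And>u v. u \<in> B \<Longrightarrow> v \<in> A - B \<Longrightarrow> scyc A B x (swap u v) = F1"
  shows "(\<Sum>\<iota>\<in>fpfs A'. scyc A B x \<iota>) = scyc_total (scyc A B x id) F1 (card (A' \<inter> B)) (card (A' - B))"
  using A'
proof (induction "card A'" arbitrary: A' rule: less_induct)
  case less
  let ?H = "scyc_total (scyc A B x id) F1"
  define b a where "b = card (A' \<inter> B)" and "a = card (A' - B)"
  have fA': "finite A'" using less.prems fin finite_subset by blast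
  have small: "card (A' - {w, z}) < card A'" if "w \<in> A'" for w z
    using that fA' by (intro psubset_card_mono) auto
  show ?case
  proof (cases "A' \<inter> B = {}")
    case False
    then obtain w where w: "w \<in> A'" "w \<in> B" by blast
    have pos: "b > 0" using False fA' by (simp add: b_def card_gt_0_iff)
    have inner: "(\<Sum>\<iota>\<in>fpfs (A' - {w, z}). scyc A B x (swap w z \<circ> \<iota>))
        = (if z \<in> B then - ?H (b - 2) a else matchings (-1) (b - 1) * matchings 1 (a - 1) * F1)"
      if z: "z \<in> A' - {w}" for z
    proof (cases "z \<in> B")
      case True
      have "(A' - {w, z}) \<inter> B = A' \<inter> B - {w, z}" "(A' - {w, z}) - B = A' - B" using w True by auto
      moreover have "card (A' \<inter> B - {w, z}) = b - 2"
        using w z True fA' unfolding b_def by (subst card_Diff_subset) auto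
      ultimately have IH: "(\<Sum>\<iota>\<in>fpfs (A' - {w, z}). scyc A B x \<iota>) = ?H (b - 2) a"
        using less.hyps[OF small[OF w(1)], of z] less.prems by (auto simp: a_def)
      have "scyc A B x (swap w z \<circ> \<iota>) = - scyc A B x \<iota>" for \<iota>
        using z True by (intro scyc_swap_inside[OF fin BA w(2)]) auto
      then show ?thesis using True IH by (simp add: sum_negf)
    next
      case zB: False
      have z': "z \<in> A - B" using z zB less.prems by auto
      have "(A' - {w, z}) \<inter> B = A' \<inter> B - {w}" "(A' - {w, z}) - B = A' - B - {z}" using w zB by auto
      moreover have "card (A' \<inter> B - {w}) = b - 1" "card (A' - B - {z}) = a - 1"
        using w z zB by (auto simp: b_def a_def)
      ultimately show ?thesis
        using sum_fpfs_scyc_crossing[OF fin BA w(2) z', of "A' - {w, z}" x] less.prems zB F1[OF w(2) z']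
        by auto
    qed
    have "(\<Sum>\<iota>\<in>fpfs A'. scyc A B x \<iota>) = (\<Sum>z\<in>A' - {w}. if z \<in> B then - ?H (b - 2) a
        else matchings (-1) (b - 1) * matchings 1 (a - 1) * F1)"
      using inner by (subst sum_fpfs_remove[OF fA' w(1)]) (rule sum.cong[OF refl], simp)
    also have "\<dots> = real (card ((A' - {w}) \<inter> B)) * - ?H (b - 2) a
        + real (card ((A' - {w}) \<inter> - B)) * (matchings (-1) (b - 1) * matchings 1 (a - 1) * F1)"
      using fA' by (simp add: sum.If_cases Int_def)
    also have "(A' - {w}) \<inter> B = A' \<inter> B - {w}" by auto
    also have "(A' - {w}) \<inter> - B = A' - B" using w by auto
    also have "card (A' \<inter> B - {w}) = b - 1" using w by (simp add: b_def)
    finally have sum: "(\<Sum>\<iota>\<in>fpfs A'. scyc A B x \<iota>) = real (b - 1) * - ?H (b - 2) a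
        + real (card (A' - B)) * (matchings (-1) (b - 1) * matchings 1 (a - 1) * F1)" .
    have rb: "real (b - 1) = real b - 1" using pos by simp
    show ?thesis
      unfolding sum a_def[symmetric] b_def[symmetric] scyc_total_rec_left[OF pos] rb by algebra
  next
    case True
    show ?thesis
    proof (cases "A' = {}")
      case True
      then show ?thesis by (simp add: scyc_total_def)
    next
      case False
      then obtain w where w: "w \<in> A'" by blast
      have AB: "A' - B = A'" "A' \<inter> B = {}" using True by auto
      have inner: "(\<Sum>\<iota>\<in>fpfs (A' - {w, z}). scyc A B x (swap w z \<circ> \<iota>)) = ?H 0 (card A' - 2)"
        if z: "z \<in> A' - {w}" for z
      proof -
        have "(A' - {w, z}) \<inter> B = {}" "(A' - {w, z}) - B = A' - {w, z}" using True by auto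
        moreover have "card (A' - {w, z}) = card A' - 2"
          using w z fA' by (subst card_Diff_subset) auto
        ultimately have IH: "(\<Sum>\<iota>\<in>fpfs (A' - {w, z}). scyc A B x \<iota>) = ?H 0 (card A' - 2)"
          using less.hyps[OF small[OF w], of z] less.prems by auto
        have "scyc A B x (swap w z \<circ> \<iota>) = scyc A B x \<iota>" for \<iota>
          by (rule scyc_swap_outside[OF BA]) (use w z True less.prems in auto)
        then show ?thesis using IH by simp
      qed
      have "(\<Sum>\<iota>\<in>fpfs A'. scyc A B x \<iota>) = (\<Sum>z\<in>A' - {w}. ?H 0 (card A' - 2))"
        using inner by (subst sum_fpfs_remove[OF fA' w]) (rule sum.cong[OF refl], simp)
      also have "\<dots> = (real (card A') - 1) * ?H 0 (card A' - 2)"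
      proof -
        have "card A' \<ge> 1" using w fA' by (metis One_nat_def Suc_leI card_gt_0_iff empty_iff)
        then show ?thesis using w fA' by (simp add: of_nat_diff)
      qed
      finally show ?thesis
        using scyc_total_rec_right[of "card A'"] False fA' AB by (simp add: card_gt_0_iff)
    qed
  qed
qed

section \<open>Detecting full cycles by sign cancellation\<close>

lemma orbit_inv_subset_or_disjoint:
  assumes "finite B" "permutation \<sigma>" "\<And>y. y \<in> B \<Longrightarrow> \<sigma> y \<in> B"
  shows "orbit \<sigma> c \<subseteq> B \<or> orbit \<sigma> c \<inter> B = {}"
proof -
  have "orbit \<sigma> c \<subseteq> B" if z: "z \<in> orbit \<sigma> c" "z \<in> B" for z
  proof -
    have "orbit \<sigma> z = orbit \<sigma> c" using orbit_eq_iff[OF assms(2), of c z] z by simp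
    moreover have "orbit \<sigma> z \<subseteq> B"
    proof
      fix y assume "y \<in> orbit \<sigma> z" then show "y \<in> B" by induction (use assms z in auto)
    qed
    ultimately show ?thesis by simp
  qed
  then show ?thesis by blast
qed

lemma num_cycles_orbit_self:
  assumes "permutation \<sigma>"
  shows "num_cycles \<sigma> (orbit \<sigma> c) = 1"
proof -
  have "orbit \<sigma> ` orbit \<sigma> c = {orbit \<sigma> c}"
    using orbit_eq_iff[OF assms, of c] permutation_self_in_orbit[OF assms, of c] by blast
  then show ?thesis by (simp add: num_cycles_orbit[OF assms])
qed

text \<open>For a permutation of a finite \<open>A\<close> these are the unions of its
  cycles.\<close>

definition invsets :: "(nat \<Rightarrow> nat) \<Rightarrow> nat set \<Rightarrow> nat set set" where
  "invsets \<sigma> A = {B. B \<subseteq> A \<and> (\<forall>x\<in>B. \<sigma> x \<in> B)}"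

text \<open>Adding or removing a cycle \<open>Q\<close> that avoids \<open>a\<close> is a
  sign-reversing involution, so the sum vanishes whenever such a cycle exists. Otherwise
  \<open>A\<close> is the only admissible set, and it contributes \<open>-1\<close>.\<close>

lemma sum_invsets_signed_containing:
  assumes fin: "finite A" and \<sigma>: "\<sigma> permutes A" and a: "a \<in> A"
  shows "(\<Sum>B\<in>{B\<in>invsets \<sigma> A. a \<in> B}. (-1::real) ^ num_cycles \<sigma> B) = (if orbit \<sigma> a = A then -1 else 0)"
proof -
  have p: "permutation \<sigma>" using fin \<sigma> permutation_permutes by blast
  let ?V = "{B\<in>invsets \<sigma> A. a \<in> B}"
  have finV: "finite B" if "B \<in> ?V" for B using that fin finite_subset by (auto simp: invsets_def)
  have inv: "\<sigma> y \<in> B" if "B \<in> ?V" "y \<in> B" for B y using that by (auto simp: invsets_def)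
  show ?thesis
  proof (cases "orbit \<sigma> a = A")
    case True
    have "?V = {A}"
    proof (intro equalityI subsetI)
      fix B assume B: "B \<in> ?V"
      have "orbit \<sigma> a \<subseteq> B \<or> orbit \<sigma> a \<inter> B = {}"
        by (rule orbit_inv_subset_or_disjoint[OF finV[OF B] p inv[OF B]])
      then show "B \<in> {A}" using B True a by (auto simp: invsets_def)
    qed (use a \<sigma> in \<open>auto simp: invsets_def permutes_in_image\<close>)
    moreover have "num_cycles \<sigma> A = 1" using num_cycles_orbit_self[OF p, of a] True by simp
    ultimately show ?thesis using True by simp
  next
    case False
    have "orbit \<sigma> a \<subseteq> A" using permutes_orbit_subset[OF \<sigma> a] .
    then obtain c where c: "c \<in> A" "c \<notin> orbit \<sigma> a" using False by blast
    define Q where "Q = orbit \<sigma> c"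
    have QA: "Q \<subseteq> A" unfolding Q_def using permutes_orbit_subset[OF \<sigma> c(1)] .
    have aQ: "a \<notin> Q" unfolding Q_def
      using c(2) orbit_eq_iff[OF p, of c a] permutation_self_in_orbit[OF p, of c] by auto
    have Qinv: "\<sigma> y \<in> Q" if "y \<in> Q" for y using that unfolding Q_def by (rule orbit.step)
    have Q1: "num_cycles \<sigma> Q = 1" unfolding Q_def by (rule num_cycles_orbit_self[OF p])
    have fQ: "finite Q" using QA fin finite_subset by blast
    define t where "t = (\<lambda>B. if Q \<subseteq> B then B - Q else B \<union> Q)"
    have Qne: "Q \<noteq> {}" unfolding Q_def by (rule orbit_nonempty)
    have dich: "Q \<subseteq> B \<or> Q \<inter> B = {}" if "B \<in> ?V" for B
      unfolding Q_def by (rule orbit_inv_subset_or_disjoint[OF finV[OF that] p inv[OF that]])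
    have tt: "t (t B) = B" if "B \<in> ?V" for B
      using dich[OF that] Qne by (auto simp: t_def)
    have injs: "\<sigma> y \<in> Q \<longleftrightarrow> y \<in> Q" for y
    proof
      assume "\<sigma> y \<in> Q"
      moreover have "orbit \<sigma> (\<sigma> y) = orbit \<sigma> y" by (rule permutation_orbit_step[OF p])
      ultimately have "orbit \<sigma> c = orbit \<sigma> y" using orbit_eq_iff[OF p, of c "\<sigma> y"] by (simp add: Q_def)
      then show "y \<in> Q" unfolding Q_def using permutation_self_in_orbit[OF p, of y] by simp
    qed (rule Qinv)
    have tV: "t B \<in> ?V" if "B \<in> ?V" for B
      using that injs QA aQ Qinv by (auto simp: t_def invsets_def)
    have sgn: "(-1::real) ^ num_cycles \<sigma> (t B) = - ((-1) ^ num_cycles \<sigma> B)" if B: "B \<in> ?V" for B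
    proof (cases "Q \<subseteq> B")
      case True
      have "num_cycles \<sigma> (Q \<union> (B - Q)) = num_cycles \<sigma> Q + num_cycles \<sigma> (B - Q)"
        using fQ finV[OF B] Qinv by (intro num_cycles_Un[OF p]) auto
      moreover have "Q \<union> (B - Q) = B" using True by auto
      ultimately show ?thesis using True Q1 by (simp add: t_def)
    next
      case False
      have "num_cycles \<sigma> (Q \<union> B) = num_cycles \<sigma> Q + num_cycles \<sigma> B"
        using fQ finV[OF B] Qinv dich[OF B] False by (intro num_cycles_Un[OF p]) auto
      then show ?thesis using False Q1 by (simp add: t_def Un_commute)
    qed
    have "(\<Sum>B\<in>?V. (-1::real) ^ num_cycles \<sigma> B) = (\<Sum>B\<in>?V. - ((-1) ^ num_cycles \<sigma> B))"
      by (rule sum.reindex_bij_witness[where i = t and j = t]) (use tt tV sgn in auto)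
    then show ?thesis using False by (simp add: sum_negf)
  qed
qed

text \<open>Writing \<open>card B\<close> as a sum over its points reduces to sets through a marked
  point. Without this weight the sum would be zero for full cycles as well.\<close>

lemma sum_invsets_signed_card:
  assumes fin: "finite A" and \<sigma>: "\<sigma> permutes A" and ne: "A \<noteq> {}"
  shows "(\<Sum>B\<in>invsets \<sigma> A. real (card B) * (-1) ^ num_cycles \<sigma> B) = (if num_cycles \<sigma> A = 1 then - real (card A) else 0)"
proof -
  have p: "permutation \<sigma>" using fin \<sigma> permutation_permutes by blast
  have fV: "finite (invsets \<sigma> A)" unfolding invsets_def using fin by simp
  have "(\<Sum>B\<in>invsets \<sigma> A. real (card B) * (-1) ^ num_cycles \<sigma> B)
      = (\<Sum>B\<in>invsets \<sigma> A. \<Sum>a\<in>A. if a \<in> B then (-1) ^ num_cycles \<sigma> B else 0)"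
  proof (rule sum.cong[OF refl])
    fix B assume "B \<in> invsets \<sigma> A"
    then have "A \<inter> B = B" by (auto simp: invsets_def)
    then show "real (card B) * (-1) ^ num_cycles \<sigma> B = (\<Sum>a\<in>A. if a \<in> B then (-1) ^ num_cycles \<sigma> B else 0)"
      using fin by (simp add: sum.If_cases)
  qed
  also have "\<dots> = (\<Sum>a\<in>A. \<Sum>B\<in>invsets \<sigma> A. if a \<in> B then (-1) ^ num_cycles \<sigma> B else 0)"
    by (rule sum.swap)
  also have "\<dots> = (\<Sum>a\<in>A. if orbit \<sigma> a = A then -1 else 0)"
  proof (rule sum.cong[OF refl])
    fix a assume a: "a \<in> A"
    have "(\<Sum>B\<in>invsets \<sigma> A. if a \<in> B then (-1::real) ^ num_cycles \<sigma> B else 0)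
        = (\<Sum>B\<in>{B\<in>invsets \<sigma> A. a \<in> B}. (-1) ^ num_cycles \<sigma> B)"
      using fV by (simp add: sum.If_cases Int_def)
    then show "(\<Sum>B\<in>invsets \<sigma> A. if a \<in> B then (-1::real) ^ num_cycles \<sigma> B else 0) = (if orbit \<sigma> a = A then -1 else 0)"
      using sum_invsets_signed_containing[OF fin \<sigma> a] by simp
  qed
  also have "\<dots> = (\<Sum>a\<in>A. if num_cycles \<sigma> A = 1 then -1 else 0)"
  proof (rule sum.cong[OF refl])
    fix a assume a: "a \<in> A"
    have "orbit \<sigma> a = A \<longleftrightarrow> num_cycles \<sigma> A = 1"
    proof
      assume "num_cycles \<sigma> A = 1"
      then obtain Z where Z: "orbit \<sigma> ` A = {Z}" by (auto simp: num_cycles_orbit[OF p] card_1_singleton_iff)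
      have "A \<subseteq> orbit \<sigma> a"
      proof
        fix y assume "y \<in> A"
        then have "orbit \<sigma> y = orbit \<sigma> a" using Z a by (metis imageI singletonD)
        then show "y \<in> orbit \<sigma> a" using permutation_self_in_orbit[OF p, of y] by simp
      qed
      then show "orbit \<sigma> a = A" using permutes_orbit_subset[OF \<sigma> a] by auto
    qed (use num_cycles_orbit_self[OF p, of a] in simp)
    then show "(if orbit \<sigma> a = A then -1 else 0) = (if num_cycles \<sigma> A = 1 then -1 else (0::real))" by simp
  qed
  finally show ?thesis by simp
qed

lemma sum_cyclic_eq_sum_stab:
  assumes fin: "finite A" and ne: "A \<noteq> {}"
  shows "real (card A) * (\<Sum>\<sigma> | \<sigma> permutes A \<and> num_cycles \<sigma> A = 1. F \<sigma>)
    = - (\<Sum>B\<in>Pow A. real (card B) * (\<Sum>\<sigma>\<in>stab A B. (-1) ^ num_cycles \<sigma> B * F \<sigma>))"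
proof -
  have fP: "finite {\<sigma>. \<sigma> permutes A}" using fin by (rule finite_permutations)
  have "(\<Sum>B\<in>Pow A. real (card B) * (\<Sum>\<sigma>\<in>stab A B. (-1) ^ num_cycles \<sigma> B * F \<sigma>))
     = (\<Sum>B\<in>Pow A. \<Sum>\<sigma>\<in>{\<sigma>\<in>{\<sigma>. \<sigma> permutes A}. \<forall>x\<in>B. \<sigma> x \<in> B}. real (card B) * (-1) ^ num_cycles \<sigma> B * F \<sigma>)"
    unfolding sum_distrib_left by (intro sum.cong refl) (auto simp: stab_def)
  also have "\<dots> = (\<Sum>\<sigma> | \<sigma> permutes A. \<Sum>B\<in>{B\<in>Pow A. \<forall>x\<in>B. \<sigma> x \<in> B}. real (card B) * (-1) ^ num_cycles \<sigma> B * F \<sigma>)"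
    by (rule sum.swap_restrict) (use fin fP in auto)
  also have "\<dots> = (\<Sum>\<sigma> | \<sigma> permutes A. if num_cycles \<sigma> A = 1 then - real (card A) * F \<sigma> else 0)"
  proof (rule sum.cong[OF refl])
    fix \<sigma> assume "\<sigma> \<in> {\<sigma>. \<sigma> permutes A}"
    then have \<sigma>: "\<sigma> permutes A" by simp
    have "{B\<in>Pow A. \<forall>x\<in>B. \<sigma> x \<in> B} = invsets \<sigma> A" by (auto simp: invsets_def)
    then have "(\<Sum>B\<in>{B\<in>Pow A. \<forall>x\<in>B. \<sigma> x \<in> B}. real (card B) * (-1) ^ num_cycles \<sigma> B * F \<sigma>)
       = (\<Sum>B\<in>invsets \<sigma> A. real (card B) * (-1) ^ num_cycles \<sigma> B) * F \<sigma>"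
      by (simp add: sum_distrib_right)
    then show "(\<Sum>B\<in>{B\<in>Pow A. \<forall>x\<in>B. \<sigma> x \<in> B}. real (card B) * (-1) ^ num_cycles \<sigma> B * F \<sigma>)
       = (if num_cycles \<sigma> A = 1 then - real (card A) * F \<sigma> else 0)"
      by (simp add: sum_invsets_signed_card[OF fin \<sigma> ne])
  qed
  also have "\<dots> = - real (card A) * (\<Sum>\<sigma> | \<sigma> permutes A \<and> num_cycles \<sigma> A = 1. F \<sigma>)"
    using fP by (simp add: sum.If_cases Int_def sum_distrib_left sum_negf)
  finally show ?thesis by simp
qed

lemma sum_Pow_card:
  fixes g :: "nat \<Rightarrow> real"
  assumes "finite A"
  shows "(\<Sum>B\<in>Pow A. g (card B)) = (\<Sum>b\<le>card A. real (card A choose b) * g b)"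
proof -
  have "(\<Sum>B\<in>Pow A. g (card B)) = (\<Sum>b\<le>card A. \<Sum>B\<in>{B\<in>Pow A. card B = b}. g (card B))"
    by (rule sum.group[symmetric]) (use assms in \<open>auto intro: card_mono\<close>)
  also have "\<dots> = (\<Sum>b\<le>card A. real (card A choose b) * g b)"
  proof (rule sum.cong[OF refl])
    fix b
    have "card {B\<in>Pow A. card B = b} = card A choose b"
      using n_subsets[OF assms, of b] by (simp add: Pow_def)
    then show "(\<Sum>B\<in>{B\<in>Pow A. card B = b}. g (card B)) = real (card A choose b) * g b" by simp
  qed
  finally show ?thesis .
qed

text \<open>With \<open>F = 1\<close> the inner sums are rising factorials at \<open>x = 1\<close>:
  \<open>pochhammer (-1) b\<close> vanishes for \<open>b > 1\<close>, and the weight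
  \<open>b\<close> removes the empty set, leaving \<open>b = 1\<close>.\<close>

lemma card_cyclic_permutations:
  assumes fin: "finite A" and ne: "A \<noteq> {}"
  shows "real (card A) * real (card {\<sigma>. \<sigma> permutes A \<and> num_cycles \<sigma> A = 1}) = fact (card A)"
proof -
  let ?n = "card A"
  have n: "?n > 0" using fin ne by (simp add: card_gt_0_iff)
  have "real ?n * real (card {\<sigma>. \<sigma> permutes A \<and> num_cycles \<sigma> A = 1})
      = - (\<Sum>B\<in>Pow A. real (card B) * (\<Sum>\<sigma>\<in>stab A B. (-1) ^ num_cycles \<sigma> B * 1))"
    using sum_cyclic_eq_sum_stab[OF fin ne, of "\<lambda>_. 1"] by simp
  also have "(\<Sum>B\<in>Pow A. real (card B) * (\<Sum>\<sigma>\<in>stab A B. (-1) ^ num_cycles \<sigma> B * 1))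
      = (\<Sum>B\<in>Pow A. real (card B) * (pochhammer (-1) (card B) * fact (?n - card B)))"
  proof (rule sum.cong[OF refl])
    fix B assume "B \<in> Pow A"
    then have B: "B \<subseteq> A" by simp
    then have "card (A - B) = ?n - card B" using fin finite_subset by (intro card_Diff_subset) auto
    then show "real (card B) * (\<Sum>\<sigma>\<in>stab A B. (-1) ^ num_cycles \<sigma> B * 1)
       = real (card B) * (pochhammer (-1) (card B) * fact (?n - card B))"
      using scyc_id[OF fin B, of 1] by (simp add: scyc_def pochhammer_fact)
  qed
  also have "\<dots> = (\<Sum>b\<le>?n. real (?n choose b) * (real b * (pochhammer (-1) b * fact (?n - b))))"
    by (rule sum_Pow_card[OF fin])
  also have "\<dots> = (\<Sum>b\<in>{1}. real (?n choose b) * (real b * (pochhammer (-1) b * fact (?n - b))))"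
  proof (rule sum.mono_neutral_right)
    show "\<forall>b\<in>{..?n} - {1}. real (?n choose b) * (real b * (pochhammer (-1) b * fact (?n - b))) = 0"
    proof
      fix b assume "b \<in> {..?n} - {1}"
      then have "b = 0 \<or> b > 1" by auto
      moreover have "pochhammer (-1::real) b = 0" if "b > 1"
        using pochhammer_of_nat_eq_0_lemma[of 1 b, where 'a = real] that by simp
      ultimately show "real (?n choose b) * (real b * (pochhammer (-1) b * fact (?n - b))) = 0" by auto
    qed
  qed (use n in auto)
  also have "\<dots> = - fact ?n" using n by (simp add: fact_reduce)
  finally show ?thesis by simp
qed

text \<open>The map taking \<open>i\<close> to \<open>(\<sigma> ^^ (i - 1)) 1\<close> conjugates
  \<open>tau1\<close> to the full cycle \<open>\<sigma>\<close>, and relabelling along it permutes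
  the chord systems. The sum is thus the same for all full cycles, which is what permits averaging
  over them.\<close>

lemma sum_fpfs_conjugate:
  assumes n: "n > 0" and \<sigma>: "\<sigma> permutes {1..2*n}" "num_cycles \<sigma> {1..2*n} = 1"
  shows "(\<Sum>\<iota>\<in>fpfs {1..2*n}. F (num_cycles (\<sigma> \<circ> \<iota>) {1..2*n})) = (\<Sum>\<iota>\<in>fpfs {1..2*n}. F (num_cycles (tau1 n \<circ> \<iota>) {1..2*n}))"
proof -
  let ?A = "{1..2*n}"
  have p: "permutation \<sigma>" using \<sigma>(1) by (rule permutation_of_permutes_interval)
  have 1: "1 \<in> ?A" using n by auto
  have self: "1 \<in> orbit \<sigma> 1" by (rule permutation_self_in_orbit[OF p])
  have orb: "orbit \<sigma> 1 = ?A"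
  proof
    show "orbit \<sigma> 1 \<subseteq> ?A" using permutes_orbit_subset[OF \<sigma>(1) 1] .
    obtain Z where Z: "orbit \<sigma> ` ?A = {Z}"
      using \<sigma>(2) by (auto simp: num_cycles_orbit[OF p] card_1_singleton_iff)
    show "?A \<subseteq> orbit \<sigma> 1"
    proof
      fix y assume "y \<in> ?A"
      then have "orbit \<sigma> y = orbit \<sigma> 1" using Z 1 by (metis imageI singletonD)
      then show "y \<in> orbit \<sigma> 1" using permutation_self_in_orbit[OF p, of y] by simp
    qed
  qed
  define d where "d = funpow_dist1 \<sigma> 1 1"
  have im: "?A = (\<lambda>k. (\<sigma> ^^ k) 1) ` {0..<d}"
    unfolding d_def using orbit_conv_funpow_dist1[OF self] orb by simp
  have inj: "inj_on (\<lambda>k. (\<sigma> ^^ k) 1) {0..<d}"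
    unfolding d_def by (rule inj_on_funpow_dist1[OF self])
  have d: "d = 2*n" using card_image[OF inj] im by (metis card_atLeastAtMost card_atLeastLessThan diff_Suc_1 diff_zero One_nat_def)
  have per: "(\<sigma> ^^ (2*n)) 1 = 1" using funpow_dist1_prop[OF self] d by (simp only: d_def)
  define \<phi> where "\<phi> = (\<lambda>i. (\<sigma> ^^ (i - 1)) 1)"
  have inj\<phi>: "inj_on \<phi> ?A"
  proof (rule inj_onI)
    fix i j assume ij: "i \<in> ?A" "j \<in> ?A" "\<phi> i = \<phi> j"
    then have "i - 1 = j - 1" using inj_onD[OF inj, of "i - 1" "j - 1"] d unfolding \<phi>_def by auto
    then show "i = j" using ij by auto
  qed
  have im\<phi>: "\<phi> ` ?A = ?A"
  proof -
    have "\<phi> ` ?A = (\<lambda>k. (\<sigma> ^^ k) 1) ` ((\<lambda>i. i - 1) ` ?A)" unfolding \<phi>_def by (simp add: image_image)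
    also have "(\<lambda>i. i - 1) ` ?A = {0..<d}"
    proof (intro equalityI subsetI)
      fix k assume "k \<in> {0..<d}"
      then show "k \<in> (\<lambda>i. i - 1) ` ?A" using d by (intro rev_image_eqI[of "k+1"]) auto
    qed (use d in auto)
    finally show ?thesis using im by simp
  qed
  have \<phi>\<tau>: "\<sigma> (\<phi> i) = \<phi> (tau1 n i)" if "i \<in> ?A" for i
  proof (cases "i = 2*n")
    case True
    have "\<sigma> (\<phi> i) = (\<sigma> ^^ Suc (i - 1)) 1" unfolding \<phi>_def by simp
    also have "\<dots> = 1" using per True n by simp
    finally show ?thesis using True n by (simp add: tau1_def \<phi>_def)
  next
    case False
    have "\<sigma> (\<phi> i) = (\<sigma> ^^ Suc (i - 1)) 1" unfolding \<phi>_def by simp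
    also have "Suc (i - 1) = i" using that by simp
    finally show ?thesis using that False by (simp add: tau1_def \<phi>_def)
  qed
  have "(\<Sum>\<iota>\<in>fpfs ?A. F (num_cycles (\<sigma> \<circ> \<iota>) ?A)) = (\<Sum>\<iota>\<in>fpfs (\<phi> ` ?A). F (num_cycles (\<sigma> \<circ> \<iota>) (\<phi> ` ?A)))"
    unfolding im\<phi> ..
  also have "\<dots> = (\<Sum>\<iota>\<in>fpfs ?A. F (num_cycles (\<sigma> \<circ> map_permutation ?A \<phi> \<iota>) (\<phi> ` ?A)))"
    by (rule sum_fpfs_relabel[OF inj\<phi>])
  also have "\<dots> = (\<Sum>\<iota>\<in>fpfs ?A. F (num_cycles (tau1 n \<circ> \<iota>) ?A))"
  proof (intro sum.cong refl arg_cong[of _ _ F] num_cycles_relabel[OF inj\<phi>])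
    fix \<iota> x assume \<iota>: "\<iota> \<in> fpfs ?A" and x: "x \<in> ?A"
    have ix: "\<iota> x \<in> ?A" using permutes_in_image[OF fpfs_permutes[OF \<iota>]] x by blast
    then show "(tau1 n \<circ> \<iota>) x \<in> ?A" using permutes_in_image[OF tau1_permutes, of n "\<iota> x"] by simp
    show "(\<sigma> \<circ> map_permutation ?A \<phi> \<iota>) (\<phi> x) = \<phi> ((tau1 n \<circ> \<iota>) x)"
      using map_permutation_apply[OF inj\<phi> x, of \<iota>] \<phi>\<tau>[OF ix] by simp
  qed
  finally show ?thesis .
qed

text \<open>The Harer-Zagier polynomial: the sides of a \<open>2*n\<close>-gon are glued in pairs,
  and \<open>x\<close> marks the vertices of the resulting surface.\<close>

definition gluing :: "nat \<Rightarrow> real \<Rightarrow> real" where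
  "gluing n x = (\<Sum>\<iota>\<in>fpfs {1..2*n}. x ^ bnd1 n \<iota>)"

text \<open>Averaging over the full cycles and inserting the sign formula reduces everything to
  \<open>scyc\<close>. A crossing chord divides by \<open>x\<close>, whence
  \<open>x \<noteq> 0\<close>. The binomial coefficients cancel against the factorial of
  \<open>2*n\<close> and leave a convolution.\<close>

theorem gluing_formula:
  assumes n: "n > 0" and x: "x \<noteq> 0"
  shows "gluing n x = - (\<Sum>b\<le>2*n. real b * scyc_total 1 (1/x) b (2*n-b)
     * (pochhammer (-x) b / fact b) * (pochhammer x (2*n-b) / fact (2*n-b)))"
proof -
  let ?A = "{1..2*n}"
  define P where "P = (\<lambda>b. pochhammer (-x) b * pochhammer x (2*n-b))"
  have fin: "finite ?A" and ne: "?A \<noteq> {}" and cA: "card ?A = 2*n" using n by auto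
  let ?C = "{\<sigma>. \<sigma> permutes ?A \<and> num_cycles \<sigma> ?A = 1}"
  define \<Phi> where "\<Phi> = (\<lambda>\<sigma>. \<Sum>\<iota>\<in>fpfs ?A. x ^ num_cycles (\<sigma> \<circ> \<iota>) ?A)"
  have "\<Phi> \<sigma> = gluing n x" if "\<sigma> \<in> ?C" for \<sigma>
    using sum_fpfs_conjugate[OF n, of \<sigma> "\<lambda>k. x ^ k"] that n by (simp add: \<Phi>_def gluing_def bnd1_def)
  then have "fact (2*n) * gluing n x = real (card ?A) * (\<Sum>\<sigma>\<in>?C. \<Phi> \<sigma>)"
    using card_cyclic_permutations[OF fin ne] cA by simp
  also have "\<dots> = - (\<Sum>B\<in>Pow ?A. real (card B) * (\<Sum>\<sigma>\<in>stab ?A B. (-1) ^ num_cycles \<sigma> B * \<Phi> \<sigma>))"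
    by (rule sum_cyclic_eq_sum_stab[OF fin ne])
  also have "(\<Sum>B\<in>Pow ?A. real (card B) * (\<Sum>\<sigma>\<in>stab ?A B. (-1) ^ num_cycles \<sigma> B * \<Phi> \<sigma>))
     = (\<Sum>B\<in>Pow ?A. real (card B) * (scyc_total 1 (1/x) (card B) (2*n - card B) * P (card B)))"
  proof (rule sum.cong[OF refl])
    fix B assume "B \<in> Pow ?A"
    then have B: "B \<subseteq> ?A" by simp
    then have cB: "card (?A - B) = 2*n - card B" "card (?A \<inter> B) = card B"
      using finite_subset[OF B fin] card_Diff_subset[of B ?A] cA by (auto simp: Int_absorb1)
    have F0: "scyc ?A B x id = P (card B)" using scyc_id[OF fin B, of x] cB by (simp add: P_def)
    have F1: "scyc ?A B x (swap u v) = P (card B) / x" if "u \<in> B" "v \<in> ?A - B" for u v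
      using scyc_one_crossing[OF fin B that, of x] x F0 by (simp add: field_simps)
    have "(\<Sum>\<sigma>\<in>stab ?A B. (-1) ^ num_cycles \<sigma> B * \<Phi> \<sigma>) = (\<Sum>\<iota>\<in>fpfs ?A. scyc ?A B x \<iota>)"
      unfolding \<Phi>_def scyc_def sum_distrib_left by (rule sum.swap)
    also have "\<dots> = scyc_total (P (card B)) (P (card B) / x) (card B) (2*n - card B)"
      using sum_fpfs_scyc[OF fin B order_refl F1] cB F0 by simp
    also have "\<dots> = scyc_total 1 (1/x) (card B) (2*n - card B) * P (card B)"
      by (simp add: scyc_total_def algebra_simps)
    finally show "real (card B) * (\<Sum>\<sigma>\<in>stab ?A B. (-1) ^ num_cycles \<sigma> B * \<Phi> \<sigma>)
       = real (card B) * (scyc_total 1 (1/x) (card B) (2*n - card B) * P (card B))" by simp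
  qed
  also have "\<dots> = (\<Sum>b\<le>2*n. real (2*n choose b) * (real b * (scyc_total 1 (1/x) b (2*n-b) * P b)))"
    using sum_Pow_card[OF fin, of "\<lambda>b. real b * (scyc_total 1 (1/x) b (2*n-b) * P b)"] cA by simp
  also have "\<dots> = fact (2*n) * (\<Sum>b\<le>2*n. real b * scyc_total 1 (1/x) b (2*n-b)
     * (pochhammer (-x) b / fact b) * (pochhammer x (2*n-b) / fact (2*n-b)))"
    unfolding sum_distrib_left
    by (intro sum.cong refl) (simp add: binomial_fact P_def field_simps)
  finally have "fact (2*n) * gluing n x = fact (2*n) * - (\<Sum>b\<le>2*n. real b * scyc_total 1 (1/x) b (2*n-b)
     * (pochhammer (-x) b / fact b) * (pochhammer x (2*n-b) / fact (2*n-b)))" by simp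
  then show ?thesis by (simp only: mult_cancel_left fact_nonzero simp_thms)
qed

section \<open>A differential system for the Hermite-like series\<close>

definition fps_theta :: "'a::comm_ring_1 fps \<Rightarrow> 'a fps" where
  "fps_theta f = fps_X * fps_deriv f"

lemma fps_theta_nth: "fps_nth (fps_theta f) k = of_nat k * fps_nth f k"
  by (cases k) (simp_all add: fps_theta_def)

lemma fps_theta_mult: "fps_theta (f * g) = fps_theta f * g + f * fps_theta g"
  by (simp add: fps_theta_def algebra_simps)

lemma fps_theta_add: "fps_theta (f + g) = fps_theta f + fps_theta g"
  by (simp add: fps_theta_def algebra_simps)

lemma fps_theta_diff: "fps_theta (f - g) = fps_theta f - fps_theta g"
  by (simp add: fps_theta_def algebra_simps)

lemma fps_theta_X2: "fps_theta (fps_X ^ 2) = 2 * fps_X ^ 2"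
  by (simp add: fps_theta_def power2_eq_square algebra_simps)

text \<open>For \<open>e = -1\<close> and \<open>y = -N\<close> this is \<open>t^N He\<^sub>N(1/t)\<close> with the Hermite polynomial \<open>He\<^sub>N\<close>; the next two
  lemmas are the derivative rule and the three-term recurrence.\<close>

definition herm :: "real \<Rightarrow> real \<Rightarrow> real fps" where
  "herm e y = Abs_fps (\<lambda>b. matchings e b / fact b * pochhammer y b)"

lemma herm_theta: "fps_theta (herm e y) = fps_const y * (herm e (y + 1) - herm e y)"
proof (rule fps_ext)
  fix b
  have "(y + real b) * pochhammer y b = y * pochhammer (y + 1) b"
    by (metis pochhammer_rec pochhammer_rec')
  then have "real b * pochhammer y b = y * (pochhammer (y + 1) b - pochhammer y b)"
    by (simp add: algebra_simps)
  then have "matchings e b / fact b * (real b * pochhammer y b) = matchings e b / fact b * (y * (pochhammer (y + 1) b - pochhammer y b))"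
    by simp
  then show "fps_nth (fps_theta (herm e y)) b = fps_nth (fps_const y * (herm e (y + 1) - herm e y)) b"
    by (simp add: fps_theta_nth herm_def algebra_simps)
qed

lemma herm_shift:
  "herm e (y + 1) - herm e y = fps_const e * (fps_X ^ 2 * (fps_theta (herm e (y + 1)) + fps_const (y + 1) * herm e (y + 1)))"
proof (rule fps_ext)
  fix b
  consider "b = 0" | "b = 1" | c where "b = Suc (Suc c)"
    by (metis One_nat_def not0_implies_Suc)
  then show "fps_nth (herm e (y + 1) - herm e y) b =
    fps_nth (fps_const e * (fps_X ^ 2 * (fps_theta (herm e (y + 1)) + fps_const (y + 1) * herm e (y + 1)))) b"
  proof cases
    case 3
    have 1: "pochhammer (y + 1) b = (y + 1 + real (Suc c)) * ((y + 1 + real c) * pochhammer (y + 1) c)"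
      unfolding 3 by (simp only: pochhammer_rec')
    have 2: "pochhammer y b = y * ((y + 1 + real c) * pochhammer (y + 1) c)"
      unfolding 3 by (subst pochhammer_rec) (simp only: pochhammer_rec')
    have 3: "pochhammer (y + 1) b - pochhammer y b = (real c + 2) * ((y + 1 + real c) * pochhammer (y + 1) c)"
      unfolding 1 2 by (simp add: algebra_simps)
    \<comment> \<open>The factor \<open>c + 2\<close> comes from the difference of rising factorials
      and \<open>c + 1\<close> from the matchings; together they take \<open>fact b\<close> down to
      \<open>fact c\<close>.\<close>
    have m: "matchings e b / fact b * (real c + 2) = e * (matchings e c / fact c)"
      unfolding \<open>b = Suc (Suc c)\<close> by (simp add: divide_simps) (simp add: algebra_simps)
    have "fps_nth (herm e (y + 1) - herm e y) b = matchings e b / fact b * (pochhammer (y + 1) b - pochhammer y b)"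
      by (simp add: herm_def algebra_simps)
    also have "\<dots> = (matchings e b / fact b * (real c + 2)) * ((y + 1 + real c) * pochhammer (y + 1) c)"
      unfolding 3 by simp
    also have "\<dots> = e * (matchings e c / fact c) * ((y + 1 + real c) * pochhammer (y + 1) c)"
      unfolding m ..
    also have "\<dots> = fps_nth (fps_const e * (fps_X ^ 2 * (fps_theta (herm e (y + 1)) + fps_const (y + 1) * herm e (y + 1)))) b"
      using \<open>b = Suc (Suc c)\<close> by (simp add: fps_X_power_mult_nth fps_theta_nth herm_def algebra_simps add_divide_distrib)
    finally show ?thesis .
  qed (simp_all add: fps_X_power_mult_nth herm_def)
qed

text \<open>\<open>p\<close> and \<open>q\<close> belong to matchings inside \<open>B\<close>,
  \<open>r\<close> and \<open>s\<close> to those in the complement, where \<open>q\<close> and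
  \<open>s\<close> have the parameter raised by one. The series \<open>x * w\<close> carries the
  gluing numbers in even positive degrees, and \<open>y\<close> is the product of series that a
  crossing chord brings in.\<close>

locale hermite_pair =
  fixes x :: real
  assumes x: "x \<noteq> 0"
begin

definition "cx = (fps_const x :: real fps)"
definition "Z = (fps_X ^ 2 :: real fps)"
definition "p = herm (-1) (-x)"
definition "q = herm (-1) (1 - x)"
definition "r = herm 1 x"
definition "s = herm 1 (x + 1)"
definition "y = Z * (q * s)"
definition "w = (p - q) * (s - r) + cx * y"

lemma theta_p: "fps_theta p = cx * (p - q)"
  using herm_theta[of "-1" "-x"] by (simp add: p_def q_def cx_def algebra_simps flip: fps_const_neg)

lemma theta_r: "fps_theta r = cx * (s - r)"
  using herm_theta[of 1 x] by (simp add: r_def s_def cx_def)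

text \<open>\<open>herm_shift\<close> determines \<open>fps_theta q\<close> only after division by
  the square of the variable. This relation and the next therefore stay multiplied by
  \<open>Z\<close>, and the later eliminations work modulo them.\<close>

lemma theta_q: "Z * fps_theta q = Z * (cx - 1) * q + p - q"
proof -
  have "q - p = - (Z * (fps_theta q + (1 - cx) * q))"
    using herm_shift[of "-1" "-x"]
    by (simp add: p_def q_def Z_def cx_def add.commute flip: fps_const_neg fps_const_sub fps_const_add)
  then show ?thesis by (simp add: algebra_simps)
qed

lemma theta_s: "Z * fps_theta s = - Z * (cx + 1) * s + s - r"
proof -
  have "s - r = Z * (fps_theta s + (cx + 1) * s)"
    using herm_shift[of 1 x]
    by (simp add: r_def s_def Z_def cx_def flip: fps_const_add)
  then show ?thesis by (simp add: algebra_simps)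
qed

lemma theta_Z: "fps_theta Z = 2 * Z"
  unfolding Z_def by (rule fps_theta_X2)

lemma theta_cx: "fps_theta cx = 0"
  by (simp add: cx_def fps_theta_def)

lemmas theta_simps = fps_theta_mult fps_theta_add fps_theta_diff theta_Z theta_cx

lemma theta_y: "fps_theta y = q * (s - r) + (p - q) * s"
  using theta_q theta_s unfolding y_def theta_simps by algebra

text \<open>With \<open>theta_y\<close> this exhibits \<open>q * (s - r)\<close> and
  \<open>(p - q) * s\<close> as half the sum and half the difference of the derivatives of
  \<open>y\<close> and \<open>w\<close>, which is why these two series satisfy a closed
  system.\<close>

lemma theta_w: "fps_theta w = q * (s - r) - (p - q) * s"
proof -
  have "Z * fps_theta w = Z * (q * (s - r) - (p - q) * s)"
    unfolding w_def theta_simps theta_y theta_p theta_r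
    using theta_q theta_s unfolding y_def by algebra
  then show ?thesis by (simp add: Z_def)
qed

lemma ode1: "Z * (fps_theta (fps_theta w) + fps_theta w) = fps_theta y - 2 * y"
  unfolding theta_w theta_y theta_simps theta_p theta_r
  using theta_q theta_s unfolding y_def by algebra

lemma ode2: "Z * (fps_theta (fps_theta y) + fps_theta y) = fps_theta w + 2 * w - 4 * cx * y"
  unfolding theta_w theta_y theta_simps theta_p theta_r
  using theta_q theta_s unfolding w_def y_def by algebra

text \<open>At index \<open>k + 2\<close> the right-hand side of \<open>ode1\<close> carries the
  factor \<open>k\<close>, and so does the left-hand side; cancelling it keeps the final recursion
  cubic. At \<open>k = 0\<close> the relation fails: \<open>w\<close> has no constant term, while
  \<open>y\<close> has coefficient 1 at index 2.\<close>

lemma coeff_rec1: "k \<noteq> 0 \<Longrightarrow> real (k + 1) * fps_nth w k = fps_nth y (k + 2)"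
proof -
  assume k: "k \<noteq> 0"
  have "fps_nth (Z * (fps_theta (fps_theta w) + fps_theta w)) (k + 2) = fps_nth (fps_theta y - 2 * y) (k + 2)"
    by (simp only: ode1)
  then have "real k * (real k * fps_nth w k) + real k * fps_nth w k = real k * fps_nth y (k + 2)"
    by (simp add: Z_def fps_X_power_mult_nth fps_theta_nth numeral_fps_const) (simp add: algebra_simps)
  then have "real k * (real k * fps_nth w k + fps_nth w k - fps_nth y (k + 2)) = 0"
    by (simp only: right_diff_distrib distrib_left)
  then have "real k * fps_nth w k + fps_nth w k - fps_nth y (k + 2) = 0"
    using k by (simp only: mult_eq_0_iff of_nat_eq_0_iff simp_thms)
  then show ?thesis by (simp add: algebra_simps)
qed

lemma coeff_rec2: "real k * real (k + 1) * fps_nth y k = real (k + 4) * fps_nth w (k + 2) - 4 * x * fps_nth y (k + 2)"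
proof -
  have "fps_nth (Z * (fps_theta (fps_theta y) + fps_theta y)) (k + 2) = fps_nth (fps_theta w + 2 * w - 4 * cx * y) (k + 2)"
    by (simp only: ode2)
  then show ?thesis
    by (simp add: Z_def cx_def fps_X_power_mult_nth fps_theta_nth mult.assoc numeral_fps_const) (simp add: algebra_simps)
qed

lemma y_2: "fps_nth y 2 = 1"
  by (simp add: y_def Z_def fps_X_power_mult_nth q_def s_def herm_def)

text \<open>\<open>fps_theta\<close> supplies the weight \<open>b\<close> of the formula.
  \<open>p'\<close> and \<open>r'\<close> include the choice of the endpoint of the crossing chord
  on either side; as \<open>b / fact b\<close> is \<open>1 / fact (b - 1)\<close>, they are shifts
  of \<open>q\<close> and \<open>s\<close>.\<close>

lemma gluing_eq_coeff:
  assumes n: "n > 0"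
  shows "gluing n x = x * fps_nth w (2*n)"
proof -
  define p' where "p' = Abs_fps (\<lambda>b. real b * (matchings (-1) (b - 1) / fact b * pochhammer (-x) b))"
  define r' where "r' = Abs_fps (\<lambda>a. real a * (matchings 1 (a - 1) / fact a * pochhammer x a))"
  have p': "p' = - (cx * (fps_X * q))"
  proof (rule fps_ext)
    fix b show "fps_nth p' b = fps_nth (- (cx * (fps_X * q))) b"
    proof (cases b)
      case (Suc c)
      have "real (Suc c) * (u / fact (Suc c) * v) = u / fact c * v" for u v :: real
        by (simp add: divide_simps)
      moreover have "pochhammer (-x) (Suc c) = - x * pochhammer (1 - x) c" by (simp add: pochhammer_rec add.commute)
      ultimately show ?thesis using Suc
        by (simp add: p'_def cx_def q_def herm_def del: of_nat_Suc fact_Suc)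
    qed (simp add: p'_def cx_def)
  qed
  have r': "r' = cx * (fps_X * s)"
  proof (rule fps_ext)
    fix b show "fps_nth r' b = fps_nth (cx * (fps_X * s)) b"
    proof (cases b)
      case (Suc c)
      have "real (Suc c) * (u / fact (Suc c) * v) = u / fact c * v" for u v :: real
        by (simp add: divide_simps)
      moreover have "pochhammer x (Suc c) = x * pochhammer (x + 1) c" by (simp add: pochhammer_rec)
      ultimately show ?thesis using Suc
        by (simp add: r'_def cx_def s_def herm_def del: of_nat_Suc fact_Suc)
    qed (simp add: r'_def cx_def)
  qed
  have "gluing n x = - (\<Sum>b\<le>2*n. fps_nth (fps_theta p) b * fps_nth r (2*n-b)
      + 1 / x * (fps_nth (fps_theta p') b * fps_nth r' (2*n-b)))"
    unfolding gluing_formula[OF n x]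
    by (intro arg_cong[of _ _ uminus] sum.cong refl)
      (simp add: scyc_total_def fps_theta_nth p_def r_def herm_def p'_def r'_def divide_inverse algebra_simps)
  also have "\<dots> = - (fps_nth (fps_theta p * r) (2*n) + 1 / x * fps_nth (fps_theta p' * r') (2*n))"
    by (simp add: fps_mult_nth sum.distrib sum_distrib_left atLeast0AtMost)
  also have "\<dots> = fps_nth (- (fps_theta p * r) - fps_const (1 / x) * (fps_theta p' * r')) (2*n)"
    by simp
  also have "- (fps_theta p * r) - fps_const (1 / x) * (fps_theta p' * r') = cx * w"
  proof -
    have tX: "fps_theta fps_X = (fps_X :: real fps)" by (simp add: fps_theta_def)
    have inv: "fps_const (1 / x) * cx = 1" using x by (simp add: cx_def)
    have tp': "fps_theta p' = - (cx * (fps_X * q + fps_X * fps_theta q))"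
      unfolding p' by (simp add: fps_theta_def cx_def algebra_simps)
    have "- (fps_const (1 / x) * (fps_theta p' * r')) = (fps_const (1 / x) * cx) * (cx * ((Z * q + Z * fps_theta q) * s))"
      unfolding tp' r' Z_def by (simp add: algebra_simps power2_eq_square)
    also have "\<dots> = cx * ((cx * Z * q + p - q) * s)" unfolding inv theta_q by (simp add: algebra_simps)
    finally have "- (fps_theta p * r) - fps_const (1 / x) * (fps_theta p' * r')
        = - (cx * (p - q) * r) + cx * ((cx * Z * q + p - q) * s)" unfolding theta_p by (simp add: algebra_simps)
    also have "\<dots> = cx * w" unfolding w_def y_def by (simp add: algebra_simps)
    finally show ?thesis .
  qed
  finally show ?thesis by (simp add: cx_def)
qed

end

lemma gluing_0: "gluing 0 x = x"
  by (simp add: gluing_def bnd1_def num_cycles_empty)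

theorem gluing_rec:
  assumes "x \<noteq> 0"
  shows "real (n + 3) * gluing (n + 2) x = 2 * real (2*n + 3) * x * gluing (n + 1) x
     + real (2*n + 3) * real (n + 1) * real (2*n + 1) * gluing n x"
proof -
  interpret hermite_pair x by unfold_locales fact
  have y4: "fps_nth y (2*n + 4) = real (2*n + 3) * fps_nth w (2*n + 2)"
    using coeff_rec1[of "2*n + 2"] by (simp add: algebra_simps eval_nat_numeral)
  have g0: "x * fps_nth y (2*n + 2) = real (2*n + 1) * gluing n x"
  proof (cases "n = 0")
    case True
    then show ?thesis using y_2 by (simp add: gluing_0 numeral_2_eq_2)
  next
    case False
    then show ?thesis using coeff_rec1[of "2*n"] gluing_eq_coeff[of n] by (simp add: algebra_simps)
  qed
  have g1: "gluing (n + 1) x = x * fps_nth w (2*n + 2)" using gluing_eq_coeff[of "n + 1"] by simp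
  have g2: "gluing (n + 2) x = x * fps_nth w (2*n + 4)" using gluing_eq_coeff[of "n + 2"] by (simp add: eval_nat_numeral)
  have "real (2*n + 2) * real (2*n + 3) * fps_nth y (2*n + 2) = real (2*n + 6) * fps_nth w (2*n + 4) - 4 * x * fps_nth y (2*n + 4)"
    using coeff_rec2[of "2*n + 2"] by (simp add: algebra_simps eval_nat_numeral)
  then have "real (2*n + 2) * real (2*n + 3) * (x * fps_nth y (2*n + 2)) = real (2*n + 6) * (x * fps_nth w (2*n + 4)) - 4 * x * (real (2*n + 3) * (x * fps_nth w (2*n + 2)))"
    unfolding y4 by algebra
  then have "real (2*n + 2) * real (2*n + 3) * (real (2*n + 1) * gluing n x) = real (2*n + 6) * gluing (n + 2) x - 4 * x * (real (2*n + 3) * gluing (n + 1) x)"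
    unfolding g0 g1 g2 .
  then show ?thesis by (simp add: algebra_simps)
qed

section \<open>From polynomials in x to the numbers of diagrams\<close>

definition gluing_poly :: "nat \<Rightarrow> real poly" where
  "gluing_poly n = (\<Sum>\<iota>\<in>fpfs {1..2*n}. monom 1 (bnd1 n \<iota>))"

lemma poly_gluing_poly: "poly (gluing_poly n) x = gluing n x"
  by (simp add: gluing_poly_def gluing_def poly_sum poly_monom)

text \<open>Multiplication by the variable removes the exception at 0.\<close>

lemma poly_eq_if_eq_nonzero:
  fixes p q :: "real poly"
  assumes "\<And>x. x \<noteq> 0 \<Longrightarrow> poly p x = poly q x"
  shows "p = q"
proof -
  have "[:0, 1:] * p = [:0, 1:] * q"
    by (rule poly_eq_poly_eq_iff[THEN iffD1]) (use assms in \<open>auto simp: fun_eq_iff\<close>)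
  then show ?thesis by simp
qed

lemma gluing_poly_rec:
  "smult (real (n + 3)) (gluing_poly (n + 2)) = smult (2 * real (2*n + 3)) (pCons 0 (gluing_poly (n + 1)))
     + smult (real (2*n + 3) * real (n + 1) * real (2*n + 1)) (gluing_poly n)"
  by (rule poly_eq_if_eq_nonzero) (use gluing_rec in \<open>simp add: poly_gluing_poly algebra_simps\<close>)

lemma coeff_gluing_poly: "coeff (gluing_poly n) k = real (card {\<iota> \<in> fpfs {1..2*n}. bnd1 n \<iota> = k})"
  unfolding gluing_poly_def coeff_sum coeff_monom
  by (simp add: sum.If_cases finite_fpfs Int_def)

lemma cnum_eq_coeff:
  assumes "2*g \<le> n + 1"
  shows "real (cnum g n) = coeff (gluing_poly n) (n + 1 - 2*g)"
proof -
  have "cnum g n = (\<Sum>\<iota>\<in>fpfs {1..2*n}. of_bool (bnd1 n \<iota> = n + 1 - 2*g))"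
    unfolding cnum_eq_sum by (intro sum.cong refl arg_cong[of _ _ of_bool]) (use assms in linarith)
  then show ?thesis
    by (simp add: coeff_gluing_poly sum_of_bool_eq finite_fpfs Int_def)
qed

lemma bnd1_pos: "0 < bnd1 n \<iota>"
  unfolding bnd1_def by (auto intro: num_cycles_pos)

lemma cnum_eq_0:
  assumes "n < 2*g"
  shows "cnum g n = 0"
proof -
  have "int n + 1 - int (bnd1 n \<iota>) \<noteq> 2 * int g" for \<iota>
    using bnd1_pos[of n \<iota>] assms by linarith
  then show ?thesis by (simp add: cnum_eq_sum)
qed

lemma coeff_gluing_poly_eq_0:
  assumes "n + 1 < k"
  shows "coeff (gluing_poly n) k = 0"
proof -
  have "{\<iota> \<in> fpfs {1..2*n}. bnd1 n \<iota> = k} = {}"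
    using bnd1_parity_bound[of _ n] assms by fastforce
  then show ?thesis by (simp only: coeff_gluing_poly card.empty of_nat_0)
qed

text \<open>Comparison of coefficients at \<open>n + 3 - 2*g\<close>, an exponent that for
  \<open>n\<close> chords belongs to genus \<open>g - 1\<close>. If \<open>2*g > n + 2\<close>, all
  the numbers involved vanish.\<close>

theorem cnum_rec:
  "real (n + 3) * real (cnum g (n + 2)) = 2 * real (2*n + 3) * real (cnum g (n + 1))
     + real (2*n + 3) * real (n + 1) * real (2*n + 1) * (if g = 0 then 0 else real (cnum (g - 1) n))"
proof (cases "2*g \<le> n + 2")
  case True
  define k where "k = n + 2 - 2*g"
  have 1: "real (cnum g (n + 2)) = coeff (gluing_poly (n + 2)) (Suc k)"
    using cnum_eq_coeff[of g "n + 2"] True by (simp add: k_def Suc_diff_le)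
  have 2: "real (cnum g (n + 1)) = coeff (gluing_poly (n + 1)) k"
    using cnum_eq_coeff[of g "n + 1"] True by (simp add: k_def)
  have 3: "(if g = 0 then 0 else real (cnum (g - 1) n)) = coeff (gluing_poly n) (Suc k)"
  proof (cases "g = 0")
    case True
    then show ?thesis using coeff_gluing_poly_eq_0[of n "Suc k"] by (simp add: k_def)
  next
    case False
    then have "n + 1 - 2 * (g - 1) = Suc k" using True by (auto simp: k_def)
    then show ?thesis using cnum_eq_coeff[of "g - 1" n] True False by auto
  qed
  show ?thesis unfolding 1 2 3
    using arg_cong[OF gluing_poly_rec[of n], of "\<lambda>p. coeff p (Suc k)"] by simp
next
  case False
  then have "cnum g (n + 2) = 0" "cnum g (n + 1) = 0" "cnum (g - 1) n = 0"
    by (intro cnum_eq_0; linarith)+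
  then show ?thesis by simp
qed

lemma cnum_at_0: "cnum g 0 = (if g = 0 then 1 else 0)"
  by (simp add: cnum_def)

section \<open>Generating functions\<close>

definition u1m4z :: "'a::comm_ring_1 fps" where "u1m4z = 1 - 4 * fps_X"

lemma u1m4z_alt: "u1m4z = 1 - fps_const 4 * fps_X"
  by (simp add: u1m4z_def numeral_fps_const)

lemma u1m4z_mult_nth: "fps_nth (u1m4z * f) n = fps_nth f n - (if n = 0 then 0 else 4 * fps_nth f (n - 1))"
proof -
  have "u1m4z * f = f - fps_const 4 * (fps_X * f)" by (simp add: u1m4z_alt algebra_simps)
  then show ?thesis by (cases n) simp_all
qed

lemma u1m4z_nth_0 [simp]: "fps_nth u1m4z 0 = 1"
  using u1m4z_mult_nth[of 1 0] by simp

lemma theta_u1m4z: "fps_theta u1m4z = - 4 * fps_X"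
  by (simp add: fps_theta_def u1m4z_alt numeral_fps_const)

text \<open>The recurrence of the central binomial coefficients, with ratio
  \<open>2*(2*k+1)/(k+1)\<close>, is the differential equation of (1-4z)^(-1/2).\<close>

lemma theta_inv_sqrt: "u1m4z * fps_theta inv_sqrt_1m4z = 2 * fps_X * inv_sqrt_1m4z"
proof (rule fps_ext)
  fix n
  show "fps_nth (u1m4z * fps_theta inv_sqrt_1m4z) n = fps_nth (2 * fps_X * inv_sqrt_1m4z) n"
  proof (cases n)
    case (Suc k)
    have "Suc k * (Suc (Suc (2*k)) choose Suc k) = Suc (Suc (2*k)) * (Suc (2*k) choose k)"
      by (rule Suc_times_binomial)
    also have "Suc (2*k) choose k = Suc (2*k) choose Suc k"
      using binomial_symmetric[of k "Suc (2*k)"] by (simp add: Suc_diff_le)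
    also have "Suc (Suc (2*k)) * (Suc (2*k) choose Suc k) = 2 * (Suc k * (Suc (2*k) choose Suc k))" by simp
    also have "Suc k * (Suc (2*k) choose Suc k) = Suc (2*k) * (2*k choose k)"
      by (rule Suc_times_binomial)
    finally have "int (Suc k * (Suc (Suc (2*k)) choose Suc k)) = int (2 * (Suc (2*k) * (2*k choose k)))"
      by (rule arg_cong)
    moreover have "Suc (Suc (2*k)) = 2 * Suc k" by simp
    ultimately have "int (Suc k) * int (2 * Suc k choose Suc k) = 2 * (int (Suc (2*k)) * int (2*k choose k))"
      by (simp only: of_nat_mult of_nat_numeral)
    then show ?thesis using Suc
      by (simp add: u1m4z_mult_nth fps_theta_nth inv_sqrt_1m4z_def numeral_fps_const mult.assoc
          del: binomial_Suc_Suc) (simp add: algebra_simps)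
  qed (simp add: u1m4z_mult_nth fps_theta_nth numeral_fps_const)
qed

lemma u1m4z_nonzero: "(u1m4z :: 'a::{comm_ring_1} fps) \<noteq> 0"
  using u1m4z_nth_0 by (metis fps_zero_nth zero_neq_one)

text \<open>The product has constant coefficient 1 and, by the product rule, derivative zero. This
  identifies \<open>inv_sqrt_1m4z\<close> as an inverse square root.\<close>

lemma inv_sqrt_square: "u1m4z * (inv_sqrt_1m4z * inv_sqrt_1m4z) = 1"
proof -
  let ?S = inv_sqrt_1m4z and ?u = "u1m4z :: int fps"
  have "fps_theta (?u * (?S * ?S)) = - 4 * fps_X * (?S * ?S) + 2 * (?u * fps_theta ?S) * ?S"
    by (simp add: fps_theta_mult theta_u1m4z algebra_simps)
  also have "\<dots> = 0" unfolding theta_inv_sqrt by (simp add: algebra_simps)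
  finally have th: "fps_theta (?u * (?S * ?S)) = 0" .
  show ?thesis
  proof (rule fps_ext)
    fix n
    show "fps_nth (?u * (?S * ?S)) n = fps_nth 1 n"
    proof (cases n)
      case 0
      then show ?thesis by (simp add: u1m4z_mult_nth inv_sqrt_1m4z_def)
    next
      case (Suc k)
      have "int n * fps_nth (?u * (?S * ?S)) n = 0" using arg_cong[OF th, of "\<lambda>f. fps_nth f n"] by (simp add: fps_theta_nth)
      then show ?thesis using Suc by simp
    qed
  qed
qed

lemma Cgf_mult_nth: "fps_nth (Cgf i * Cgf j) k = int (\<Sum>m\<le>k. cnum i m * cnum j (k - m))"
  by (simp add: Cgf_def fps_mult_nth atLeast0AtMost)

lemma Cgf_0_rec: "Cgf 0 = 1 + fps_X * (Cgf 0 * Cgf 0)"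
proof (rule fps_ext)
  fix n
  show "fps_nth (Cgf 0) n = fps_nth (1 + fps_X * (Cgf 0 * Cgf 0)) n"
  proof (cases n)
    case (Suc k)
    have "fps_nth (1 + fps_X * (Cgf 0 * Cgf 0)) n = fps_nth (Cgf 0 * Cgf 0) k" using Suc by simp
    then show ?thesis using cnum_Suc[of 0 k] Suc unfolding Cgf_mult_nth by (simp add: Cgf_def)
  qed (simp add: Cgf_def cnum_at_0)
qed

lemma Cgf_Suc_rec: "Cgf (Suc g) = fps_X * C2gf g + fps_X * (\<Sum>i\<le>Suc g. Cgf i * Cgf (Suc g - i))"
proof (rule fps_ext)
  fix n
  show "fps_nth (Cgf (Suc g)) n = fps_nth (fps_X * C2gf g + fps_X * (\<Sum>i\<le>Suc g. Cgf i * Cgf (Suc g - i))) n"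
  proof (cases n)
    case (Suc k)
    have "(\<Sum>m\<le>k. \<Sum>i\<le>Suc g. cnum i m * cnum (Suc g - i) (k - m)) = (\<Sum>i\<le>Suc g. \<Sum>m\<le>k. cnum i m * cnum (Suc g - i) (k - m))"
      by (rule sum.swap)
    then have "cnum (Suc g) (Suc k) = cnum2 g k + (\<Sum>i\<le>Suc g. \<Sum>m\<le>k. cnum i m * cnum (Suc g - i) (k - m))"
      using cnum_Suc[of "Suc g" k] by simp
    then have "int (cnum (Suc g) (Suc k)) = int (cnum2 g k) + (\<Sum>i\<le>Suc g. fps_nth (Cgf i * Cgf (Suc g - i)) k)"
      unfolding Cgf_mult_nth by (simp only: of_nat_add of_nat_sum)
    moreover have "fps_nth (fps_X * C2gf g + fps_X * (\<Sum>i\<le>Suc g. Cgf i * Cgf (Suc g - i))) n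
       = fps_nth (C2gf g) k + (\<Sum>i\<le>Suc g. fps_nth (Cgf i * Cgf (Suc g - i)) k)"
      unfolding Suc by (simp only: fps_add_nth fps_X_mult_nth fps_sum_nth) simp
    ultimately show ?thesis using Suc by (simp add: Cgf_def C2gf_def)
  qed (simp add: Cgf_def cnum_at_0)
qed

text \<open>Both sides square to 1 - 4z, the left one by the Catalan equation for
  \<open>Cgf 0\<close>. Hence their sum or their difference is zero, and the sum has constant
  coefficient 2.\<close>

lemma Cgf_0_sqrt: "1 - 2 * (fps_X * Cgf 0) = u1m4z * inv_sqrt_1m4z"
proof -
  let ?f = "1 - 2 * (fps_X * Cgf 0)" and ?S = inv_sqrt_1m4z and ?u = "u1m4z :: int fps"
  have "?f * ?f = 1 - 4 * fps_X * (Cgf 0 - fps_X * (Cgf 0 * Cgf 0))" by (simp add: algebra_simps)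
  also have "Cgf 0 - fps_X * (Cgf 0 * Cgf 0) = 1" using Cgf_0_rec by (metis add_diff_cancel_right')
  finally have "?f * ?f = ?u" by (simp add: u1m4z_def)
  moreover have "(?u * ?S) * (?u * ?S) = ?u" using inv_sqrt_square by (metis mult.assoc mult.commute mult.left_neutral)
  ultimately have "(?f - ?u * ?S) * (?f + ?u * ?S) = 0" by (simp add: algebra_simps)
  moreover have "fps_nth (?f + ?u * ?S) 0 = 2"
    by (simp add: u1m4z_mult_nth inv_sqrt_1m4z_def numeral_fps_const)
  then have "?f + ?u * ?S \<noteq> 0" by (metis fps_zero_nth zero_neq_numeral)
  ultimately have "?f - ?u * ?S = 0" by (metis mult_eq_0_iff)
  then show ?thesis by simp
qed

section \<open>Two-backbone series in terms of one-backbone series\<close>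

lemma Pfps_alt: "Pfps g = Cgf g * u1m4z ^ (3*g) * inv_sqrt_1m4z"
  by (simp add: Pfps_def u1m4z_def)

text \<open>The terms \<open>i = 0\<close> and \<open>i = g + 1\<close> of the convolution move to
  the left and form the factor 1 - 2 z C_0. In the other products the two inverse roots combine to
  1/(1-4z), which takes the exponent \<open>3*g+3\<close> down to \<open>3*g+2\<close>.\<close>

theorem C2gf_eq_Pfps:
  "fps_X * (C2gf g * u1m4z ^ (3*g+2)) = Pfps (g+1) - fps_X * (\<Sum>i=1..g. Pfps i * Pfps (g+1-i))"
proof -
  let ?u = "u1m4z :: int fps" and ?S = inv_sqrt_1m4z
  have split: "(\<Sum>i\<le>Suc g. Cgf i * Cgf (Suc g - i)) = 2 * (Cgf 0 * Cgf (Suc g)) + (\<Sum>i=1..g. Cgf i * Cgf (Suc g - i))"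
  proof -
    have "{..Suc g} = insert 0 (insert (Suc g) {1..g})" by auto
    then show ?thesis by (simp add: algebra_simps)
  qed
  have "fps_X * C2gf g = (1 - 2 * (fps_X * Cgf 0)) * Cgf (Suc g) - fps_X * (\<Sum>i=1..g. Cgf i * Cgf (Suc g - i))"
    using Cgf_Suc_rec[of g] unfolding split by (simp add: algebra_simps)
  then have "fps_X * (C2gf g * ?u ^ (3*g+2)) = (?u * ?S * Cgf (Suc g) - fps_X * (\<Sum>i=1..g. Cgf i * Cgf (Suc g - i))) * ?u ^ (3*g+2)"
    unfolding Cgf_0_sqrt by (simp only: mult.assoc[symmetric])
  also have "\<dots> = Cgf (Suc g) * (?u ^ (3*g+2) * ?u) * ?S - fps_X * (\<Sum>i=1..g. Cgf i * Cgf (Suc g - i) * ?u ^ (3*g+2))"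
    by (simp add: algebra_simps sum_distrib_left sum_distrib_right)
  also have "?u ^ (3*g+2) * ?u = ?u ^ Suc (3*g+2)" by (rule power_Suc2[symmetric])
  also have "Suc (3*g+2) = 3 * (g+1)" by simp
  also have "(\<Sum>i=1..g. Cgf i * Cgf (Suc g - i) * ?u ^ (3*g+2)) = (\<Sum>i=1..g. Pfps i * Pfps (g+1-i))"
  proof (rule sum.cong[OF refl])
    fix i assume "i \<in> {1..g}"
    then have e: "3 * i + 3 * (g+1-i) = Suc (3*g+2)" by auto
    have "Pfps i * Pfps (g+1-i) = Cgf i * Cgf (g+1-i) * ?u ^ (3 * i + 3 * (g+1-i)) * (?S * ?S)"
      by (simp add: Pfps_alt power_add algebra_simps)
    also have "\<dots> = Cgf i * Cgf (g+1-i) * ?u ^ (3*g+2) * (?u * (?S * ?S))"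
      unfolding e by (simp add: algebra_simps)
    finally show "Cgf i * Cgf (Suc g - i) * ?u ^ (3*g+2) = Pfps i * Pfps (g+1-i)"
      by (simp add: inv_sqrt_square)
  qed
  finally show ?thesis by (simp add: Pfps_alt)
qed

section \<open>Differential equations for the one-backbone series\<close>

definition fps_op :: "int \<Rightarrow> int fps \<Rightarrow> int fps" where
  "fps_op a f = 2 * fps_theta f + of_int a * f"

lemma fps_op_commute: "fps_op a (fps_op b f) = fps_op b (fps_op a f)"
  by (simp add: fps_op_def fps_theta_add fps_theta_mult algebra_simps fps_theta_def flip: fps_of_int)

lemma fps_op_nth: "fps_nth (fps_op a f) k = (2 * int k + a) * fps_nth f k"
  by (simp add: fps_op_def fps_theta_nth numeral_fps_const algebra_simps flip: fps_of_int)

text \<open>The weight (1-4z)^(k-1/2); \<open>wt (3*g)\<close> turns \<open>Cgf g\<close> into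
  \<open>Pfps g\<close>.\<close>

definition wt :: "nat \<Rightarrow> int fps" where
  "wt k = u1m4z ^ k * inv_sqrt_1m4z"

lemma theta_wt: "u1m4z * fps_theta (wt k) = of_int (2 - 4 * int k) * fps_X * wt k"
proof (induction k)
  case 0
  then show ?case using theta_inv_sqrt by (simp add: wt_def)
next
  case (Suc k)
  have "wt (Suc k) = u1m4z * wt k" by (simp add: wt_def)
  then have "u1m4z * fps_theta (wt (Suc k)) = u1m4z * (- 4 * fps_X * wt k + u1m4z * fps_theta (wt k))"
    by (simp add: fps_theta_mult theta_u1m4z)
  also have "\<dots> = of_int (2 - 4 * int (Suc k)) * fps_X * (u1m4z * wt k)"
    unfolding Suc by (simp add: algebra_simps)
  finally show ?case by (simp add: wt_def mult.assoc)
qed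

text \<open>The operator \<open>2 \<theta> + a\<close> after conjugation with the weight \<open>(1 - 4z)^(k - 1/2)\<close>, up to a factor \<open>1 - 4z\<close>.\<close>

definition fps_L :: "nat \<Rightarrow> int \<Rightarrow> int fps \<Rightarrow> int fps" where
  "fps_L k a f = u1m4z * fps_op a f + of_int (8 * int k - 4) * fps_X * f"

text \<open>Product rule with \<open>theta_wt\<close>. Each operator uses up one factor 1 - 4z, so
  three of them raise the index of the weight from \<open>3*g\<close> to \<open>3*g+3\<close>, just
  what the passage to the next genus requires.\<close>

lemma fps_op_wt: "fps_op a f * wt (Suc k) = fps_L k a (f * wt k)"
proof -
  have w: "wt (Suc k) = u1m4z * wt k" by (simp add: wt_def)
  have "fps_L k a (f * wt k) = 2 * (u1m4z * fps_theta f * wt k) + 2 * f * (u1m4z * fps_theta (wt k))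
      + of_int a * (u1m4z * (f * wt k)) + of_int (8 * int k - 4) * fps_X * (f * wt k)"
    by (simp add: fps_L_def fps_op_def fps_theta_mult algebra_simps)
  also have "\<dots> = fps_op a f * wt (Suc k)"
    unfolding theta_wt w by (simp add: fps_op_def algebra_simps)
  finally show ?thesis ..
qed

lemma fps_X2_mult_nth: "fps_nth (fps_X ^ 2 * f) (Suc (Suc k)) = fps_nth f k" for f :: "'a::comm_ring_1 fps"
  by (simp add: fps_X_power_mult_nth)

text \<open>Twice \<open>cnum_rec\<close> as an identity of generating functions; the doubling
  completes (2k+1)(k+1)(2k+3) to three consecutive factors, one for each
  \<open>fps_op\<close>.\<close>

lemma Cgf_ode:
  "2 * (u1m4z * fps_theta (Cgf (Suc g))) + (2 - 4 * fps_X) * Cgf (Suc g)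
    = fps_X ^ 2 * fps_op 3 (fps_op 2 (fps_op 1 (Cgf g)))" (is "?L = ?R")
proof (rule fps_ext)
  fix n
  have L: "fps_nth ?L n = (2 * int n + 2) * int (cnum (Suc g) n)
     - (if n = 0 then 0 else (8 * int n - 4) * int (cnum (Suc g) (n - 1)))"
  proof -
    have "?L = 2 * (u1m4z * fps_theta (Cgf (Suc g)) + Cgf (Suc g) - 2 * (fps_X * Cgf (Suc g)))"
      by (simp add: algebra_simps)
    then show ?thesis
      by (cases n) (simp_all add: numeral_fps_const u1m4z_mult_nth fps_theta_nth Cgf_def algebra_simps)
  qed
  consider "n = 0" | "n = 1" | k where "n = Suc (Suc k)" by (metis One_nat_def not0_implies_Suc)
  then show "fps_nth ?L n = fps_nth ?R n"
  proof cases
    case 3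
    have "real (k + 3) * real (cnum (Suc g) (k + 2)) = 2 * real (2*k + 3) * real (cnum (Suc g) (k + 1))
     + real (2*k + 3) * real (k + 1) * real (2*k + 1) * real (cnum g k)"
      using cnum_rec[of k "Suc g"] by simp
    then have "real ((k + 3) * cnum (Suc g) (k + 2)) = real (2 * (2*k + 3) * cnum (Suc g) (k + 1)
     + (2*k + 3) * (k + 1) * (2*k + 1) * cnum g k)"
      by (simp only: of_nat_mult of_nat_add of_nat_numeral)
    then have "int ((k + 3) * cnum (Suc g) (k + 2)) = int (2 * (2*k + 3) * cnum (Suc g) (k + 1)
     + (2*k + 3) * (k + 1) * (2*k + 1) * cnum g k)"
      unfolding of_nat_eq_iff .
    then have "(int k + 3) * int (cnum (Suc g) n) = 2 * (2 * int k + 3) * int (cnum (Suc g) (Suc k))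
     + (2 * int k + 3) * (int k + 1) * (2 * int k + 1) * int (cnum g k)"
      using 3 by (simp add: algebra_simps)
    moreover have "fps_nth ?R n = 2 * ((2 * int k + 3) * (int k + 1) * (2 * int k + 1) * int (cnum g k))"
      unfolding 3 fps_X2_mult_nth fps_op_nth by (simp add: Cgf_def algebra_simps)
    moreover have "fps_nth ?L n = 2 * ((int k + 3) * int (cnum (Suc g) n)) - 2 * (2 * (2 * int k + 3) * int (cnum (Suc g) (Suc k)))"
      unfolding L using 3 by (simp add: algebra_simps)
    ultimately show ?thesis by simp
  next
    case 2
    then show ?thesis unfolding L by (simp add: cnum_at_0 cnum_eq_0 fps_X_power_mult_nth)
  next
    case 1
    then show ?thesis unfolding L by (simp add: cnum_at_0 fps_X_power_mult_nth)
  qed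
qed

lemma Pfps_wt: "Pfps g = Cgf g * wt (3*g)"
  by (simp add: Pfps_alt wt_def mult.assoc)

text \<open>With G = g+1, moving the derivative past the weight adds 24G - 4 to the coefficient of
  the linear term, and the -4 already present makes it 24G - 8.\<close>

lemma Pfps_ode_lhs:
  "(2 * (u1m4z * fps_theta (Cgf (Suc g))) + (2 - 4 * fps_X) * Cgf (Suc g)) * wt (3 * Suc g)
    = 2 * (u1m4z * fps_theta (Pfps (Suc g))) + (2 + of_int (24 * int (Suc g) - 8) * fps_X) * Pfps (Suc g)"
proof -
  have "u1m4z * fps_theta (Pfps (Suc g)) = u1m4z * fps_theta (Cgf (Suc g)) * wt (3 * Suc g)
      + Cgf (Suc g) * (u1m4z * fps_theta (wt (3 * Suc g)))"
    by (simp add: Pfps_wt fps_theta_mult algebra_simps del: mult_Suc_right)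
  also note theta_wt
  finally have "2 * (u1m4z * fps_theta (Pfps (Suc g))) + (2 + of_int (24 * int (Suc g) - 8) * fps_X) * Pfps (Suc g)
     = 2 * (u1m4z * fps_theta (Cgf (Suc g)) * wt (3 * Suc g)
      + Cgf (Suc g) * (of_int (2 - 4 * int (3 * Suc g)) * fps_X * wt (3 * Suc g)))
      + (2 + of_int (24 * int (Suc g) - 8) * fps_X) * (Cgf (Suc g) * wt (3 * Suc g))"
    by (simp only: Pfps_wt)
  then show ?thesis by (simp add: algebra_simps)
qed

lemma Pfps_ode:
  assumes "g > 0"
  shows "2 * (u1m4z * fps_theta (Pfps (Suc g))) + (2 + of_int (24 * int (Suc g) - 8) * fps_X) * Pfps (Suc g)
    = fps_X ^ 2 * fps_L (3*g+2) 3 (fps_L (3*g+1) 2 (fps_L (3*g) 1 (Pfps g)))"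
proof -
  have "fps_L (3*g+2) 3 (fps_L (3*g+1) 2 (fps_L (3*g) 1 (Pfps g)))
     = fps_op 3 (fps_op 2 (fps_op 1 (Cgf g))) * wt (3 * Suc g)"
    by (simp add: Pfps_wt flip: fps_op_wt) (simp add: eval_nat_numeral flip: fps_op_wt)
  then show ?thesis
    by (simp only: Pfps_ode_lhs[symmetric] Cgf_ode mult.assoc)
qed

text \<open>Genus 0 does not provide a polynomial to start from, so the source term is computed in
  closed form. With S = (1-4z)^(-1/2), the operator 2\<theta>+2 takes C_0 to 2S, and
  (2\<theta>+3)(2\<theta>+1) takes S to 3S/(1-4z)^2; the weight \<open>wt 3\<close> turns the result
  into the constant 6.\<close>

lemma Pfps_ode_1:
  "2 * (u1m4z * fps_theta (Pfps 1)) + (2 + 16 * fps_X) * Pfps 1 = 6 * fps_X ^ 2"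
proof -
  let ?u = "u1m4z :: int fps" and ?S = inv_sqrt_1m4z
  \<comment> \<open>Multiplied by z, the operator 2\<theta>+2 becomes a plain derivative of 2 z C_0,
    which is 1 - (1-4z)^(1/2).\<close>
  have "fps_X * fps_op 2 (Cgf 0) = fps_theta (2 * (fps_X * Cgf 0))"
    by (simp add: fps_op_def fps_theta_def algebra_simps)
  also have "2 * (fps_X * Cgf 0) = 1 - wt 1" using Cgf_0_sqrt by (simp add: wt_def algebra_simps)
  also have "fps_theta (1 - wt 1) = - fps_theta (wt 1)" by (simp add: fps_theta_def)
  finally have "?u * (fps_X * fps_op 2 (Cgf 0)) = - (?u * fps_theta (wt 1))" by simp
  also have "\<dots> = ?u * (fps_X * (2 * ?S))" unfolding theta_wt by (simp add: wt_def algebra_simps)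
  finally have 1: "fps_op 2 (Cgf 0) = 2 * ?S" using u1m4z_nonzero[where 'a = int] by simp
  have 2: "?u * fps_op 1 ?S = ?S"
  proof -
    have "?u * fps_op 1 ?S = 2 * (?u * fps_theta ?S) + ?u * ?S" by (simp add: fps_op_def algebra_simps)
    also have "\<dots> = ?S" unfolding theta_inv_sqrt by (simp add: u1m4z_def algebra_simps)
    finally show ?thesis .
  qed
  have "?u * fps_theta (fps_op 1 ?S) = fps_theta ?S + 4 * fps_X * fps_op 1 ?S"
    using arg_cong[OF 2, of fps_theta] by (simp add: fps_theta_mult theta_u1m4z algebra_simps)
  then have "?u * (?u * fps_theta (fps_op 1 ?S)) = ?u * fps_theta ?S + 4 * fps_X * (?u * fps_op 1 ?S)"
    by (simp add: algebra_simps)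
  also have "\<dots> = 6 * fps_X * ?S" unfolding 2 theta_inv_sqrt by (simp add: algebra_simps)
  finally have 3: "?u * (?u * fps_theta (fps_op 1 ?S)) = 6 * fps_X * ?S" .
  have "?u * (?u * fps_op 3 (fps_op 1 ?S)) = 2 * (?u * (?u * fps_theta (fps_op 1 ?S))) + 3 * (?u * (?u * fps_op 1 ?S))"
    unfolding fps_op_def[of 3] by (simp add: algebra_simps)
  also have "\<dots> = 3 * ?S" unfolding 3 2 by (simp add: u1m4z_def algebra_simps)
  finally have 4: "?u * (?u * fps_op 3 (fps_op 1 ?S)) = 3 * ?S" .
  have "fps_op 3 (fps_op 2 (fps_op 1 (Cgf 0))) = 2 * fps_op 3 (fps_op 1 ?S)"
    unfolding fps_op_commute[of 2 1] 1 by (simp add: fps_op_def fps_theta_def algebra_simps)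
  then have "fps_op 3 (fps_op 2 (fps_op 1 (Cgf 0))) * wt 3 = 2 * (?u * (?u * fps_op 3 (fps_op 1 ?S))) * (?u * ?S)"
    by (simp add: wt_def eval_nat_numeral algebra_simps)
  also have "\<dots> = 6 * (?u * (?S * ?S))" unfolding 4 by (simp add: algebra_simps)
  finally have 5: "fps_op 3 (fps_op 2 (fps_op 1 (Cgf 0))) * wt 3 = 6" by (simp add: inv_sqrt_square)
  have "2 * (?u * fps_theta (Pfps 1)) + (2 + 16 * fps_X) * Pfps 1
      = fps_X ^ 2 * fps_op 3 (fps_op 2 (fps_op 1 (Cgf 0))) * wt 3"
    using Pfps_ode_lhs[of 0] Cgf_ode[of 0] by simp
  also have "\<dots> = 6 * fps_X ^ 2" unfolding mult.assoc 5 by (rule mult.commute)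
  finally show ?thesis .
qed

section \<open>The polynomials of given genus\<close>

lemma Pfps_nth_low:
  assumes "h < 2*g"
  shows "fps_nth (Pfps g) h = 0"
  using assms unfolding Pfps_wt fps_mult_nth by (intro sum.neutral) (auto simp: Cgf_def cnum_eq_0)

lemma wt_nth_0: "fps_nth (wt k) 0 = 1"
  by (simp add: wt_def fps_power_zeroth inv_sqrt_1m4z_def)

lemma Pfps_nth_lowest: "fps_nth (Pfps g) (2*g) = int (cnum g (2*g))"
proof -
  have "fps_nth (Pfps g) (2*g) = (\<Sum>i=0..2*g. fps_nth (Cgf g) i * fps_nth (wt (3*g)) (2*g - i))"
    unfolding Pfps_wt fps_mult_nth ..
  also have "\<dots> = (\<Sum>i\<in>{2*g}. fps_nth (Cgf g) i * fps_nth (wt (3*g)) (2*g - i))"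
    by (rule sum.mono_neutral_right) (auto simp: Cgf_def cnum_eq_0)
  finally show ?thesis by (simp add: wt_nth_0 Cgf_def)
qed

lemma fps_L_nth_Suc:
  "fps_nth (fps_L k a f) (Suc h) = (2 * int (Suc h) + a) * fps_nth f (Suc h)
     + (8 * int k - 4 - 8 * int h - 4 * a) * fps_nth f h"
proof -
  have "fps_L k a f = u1m4z * fps_op a f + fps_const (8 * int k - 4) * (fps_X * f)"
    by (simp add: fps_L_def mult.assoc flip: fps_of_int)
  then show ?thesis by (simp add: u1m4z_mult_nth fps_op_nth algebra_simps)
qed

text \<open>In general the operator raises the degree by one. The new top coefficient, at
  \<open>d\<close>, is the one of \<open>f\<close> at \<open>d - 1\<close> times 8k + 4 - 8d - 4a;
  the second alternative of the hypothesis says that this factor vanishes.\<close>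

lemma fps_L_vanish:
  assumes "\<And>h. h \<ge> d \<Longrightarrow> fps_nth f h = 0" "h > d \<or> h = d \<and> d > 0 \<and> 2 * int k + 1 = 2 * int d + a"
  shows "fps_nth (fps_L k a f) h = 0"
proof -
  obtain j where j: "h = Suc j" using assms(2) by (cases h) auto
  show ?thesis
  proof (cases "h > d")
    case True
    then show ?thesis using assms(1)[of h] assms(1)[of j] j by (simp add: fps_L_nth_Suc)
  next
    case False
    then have e: "8 * int k - 4 - 8 * int j - 4 * a = 0" and f: "fps_nth f (Suc j) = 0"
      using assms j by auto
    show ?thesis unfolding j fps_L_nth_Suc e f by simp
  qed
qed

lemma ode_lhs_nth_Suc:
  fixes f :: "int fps"
  shows "fps_nth (2 * (u1m4z * fps_theta f) + (2 + of_int c * fps_X) * f) (Suc h)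
     = (2 * int (Suc h) + 2) * fps_nth f (Suc h) + (c - 8 * int h) * fps_nth f h"
proof -
  have "2 * (u1m4z * fps_theta f) + (2 + of_int c * fps_X) * f
      = fps_const 2 * (u1m4z * fps_theta f + f) + fps_const c * (fps_X * f)"
    by (simp add: algebra_simps numeral_fps_const flip: fps_of_int)
  then show ?thesis by (simp add: u1m4z_mult_nth fps_theta_nth algebra_simps)
qed

text \<open>The coefficient of \<open>f\<close> at \<open>h + 1\<close> is coupled to the one at
  \<open>h\<close> by 8(d-1) - 8h, which is zero at h = d - 1. From degree \<open>d\<close> on the
  coefficients are thus independent of the lower ones and vanish with those of
  \<open>R\<close>.\<close>

lemma vanish_from_ode:
  assumes ode: "2 * (u1m4z * fps_theta f) + (2 + of_int (8 * int d - 8) * fps_X) * f = (R :: int fps)"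
    and R: "\<And>h. h \<ge> d \<Longrightarrow> fps_nth R h = 0" and "d > 0" "h \<ge> d"
  shows "fps_nth f h = 0"
  using \<open>h \<ge> d\<close>
proof (induction h rule: dec_induct)
  case base
  obtain e where "d = Suc e" using \<open>d > 0\<close> gr0_conv_Suc by blast
  then show ?case using ode_lhs_nth_Suc[of f "8 * int d - 8" e] R[of d] unfolding ode by simp
next
  case (step h)
  then show ?case using ode_lhs_nth_Suc[of f "8 * int d - 8" h] R[of "Suc h"] unfolding ode by simp
qed

lemma Pfps_nth_high:
  assumes "g > 0" "h \<ge> 3*g"
  shows "fps_nth (Pfps g) h = 0"
  using assms
proof (induction g arbitrary: h)
  case (Suc g)
  show ?case
  proof (cases "g = 0")
    case True
    show ?thesis
      using Suc.prems True Pfps_ode_1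
      by (intro vanish_from_ode[of "Pfps (Suc g)" 3 "6 * fps_X ^ 2"]) (auto simp: fps_X_power_nth numeral_fps_const)
  next
    case False
    let ?L1 = "fps_L (3*g) 1 (Pfps g)"
    let ?L2 = "fps_L (3*g+1) 2 ?L1"
    let ?L3 = "fps_L (3*g+2) 3 ?L2"
    \<comment> \<open>The leading term cancels for \<open>a = 1\<close> and \<open>a = 3\<close> but
      not for \<open>a = 2\<close>, so the bound rises by one; \<open>fps_X ^ 2\<close> adds the two
      missing to reach \<open>3 * Suc g\<close>.\<close>
    have L1: "fps_nth ?L1 h = 0" if "h \<ge> 3*g" for h
      by (rule fps_L_vanish[where d = "3*g"]) (use Suc.IH False that in auto)
    have L2: "fps_nth ?L2 h = 0" if "h \<ge> 3*g+1" for h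
      by (rule fps_L_vanish[where d = "3*g"]) (use L1 that in auto)
    have L3: "fps_nth ?L3 h = 0" if "h \<ge> 3*g+1" for h
      by (rule fps_L_vanish[where d = "3*g+1"]) (use L2 that in auto)
    have R: "fps_nth (fps_X ^ 2 * ?L3) h = 0" if "h \<ge> 3 * Suc g" for h
      using L3[of "h - 2"] that by (simp add: fps_X_power_mult_nth)
    have e: "8 * int (3 * Suc g) - 8 = 24 * int (Suc g) - 8" by simp
    show ?thesis
      by (rule vanish_from_ode[OF _ R, of "Pfps (Suc g)"]) (use Suc.prems False Pfps_ode[of g] in \<open>simp_all only: e\<close>, auto)
  qed
qed simp

section \<open>Real polynomials and their values at 1/4\<close>

definition rfps :: "int fps \<Rightarrow> real fps" where
  "rfps f = Abs_fps (\<lambda>n. real_of_int (fps_nth f n))"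

lemma rfps_nth: "fps_nth (rfps f) n = real_of_int (fps_nth f n)"
  by (simp add: rfps_def)

lemma rfps_add: "rfps (f + g) = rfps f + rfps g"
  and rfps_diff: "rfps (f - g) = rfps f - rfps g"
  and rfps_sum: "rfps (sum F A) = (\<Sum>i\<in>A. rfps (F i))"
  by (rule fps_ext; simp add: rfps_nth fps_sum_nth)+

lemma rfps_mult: "rfps (f * g) = rfps f * rfps g"
  by (rule fps_ext) (simp add: rfps_nth fps_mult_nth)

lemma rfps_1: "rfps 1 = 1" and rfps_X: "rfps fps_X = fps_X"
  and rfps_of_int: "rfps (of_int c) = fps_const (real_of_int c)"
  by (rule fps_ext; simp add: rfps_nth fps_X_nth flip: fps_of_int)+

lemma rfps_numeral: "rfps (numeral k) = fps_const (numeral k)"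
  using rfps_of_int[of "numeral k"] by simp

lemma rfps_power: "rfps (f ^ n) = rfps f ^ n"
  by (induction n) (simp_all add: rfps_1 rfps_mult)

lemma rfps_u1m4z: "rfps u1m4z = u1m4z"
  unfolding u1m4z_alt by (simp add: rfps_diff rfps_1 rfps_mult rfps_X numeral_fps_const[symmetric] rfps_numeral)

lemma rfps_theta: "rfps (fps_theta f) = fps_theta (rfps f)"
  by (rule fps_ext) (simp add: rfps_nth fps_theta_nth)

definition Ppoly :: "nat \<Rightarrow> real poly" where
  "Ppoly g = (\<Sum>h<3*g. monom (real_of_int (fps_nth (Pfps g) h)) h)"

lemma fps_of_Ppoly: "g > 0 \<Longrightarrow> fps_of_poly (Ppoly g) = rfps (Pfps g)"
  by (rule fps_ext) (auto simp: Ppoly_def coeff_sum coeff_monom rfps_nth not_less Pfps_nth_high)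

definition poly_theta :: "real poly \<Rightarrow> real poly" where
  "poly_theta p = pCons 0 (pderiv p)"

definition poly_L :: "nat \<Rightarrow> real \<Rightarrow> real poly \<Rightarrow> real poly" where
  "poly_L k a p = [:1, -4:] * (smult 2 (poly_theta p) + smult a p) + smult (8 * real k - 4) (pCons 0 p)"

lemma fps_of_poly_theta: "fps_of_poly (poly_theta p) = fps_theta (fps_of_poly p)"
  by (simp add: poly_theta_def fps_theta_def fps_of_poly_pCons fps_of_poly_pderiv)

lemma fps_of_poly_shift: "fps_of_poly (pCons 0 p) = fps_X * fps_of_poly (p :: real poly)"
  by (simp add: fps_of_poly_pCons mult.commute)

lemma fps_of_poly_u: "fps_of_poly [:1, -4:] = (u1m4z :: real fps)"
  by (simp add: u1m4z_alt fps_of_poly_pCons fps_const_neg[symmetric] algebra_simps del: fps_const_neg)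

lemma rfps_L:
  assumes "fps_of_poly p = rfps f"
  shows "fps_of_poly (poly_L k (real_of_int a) p) = rfps (fps_L k a f)"
  unfolding poly_L_def fps_L_def fps_op_def
  by (simp only: fps_of_poly_mult fps_of_poly_add fps_of_poly_smult fps_of_poly_u fps_of_poly_theta fps_of_poly_shift
      assms rfps_add rfps_mult rfps_u1m4z rfps_theta rfps_of_int rfps_X rfps_numeral)
    (simp add: algebra_simps)

text \<open>The derivative carries the factor 1 - 4z, which vanishes at 1/4; what remains is
  (8k-4)/4.\<close>

lemma poly_L_quarter: "poly (poly_L k a p) (1/4) = (2 * real k - 1) * poly p (1/4)"
  by (simp add: poly_L_def algebra_simps)

definition Pval :: "nat \<Rightarrow> real" where
  "Pval g = poly (Ppoly g) (1/4)"

lemma ode_lhs_quarter: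
  assumes f: "fps_of_poly p = rfps f"
    and ode: "rfps (2 * (u1m4z * fps_theta f) + (2 + of_int c * fps_X) * f) = fps_of_poly R"
  shows "(2 + real_of_int c / 4) * poly p (1/4) = poly R (1/4)"
proof -
  let ?p = "[:1, -4:] * smult 2 (poly_theta p) + (smult 2 p + smult (real_of_int c) (pCons 0 p))"
  have "fps_of_poly ?p = rfps (2 * (u1m4z * fps_theta f) + (2 + of_int c * fps_X) * f)"
    by (simp only: fps_of_poly_mult fps_of_poly_add fps_of_poly_smult fps_of_poly_u fps_of_poly_theta fps_of_poly_shift
      f rfps_add rfps_mult rfps_u1m4z rfps_theta rfps_of_int rfps_X rfps_numeral)
      (simp add: algebra_simps)
  then have "?p = R" unfolding ode by (simp only: fps_of_poly_eq_iff)
  then have "poly ?p (1/4) = poly R (1/4)" by simp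
  then show ?thesis by (simp add: algebra_simps)
qed

lemma Pval_1: "Pval 1 = 1/16"
proof -
  have "rfps (2 * (u1m4z * fps_theta (Pfps 1)) + (2 + of_int 16 * fps_X) * Pfps 1) = fps_of_poly (monom 6 2)"
    using Pfps_ode_1 by (simp add: rfps_mult rfps_power rfps_numeral rfps_X fps_of_poly_monom)
  from ode_lhs_quarter[OF fps_of_Ppoly[of 1] this] show ?thesis
    by (simp add: Pval_def poly_monom power2_eq_square)
qed

text \<open>The factors 6g-1, 6g+1 and 6g+3 are the values of the three operators at 1/4. The square
  of the variable gives 1/16, and the left-hand side of the differential equation gives the divisor
  6(g+1).\<close>

definition Pratio :: "nat \<Rightarrow> real" where
  "Pratio g = (36 * (real g)^2 - 1) * ((6 * real g + 3) / (real g + 1)) / 96"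

lemma Pval_Suc:
  assumes "g > 0"
  shows "Pval (Suc g) = Pratio g * Pval g"
proof -
  let ?R = "monom 1 2 * poly_L (3*g+2) (real_of_int 3) (poly_L (3*g+1) (real_of_int 2) (poly_L (3*g) (real_of_int 1) (Ppoly g)))"
  have "fps_of_poly ?R = rfps (fps_X ^ 2 * fps_L (3*g+2) 3 (fps_L (3*g+1) 2 (fps_L (3*g) 1 (Pfps g))))"
    unfolding fps_of_poly_mult
    by (subst rfps_L[OF rfps_L[OF rfps_L[OF fps_of_Ppoly[OF assms]]]])
      (simp add: rfps_mult rfps_power rfps_X fps_of_poly_monom)
  then have "rfps (2 * (u1m4z * fps_theta (Pfps (Suc g))) + (2 + of_int (24 * int (Suc g) - 8) * fps_X) * Pfps (Suc g)) = fps_of_poly ?R"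
    by (simp only: Pfps_ode[OF assms])
  from ode_lhs_quarter[OF fps_of_Ppoly[of "Suc g"] this]
  have "(2 + real_of_int (24 * int (Suc g) - 8) / 4) * Pval (Suc g)
      = 1/16 * ((2 * real (3*g+2) - 1) * ((2 * real (3*g+1) - 1) * ((2 * real (3*g) - 1) * Pval g)))"
    unfolding poly_mult poly_L_quarter by (simp add: Pval_def poly_monom power2_eq_square)
  also have "2 + real_of_int (24 * int (Suc g) - 8) / 4 = 6 * (real g + 1)" by (simp add: field_simps)
  also have "(2 * real (3*g+2) - 1) * ((2 * real (3*g+1) - 1) * ((2 * real (3*g) - 1) * Pval g))
      = (6 * real g + 3) * ((36 * (real g)^2 - 1) * Pval g)"
    by (simp add: algebra_simps power2_eq_square)
  finally have "Pval (Suc g) = 1/16 * ((6 * real g + 3) * ((36 * (real g)^2 - 1) * Pval g)) / (6 * (real g + 1))"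
    by (simp add: field_simps)
  moreover have "real g + 1 \<noteq> 0" by simp
  ultimately show ?thesis unfolding Pratio_def by (simp add: divide_simps) (simp add: algebra_simps)
qed

text \<open>The fraction equals 6 - 3/(g+1) and is increasing. Monotone ratios amount to
  log-convexity of \<open>Pval\<close>.\<close>

lemma Pratio_mono:
  assumes "0 < a" "a \<le> b"
  shows "Pratio a \<le> Pratio b"
proof -
  have "(real a)^2 \<ge> 1" "(real b)^2 \<ge> 1" using assms by (simp_all add: one_le_power)
  moreover have "(real a)^2 \<le> (real b)^2" using assms by (intro power_mono) auto
  moreover have "(6 * real a + 3) / (real a + 1) \<le> (6 * real b + 3) / (real b + 1)"
    using assms by (simp add: divide_simps algebra_simps)
  ultimately have "(36 * (real a)^2 - 1) * ((6 * real a + 3) / (real a + 1))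
      \<le> (36 * (real b)^2 - 1) * ((6 * real b + 3) / (real b + 1))"
    by (intro mult_mono; (linarith | simp))
  then show ?thesis unfolding Pratio_def by (rule divide_right_mono) simp
qed

text \<open>The two factors are at least 35g and 3, so the bound is far from sharp; g/64 is the
  amount the convolution calls for, namely \<open>real g * Pval 1 / 4\<close>.\<close>

lemma Pratio_gt:
  assumes "0 < g"
  shows "Pratio g > real g / 64"
proof -
  have g: "real g \<ge> 1" using assms by simp
  have "3 \<le> (6 * real g + 3) / (real g + 1)" using g by (simp add: field_simps)
  moreover have "real g \<le> (real g)^2" using g by (simp add: power2_eq_square)
  then have "35 * real g \<le> 36 * (real g)^2 - 1" using g by linarith
  ultimately have "35 * real g * 3 \<le> (36 * (real g)^2 - 1) * ((6 * real g + 3) / (real g + 1))"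
    using g by (intro mult_mono) auto
  also have "\<dots> = 96 * Pratio g"
  proof -
    have "x = 96 * (x / 96)" for x :: real by simp
    then show ?thesis unfolding Pratio_def .
  qed
  finally show ?thesis using g by linarith
qed

lemma Pval_pos: "g > 0 \<Longrightarrow> Pval g > 0"
proof (induction g)
  case (Suc g)
  show ?case
  proof (cases "g = 0")
    case True
    then show ?thesis using Pval_1 by simp
  next
    case False
    have "Pratio g > 0" using Pratio_gt[of g] False by (smt (verit) divide_nonneg_nonneg of_nat_0_le_iff neq0_conv)
    then show ?thesis using Suc False by (simp add: Pval_Suc)
  qed
qed simp

text \<open>By log-convexity a product with fixed index sum grows as the indices move apart. In the
  induction step the left product gains the ratio at \<open>Suc i\<close> and the right one the
  ratio at \<open>i + j\<close>, which is no smaller since \<open>j > 0\<close>.\<close>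

lemma Pval_mult_le: "j > 0 \<Longrightarrow> Pval (Suc i) * Pval j \<le> Pval 1 * Pval (i + j)"
proof (induction i)
  case (Suc i)
  have "Pval (Suc (Suc i)) * Pval j = Pratio (Suc i) * (Pval (Suc i) * Pval j)" by (simp add: Pval_Suc)
  also have "\<dots> \<le> Pratio (i + j) * (Pval 1 * Pval (i + j))"
  proof (rule mult_mono[OF Pratio_mono Suc.IH[OF Suc.prems]])
    show "0 \<le> Pratio (i + j)" using Pratio_gt[of "i + j"] Suc.prems
      by (intro order_trans[OF _ less_imp_le[OF Pratio_gt]]) auto
    show "0 \<le> Pval (Suc i) * Pval j" using Pval_pos[of "Suc i"] Pval_pos[of j] Suc.prems by simp
  qed (use Suc.prems in auto)
  also have "\<dots> = Pval 1 * Pval (Suc i + j)" using Suc.prems by (simp add: Pval_Suc)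
  finally show ?case .
qed simp

text \<open>Each of the \<open>g\<close> products is at most \<open>Pval 1 * Pval g\<close>, in
  total g/16 times \<open>Pval g\<close>, against \<open>4 * Pratio g * Pval g\<close> on the right.
  The 4 is the value of 1/z at 1/4.\<close>

lemma Pval_convolution_lt: "(\<Sum>i=1..g. Pval i * Pval (g + 1 - i)) < 4 * Pval (g + 1)"
proof (cases "g = 0")
  case True
  then show ?thesis using Pval_1 by simp
next
  case False
  have "(\<Sum>i=1..g. Pval i * Pval (g + 1 - i)) \<le> (\<Sum>i=1..g. Pval 1 * Pval g)"
  proof (rule sum_mono)
    fix i assume i: "i \<in> {1..g}"
    then have "Suc (i - 1) = i" "i - 1 + (g + 1 - i) = g" by auto
    then show "Pval i * Pval (g + 1 - i) \<le> Pval 1 * Pval g" using Pval_mult_le[of "g + 1 - i" "i - 1"] i by simp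
  qed
  also have "\<dots> = 4 * (real g / 64 * Pval g)" using Pval_1 by simp
  also have "\<dots> < 4 * (Pratio g * Pval g)" using Pratio_gt[of g] Pval_pos[of g] False by simp
  finally show ?thesis using False by (simp add: Pval_Suc)
qed

text \<open>Genus \<open>g\<close> needs at least \<open>2*g\<close> chords, so on this boundary the
  middle term of \<open>cnum_rec\<close> drops out and a two-term recursion in \<open>g\<close>
  remains.\<close>

lemma cnum_maximal_genus: "real (cnum g (2*g)) = fact (4*g) / (4 ^ g * fact (2*g + 1))"
proof (induction g)
  case 0
  then show ?case by (simp add: cnum_at_0)
next
  case (Suc g)
  have "real (2*g + 3) * real (cnum (Suc g) (2*g + 2)) = real (4*g + 3) * real (2*g + 1) * real (4*g + 1) * real (cnum g (2*g))"
    using cnum_rec[of "2*g" "Suc g"] cnum_eq_0[of "2*g+1" "Suc g"] by simp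
  moreover have "real (2*g + 3) \<noteq> 0" by simp
  ultimately have "real (cnum (Suc g) (2*g + 2)) = real (4*g + 3) * real (2*g + 1) * real (4*g + 1) * real (cnum g (2*g)) / real (2*g + 3)"
    by (metis nonzero_mult_div_cancel_left)
  then have 1: "real (cnum (Suc g) (2*g + 2)) = real (4*g + 3) * real (2*g + 1) * real (4*g + 1) * fact (4*g) / (4 ^ g * fact (2*g + 1) * real (2*g + 3))"
    unfolding Suc by (simp only: times_divide_eq_right divide_divide_eq_left)
  have f1: "(fact (4 * Suc g) :: real) = (4 * real g + 4) * ((4 * real g + 3) * ((4 * real g + 2) * ((4 * real g + 1) * fact (4*g))))"
    by (simp add: eval_nat_numeral algebra_simps)
  have f2: "(fact (2 * Suc g + 1) :: real) = (2 * real g + 3) * ((2 * real g + 2) * fact (2*g + 1))"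
    by (simp add: eval_nat_numeral algebra_simps)
  have "4 * Suc g = 4 * g + 4" "2 * Suc g = 2 * g + 2" by simp_all
  have "real (cnum (Suc g) (2 * Suc g)) = real (cnum (Suc g) (2*g + 2))" by simp
  also have "\<dots> = fact (4 * Suc g) / (4 ^ Suc g * fact (2 * Suc g + 1))"
  proof -
    have "2 * real g + 3 \<noteq> 0" "2 * real g + 2 \<noteq> 0"
      using of_nat_0_le_iff[of g, where 'a = real] by linarith+
    then have n: "4 ^ g * fact (2*g + 1) * real (2*g + 3) \<noteq> (0 :: real)"
      "4 ^ Suc g * ((2 * real g + 3) * ((2 * real g + 2) * fact (2*g + 1))) \<noteq> (0 :: real)"
      by simp_all
    show ?thesis unfolding 1 f1 f2 frac_eq_eq[OF n] by (simp add: algebra_simps del: fact_Suc)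
  qed
  finally show ?case .
qed

text \<open>Deleting the first chord cannot disconnect the diagram here: two parts of total genus
  \<open>g + 1\<close> would need \<open>2*g+2\<close> chords, and only \<open>2*g+1\<close> are
  left.\<close>

lemma cnum2_lowest: "cnum2 g (2*g + 1) = cnum (g + 1) (2*g + 2)"
proof -
  have "cnum i m * cnum (g + 1 - i) (2*g + 1 - m) = 0" if "i \<le> g + 1" "m \<le> 2*g + 1" for i m
  proof (cases "m < 2*i")
    case True
    then show ?thesis by (simp add: cnum_eq_0)
  next
    case False
    then have "2*g + 1 - m < 2 * (g + 1 - i)" using that by linarith
    then show ?thesis by (simp add: cnum_eq_0)
  qed
  then have s: "(\<Sum>m\<le>2*g+1. \<Sum>i\<le>g+1. cnum i m * cnum (g + 1 - i) (2*g + 1 - m)) = 0"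
    by (intro sum.neutral ballI) (simp only: atMost_iff)
  show ?thesis using cnum_Suc[of "g + 1" "2*g + 1"] unfolding s by simp
qed

section \<open>Coefficient asymptotics of rational functions with a pole at 1/4\<close>

definition binfps :: "nat \<Rightarrow> real fps" where
  "binfps m = Abs_fps (\<lambda>n. real (n + m choose m) * 4 ^ n)"

text \<open>By Pascal's rule one factor 1 - 4z lowers the parameter by one.\<close>

lemma u1m4z_power_binfps: "u1m4z ^ Suc m * binfps m = 1"
proof (induction m)
  case 0
  show ?case by (rule fps_ext) (auto simp: u1m4z_mult_nth binfps_def power_eq_if)
next
  case (Suc m)
  have "u1m4z * binfps (Suc m) = binfps m"
  proof (rule fps_ext)
    fix n show "fps_nth (u1m4z * binfps (Suc m)) n = fps_nth (binfps m) n"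
      by (cases n) (auto simp: u1m4z_mult_nth binfps_def algebra_simps)
  qed
  then have "u1m4z ^ Suc (Suc m) * binfps (Suc m) = u1m4z ^ Suc m * binfps m"
    by (simp only: power_Suc2[of _ "Suc m"] mult.assoc)
  with Suc show ?case by (simp only:)
qed

lemma binomial_shift_asymp:
  "(\<lambda>n. real (n - k + m choose m) / real n ^ m) \<longlonglongrightarrow> 1 / fact m"
proof -
  have eq: "real (n - k + m choose m) / real n ^ m = (\<Prod>i<m. (real n - real k + 1 + real i) / real n) / fact m"
    if "n \<ge> k" for n
  proof -
    have "real (n - k + m choose m) = pochhammer (real (n - k + m) - real m + 1) m / fact m"
      by (simp add: binomial_gbinomial gbinomial_pochhammer')
    also have "real (n - k + m) - real m + 1 = real n - real k + 1" using that by (simp add: of_nat_diff)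
    finally show ?thesis by (simp add: pochhammer_prod prod_dividef atLeast0LessThan)
  qed
  have "(\<lambda>n. (\<Prod>i<m. (real n - real k + 1 + real i) / real n) / fact m) \<longlonglongrightarrow> (\<Prod>i<m. 1) / fact m"
  proof (intro tendsto_intros tendsto_prod)
    fix i
    show "(\<lambda>n. (real n - real k + 1 + real i) / real n) \<longlonglongrightarrow> 1" by real_asymp
  qed auto
  then have "(\<lambda>n. (\<Prod>i<m. (real n - real k + 1 + real i) / real n) / fact m) \<longlonglongrightarrow> 1 / fact m" by simp
  moreover have "\<forall>\<^sub>F n in sequentially. (\<Prod>i<m. (real n - real k + 1 + real i) / real n) / fact m = real (n - k + m choose m) / real n ^ m"
    using eventually_ge_at_top[of k] by eventually_elim (rule eq[symmetric])
  ultimately show ?thesis by (rule Lim_transform_eventually)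
qed

text \<open>For \<open>n \<ge> m\<close> the degree bound leaves the fixed window
  \<open>k \<le> m\<close>, in which the coefficient p_k contributes p_k 4^(-k) / m! to the limit of
  \<open>a n / (real n ^ m * 4 ^ n)\<close>. These shares add up to p(1/4)/m!, and a nonzero limit
  yields asymptotic equivalence.\<close>

lemma coeff_asymp_rational:
  fixes a :: "nat \<Rightarrow> real"
  assumes eq: "Abs_fps a * u1m4z ^ Suc m = fps_of_poly p" and deg: "degree p \<le> m" and nz: "poly p (1/4) \<noteq> 0"
  shows "a \<sim>[at_top] (\<lambda>n. poly p (1/4) / fact m * real n ^ m * 4 ^ n)"
proof -
  have "Abs_fps a = Abs_fps a * (u1m4z ^ Suc m * binfps m)" unfolding u1m4z_power_binfps by simp
  also have "\<dots> = fps_of_poly p * binfps m" unfolding mult.assoc[symmetric] eq ..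
  finally have A: "Abs_fps a = fps_of_poly p * binfps m" .
  have an: "a n = (\<Sum>k\<le>m. coeff p k * (real (n - k + m choose m) * 4 ^ (n - k)))" if "n \<ge> m" for n
  proof -
    have "a n = fps_nth (fps_of_poly p * binfps m) n" using A by (metis fps_nth_Abs_fps)
    also have "\<dots> = (\<Sum>k\<le>n. coeff p k * (real (n - k + m choose m) * 4 ^ (n - k)))"
      by (simp add: fps_mult_nth binfps_def atLeast0AtMost)
    also have "\<dots> = (\<Sum>k\<le>m. coeff p k * (real (n - k + m choose m) * 4 ^ (n - k)))"
      by (rule sum.mono_neutral_right) (use that deg in \<open>auto simp: coeff_eq_0\<close>)
    finally show ?thesis .
  qed
  have quot: "(\<Sum>k\<le>m. coeff p k * (1/4) ^ k * (real (n - k + m choose m) / real n ^ m)) = a n / (real n ^ m * 4 ^ n)"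
    if n: "n \<ge> m" "n > 0" for n
  proof -
    have pw: "(1/4) ^ k * (x / real n ^ m) = x * 4 ^ (n - k) / (real n ^ m * 4 ^ n)" if "k \<le> m" for k and x :: real
      using that n power_add[of "4::real" k "n - k"] by (simp add: field_simps power_one_over)
    show ?thesis unfolding an[OF n(1)] sum_divide_distrib
    proof (rule sum.cong[OF refl])
      fix k assume "k \<in> {..m}"
      then show "coeff p k * (1/4) ^ k * (real (n - k + m choose m) / real n ^ m)
          = coeff p k * (real (n - k + m choose m) * 4 ^ (n - k)) / (real n ^ m * 4 ^ n)"
        using pw[of k "real (n - k + m choose m)"] unfolding mult.assoc by simp
    qed
  qed
  have "(\<lambda>n. \<Sum>k\<le>m. coeff p k * (1/4) ^ k * (real (n - k + m choose m) / real n ^ m)) \<longlonglongrightarrow> (\<Sum>k\<le>m. coeff p k * (1/4) ^ k * (1 / fact m))"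
    by (intro tendsto_intros binomial_shift_asymp)
  moreover have "(\<Sum>k\<le>m. coeff p k * (1/4) ^ k * (1 / fact m)) = poly p (1/4) / fact m"
  proof -
    have "poly p (1/4) = (\<Sum>k\<le>m. coeff p k * (1/4) ^ k)"
      unfolding poly_altdef by (rule sum.mono_neutral_left) (use deg in \<open>auto simp: coeff_eq_0\<close>)
    then show ?thesis by (simp add: sum_divide_distrib)
  qed
  moreover have "\<forall>\<^sub>F n in sequentially. (\<Sum>k\<le>m. coeff p k * (1/4) ^ k * (real (n - k + m choose m) / real n ^ m)) = a n / (real n ^ m * 4 ^ n)"
    using eventually_ge_at_top[of m] eventually_gt_at_top[of 0] by eventually_elim (rule quot)
  ultimately have "(\<lambda>n. a n / (real n ^ m * 4 ^ n)) \<longlonglongrightarrow> poly p (1/4) / fact m"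
    by (simp only: Lim_transform_eventually)
  then have "(\<lambda>n. a n / (real n ^ m * 4 ^ n) / (poly p (1/4) / fact m)) \<longlonglongrightarrow> poly p (1/4) / fact m / (poly p (1/4) / fact m)"
    by (rule tendsto_divide) (use nz in auto)
  then have "(\<lambda>n. a n / (poly p (1/4) / fact m * real n ^ m * 4 ^ n)) \<longlonglongrightarrow> 1"
    using nz by (simp add: field_simps)
  then show ?thesis by (intro asymp_equivI')
qed

theorem theorem4p1:
  fixes g :: nat
  shows "\<exists>P2 :: int poly.
     C2gf g * (1 - 4 * fps_X) ^ (3*g+2) = fps_of_poly P2 \<and>
     degree P2 \<le> 3*g+1 \<and>
     poly (map_poly real_of_int P2) (1/4) > 0 \<and>
     (\<forall>h\<le>2*g. coeff P2 h = 0) \<and>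
     fps_X * fps_of_poly P2 = Pfps (g+1) - fps_X * (\<Sum>g1=1..g. Pfps g1 * Pfps (g+1-g1)) \<and>
     coeff P2 (2*g+1) = int (cnum2 g (2*g+1)) \<and>
     cnum2 g (2*g+1) = cnum (g+1) (2*g+2) \<and>
     real (cnum (g+1) (2*g+2)) = fact (4*g+4) / (4^(g+1) * fact (2*g+3)) \<and>
     (\<lambda>n. real (cnum2 g n)) \<sim>[at_top]
       (\<lambda>n. poly (map_poly real_of_int P2) (1/4) / Gamma (real (3*g+2))
              * real n ^ (3*g+1) * 4 ^ n)"
proof -
  define F where "F = C2gf g * u1m4z ^ (3*g+2)"
  define \<Sigma> where "\<Sigma> = (\<Sum>i=1..g. Pfps i * Pfps (g+1-i))"
  have XF: "fps_X * F = Pfps (g+1) - fps_X * \<Sigma>" unfolding F_def \<Sigma>_def by (rule C2gf_eq_Pfps)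
  have F_nth: "fps_nth F h = fps_nth (Pfps (g+1)) (Suc h) - fps_nth \<Sigma> h" for h
    using arg_cong[OF XF, of "\<lambda>f. fps_nth f (Suc h)"] by simp
  \<comment> \<open>P_i is supported on the degrees 2i to 3i-1, so each product lives in degrees
    2g+2 to 3g+1. Degree 2g+1 is left to P_(g+1)/z alone, which settles the lowest
    coefficient.\<close>
  have \<Sigma>_nth: "fps_nth \<Sigma> h = 0" if h: "h \<le> 2*g+1 \<or> h \<ge> 3*g+2" for h
  proof -
    have "fps_nth (Pfps i) a * fps_nth (Pfps (g+1-i)) (h-a) = 0" if "i \<in> {1..g}" "a \<le> h" for i a
    proof (cases "a < 2*i \<or> a \<ge> 3*i")
      case True
      then show ?thesis using Pfps_nth_low[of a i] Pfps_nth_high[of i a] that by auto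
    next
      case False
      then have "h - a < 2 * (g+1-i) \<or> h - a \<ge> 3 * (g+1-i)" using h that by auto
      then show ?thesis using Pfps_nth_low[of "h-a" "g+1-i"] Pfps_nth_high[of "g+1-i" "h-a"] that by auto
    qed
    then show ?thesis unfolding \<Sigma>_def fps_sum_nth fps_mult_nth by (intro sum.neutral ballI) auto
  qed
  define P2 where "P2 = (\<Sum>h\<le>3*g+1. monom (fps_nth F h) h)"
  have cP2: "coeff P2 h = fps_nth F h" for h
  proof (cases "h \<le> 3*g+1")
    case False
    then show ?thesis using F_nth[of h] \<Sigma>_nth[of h] Pfps_nth_high[of "g+1" "Suc h"]
      by (simp add: P2_def coeff_sum coeff_monom)
  qed (simp add: P2_def coeff_sum coeff_monom)
  have F_P2: "F = fps_of_poly P2" by (rule fps_ext) (simp add: cP2)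
  have deg: "degree P2 \<le> 3*g+1"
    unfolding P2_def by (intro degree_sum_le) (auto intro: order_trans[OF degree_monom_le])
  define p where "p = map_poly real_of_int P2"
  have p: "fps_of_poly p = rfps F" unfolding p_def F_P2 by (rule fps_ext) (simp add: rfps_nth coeff_map_poly)
  have degp: "degree p \<le> 3*g+1" 
    unfolding p_def using deg by (intro degree_le) (auto simp: coeff_map_poly coeff_eq_0)
  \<comment> \<open>The relation is carried over to real polynomials with the division by the
    variable cleared, so that 1/4 can be inserted.\<close>
  have "fps_of_poly (pCons 0 p) = fps_of_poly (Ppoly (g+1) - pCons 0 (\<Sum>i=1..g. Ppoly i * Ppoly (g+1-i)))"
  proof -
    have "fps_of_poly (pCons 0 p) = rfps (fps_X * F)" by (simp add: fps_of_poly_pCons p rfps_mult rfps_X mult.commute)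
    also have "\<dots> = rfps (Pfps (g+1)) - fps_X * (\<Sum>i=1..g. rfps (Pfps i) * rfps (Pfps (g+1-i)))"
      unfolding XF by (simp add: \<Sigma>_def rfps_diff rfps_mult rfps_X rfps_sum)
    also have "(\<Sum>i=1..g. rfps (Pfps i) * rfps (Pfps (g+1-i))) = (\<Sum>i=1..g. fps_of_poly (Ppoly i) * fps_of_poly (Ppoly (g+1-i)))"
      by (intro sum.cong refl) (simp add: fps_of_Ppoly)
    finally show ?thesis
      by (simp add: fps_of_Ppoly fps_of_poly_pCons fps_of_poly_diff fps_of_poly_sum fps_of_poly_mult mult.commute)
  qed
  then have "pCons 0 p = Ppoly (g+1) - pCons 0 (\<Sum>i=1..g. Ppoly i * Ppoly (g+1-i))"
    by (simp only: fps_of_poly_eq_iff)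
  from arg_cong[OF this, of "\<lambda>q. poly q (1/4)"]
  have "poly p (1/4) = 4 * Pval (g+1) - (\<Sum>i=1..g. Pval i * Pval (g+1-i))"
    by (simp add: Pval_def poly_sum)
  then have pos: "poly p (1/4) > 0" using Pval_convolution_lt[of g] by simp
  have "Abs_fps (\<lambda>n. real (cnum2 g n)) = rfps (C2gf g)" by (rule fps_ext) (simp add: rfps_nth C2gf_def)
  then have "Abs_fps (\<lambda>n. real (cnum2 g n)) * u1m4z ^ Suc (3*g+1) = fps_of_poly p"
    unfolding p F_def rfps_mult rfps_power rfps_u1m4z by simp
  from coeff_asymp_rational[OF this degp] pos
  have "(\<lambda>n. real (cnum2 g n)) \<sim>[at_top] (\<lambda>n. poly p (1/4) / fact (3*g+1) * real n ^ (3*g+1) * 4 ^ n)"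
    by simp
  moreover have "Gamma (real (3*g+2)) = fact (3*g+1)"
    using Gamma_fact[of "3*g+1", where 'a = real] by (simp add: add.commute)
  ultimately have asym: "(\<lambda>n. real (cnum2 g n)) \<sim>[at_top] (\<lambda>n. poly p (1/4) / Gamma (real (3*g+2)) * real n ^ (3*g+1) * 4 ^ n)"
    by (simp only:)
  have low: "coeff P2 h = 0" if "h \<le> 2*g" for h
    unfolding cP2 F_nth using that \<Sigma>_nth[of h] Pfps_nth_low[of "Suc h" "g+1"] by simp
  have "coeff P2 (2*g+1) = int (cnum (g+1) (2*g+2))"
    unfolding cP2 F_nth using \<Sigma>_nth[of "2*g+1"] Pfps_nth_lowest[of "g+1"] by simp
  moreover have "real (cnum (g+1) (2*g+2)) = fact (4*g+4) / (4^(g+1) * fact (2*g+3))"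
    using cnum_maximal_genus[of "g+1"] by (simp add: eval_nat_numeral)
  ultimately show ?thesis
    using F_P2 XF deg pos asym low cnum2_lowest[of g]
    unfolding F_def \<Sigma>_def p_def u1m4z_def by (intro exI[of _ P2]) auto
qed

end
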